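(* For every real $\lambda>\mu_{\rm taxi}^4-1$, the hard-core model on $\mathbb{Z}^2$ with activity $\lambda$ admits multiple Gibbs measures; that is, there exist at least two distinct Gibbs measures for the hard-core model with parameter $\lambda$ on $\mathbb{Z}^2$. Here $\mu_{\rm taxi}$ is the taxi walk connective constant.
   Context: $\mathbb{Z}^2$ denotes the nearest-neighbour graph with vertex set $\mathbb{Z}\times\mathbb{Z}$, in which two vertices are adjacent if they differ in exactly one coordinate, and differ by $\pm1$ in that coordinate. For a graph $G=(V,E)$, $\mathcal{I}(G)$ is the set of independent sets of $G$, a subset of $\{0,1\}^V$ equipped with the cylinder $\sigma$-algebra. Gibbs measures: let $G=(V,E)$ be infinite and locally finite and $\lambda>0$. A probability measure $\mu$ on $\mathcal{I}(G)$ is a Gibbs measure for the hard-core model with parameter (activity) $\lambda$ on $G$ if for every finite $\Lambda\subset V$, every $J\in\mathcal{I}(G)$ and $\mu$-almost every $I\in\mathcal{I}(G)$, writing $\bar\Lambda=V\setminus\Lambda$, the conditional probability of $J$ given that the configuration off $\Lambda$ is $I\cap\bar\Lambda$ satisfies $$\mu(J\mid I\cap\bar\Lambda)=\begin{cases}\dfrac{\lambda^{|J\cap\Lambda|}}{Z^I_{\Lambda,\lambda}} & \text{if } I\cap\bar\Lambda=J\cap\bar\Lambda,\\[2mm] 0 & \text{otherwise,}\end{cases}\qquad Z^I_{\Lambda,\lambda}=\sum_{K\in\mathcal{I}(G):\,K\cap\bar\Lambda=I\cap\bar\Lambda}\lambda^{|K\cap\Lambda|}.$$ Taxi walks: let $\vec{\mathbb{Z}}^2$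 (the Manhattan lattice) be the orientation of $\mathbb{Z}^2$ in which an edge parallel to the $x$-axis is oriented in the positive $x$-direction if its $y$-coordinate is even and in the negative $x$-direction otherwise, and an edge parallel to the $y$-axis is oriented in the positive $y$-direction if its $x$-coordinate is even and in the negative $y$-direction otherwise. A self-avoiding walk of length $n$ in $\vec{\mathbb{Z}}^2$ starting at $v_0$ is a sequence $v_0,v_1,\ldots,v_n$ of distinct vertices such that, for each $i=1,\dots,n$, $v_{i-1}v_i$ is an edge oriented from $v_{i-1}$ to $v_i$. It turns at $v_i$ ($1\le i\le n-1$) if the edges $v_{i-1}v_i$ and $v_iv_{i+1}$ are perpendicular. A taxi walk is a self-avoiding walk in $\vec{\mathbb{Z}}^2$ that does not turn at two consecutive vertices. Let $c_n$ be the number of taxi walks of length $n$ starting at the origin. The taxi walk connective constant is $\mu_{\rm taxi}=\lim_{n\to\infty}c_n^{1/n}$ (this limit exists). *)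

theory Defs
  imports "HOL-Probability.Probability"
begin

text \<open>A graph is given by its adjacency relation; its vertex set is the whole type.
  Configurations are subsets of the vertex set rather than elements of \<open>{0,1}\<^sup>V\<close>;
  the map \<open>\<lambda>I v. v \<in> I\<close> translates between the two.\<close>

definition independent_sets :: "('v \<Rightarrow> 'v \<Rightarrow> bool) \<Rightarrow> 'v set set" where
  "independent_sets adj = {I. \<forall>u\<in>I. \<forall>v\<in>I. \<not> adj u v}"

definition cylinder_algebra :: "('v \<Rightarrow> 'v \<Rightarrow> bool) \<Rightarrow> 'v set measure" where
  "cylinder_algebra adj =
     vimage_algebra (independent_sets adj) (\<lambda>I v. v \<in> I)
       (\<Pi>\<^sub>M v\<in>UNIV. count_space (UNIV :: bool set))"

definition off_algebra :: "('v \<Rightarrow> 'v \<Rightarrow> bool) \<Rightarrow> 'v set \<Rightarrow> 'v set measure" where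
  "off_algebra adj \<Lambda> =
     vimage_algebra (independent_sets adj) (\<lambda>I. I \<inter> - \<Lambda>) (cylinder_algebra adj)"

definition regular_cond_prob ::
    "'a measure \<Rightarrow> 'a measure \<Rightarrow> ('a \<Rightarrow> 'a measure) \<Rightarrow> bool" where
  "regular_cond_prob M F \<kappa> \<longleftrightarrow>
     \<kappa> \<in> F \<rightarrow>\<^sub>M prob_algebra M \<and>
     (\<forall>A\<in>sets M. AE x in M. real_cond_exp M F (indicat_real A) x = measure (\<kappa> x) A)"

definition hc_partition :: "('v \<Rightarrow> 'v \<Rightarrow> bool) \<Rightarrow> real \<Rightarrow> 'v set \<Rightarrow> 'v set \<Rightarrow> real" where
  "hc_partition adj l \<Lambda> I =
     (\<Sum>K | K \<in> independent_sets adj \<and> K \<inter> - \<Lambda> = I \<inter> - \<Lambda>. l ^ card (K \<inter> \<Lambda>))"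

text \<open>The prescribed value of the conditional probability of \<open>J\<close> is required for all \<open>J\<close>
  simultaneously, outside one null set of \<open>I\<close>: if the null set could depend on \<open>J\<close>, then for
  an atomless \<open>\<mu>\<close> the condition would say nothing. Hence conditional probabilities are taken
  from a regular version. On a countable vertex set such versions exist and
  are almost surely unique, so the choice of \<open>\<kappa>\<close> does not matter.\<close>

definition hc_gibbs :: "('v \<Rightarrow> 'v \<Rightarrow> bool) \<Rightarrow> real \<Rightarrow> 'v set measure \<Rightarrow> bool" where
  "hc_gibbs adj l \<mu> \<longleftrightarrow>
     prob_space \<mu> \<and> sets \<mu> = sets (cylinder_algebra adj) \<and>
     (\<forall>\<Lambda>. finite \<Lambda> \<longrightarrow>
       (\<exists>\<kappa>. regular_cond_prob \<mu> (off_algebra adj \<Lambda>) \<kappa> \<and>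
         (AE I in \<mu>. \<forall>J\<in>independent_sets adj.
            measure (\<kappa> I) {J} =
              (if I \<inter> - \<Lambda> = J \<inter> - \<Lambda>
               then l ^ card (J \<inter> \<Lambda>) / hc_partition adj l \<Lambda> I else 0))))"

text \<open>The conditioning algebra is a genuine sub-algebra, so \<^const>\<open>real_cond_exp\<close> is not used
  outside its intended domain.\<close>

lemma subalgebra_off_algebra:
  assumes "sets \<mu> = sets (cylinder_algebra adj)"
  shows "subalgebra \<mu> (off_algebra adj \<Lambda>)"
proof -
  let ?X = "independent_sets adj" and ?C = "cylinder_algebra adj"
  let ?P = "\<Pi>\<^sub>M v\<in>UNIV. count_space (UNIV :: bool set)"
  have sp: "space ?C = ?X" by (simp add: cylinder_algebra_def)
  have *: "(\<lambda>I v. v \<in> I) \<in> ?C \<rightarrow>\<^sub>M ?P"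
    unfolding cylinder_algebra_def by (rule measurable_vimage_algebra1) (auto simp: space_PiM)
  have coord: "(\<lambda>I. v \<in> I) \<in> ?C \<rightarrow>\<^sub>M count_space UNIV" for v
    using measurable_compose[OF * measurable_component_singleton[of v UNIV]] by simp
  have "(\<lambda>I v. v \<in> I \<inter> - \<Lambda>) \<in> ?C \<rightarrow>\<^sub>M ?P"
  proof (rule measurable_PiM_single')
    fix v :: 'a
    show "(\<lambda>I. v \<in> I \<inter> - \<Lambda>) \<in> ?C \<rightarrow>\<^sub>M count_space UNIV"
      using coord[of v] by (cases "v \<in> \<Lambda>") simp_all
  qed (auto simp: space_PiM)
  moreover have "(\<lambda>I. I \<inter> - \<Lambda>) \<in> space ?C \<rightarrow> ?X"
    unfolding sp by (auto simp: independent_sets_def)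
  ultimately have m: "(\<lambda>I. I \<inter> - \<Lambda>) \<in> ?C \<rightarrow>\<^sub>M ?C"
    by (subst (2) cylinder_algebra_def) (rule measurable_vimage_algebra2)
  have "space \<mu> = ?X" using sets_eq_imp_space_eq[OF assms] sp by simp
  moreover have "sets (off_algebra adj \<Lambda>) \<subseteq> sets ?C"
  proof
    fix B assume B: "B \<in> sets (off_algebra adj \<Lambda>)"
    have "(\<lambda>I. I \<inter> - \<Lambda>) \<in> ?X \<rightarrow> space ?C"
      unfolding sp by (auto simp: independent_sets_def)
    from B[unfolded off_algebra_def sets_vimage_algebra2[OF this]]
    obtain A where "A \<in> sets ?C" "B = (\<lambda>I. I \<inter> - \<Lambda>) -` A \<inter> ?X" by auto
    then show "B \<in> sets ?C"
      using measurable_sets[OF m, of A] by (simp add: sp)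
  qed
  ultimately show ?thesis
    by (simp add: subalgebra_def off_algebra_def assms)
qed

type_synonym vertex = "int \<times> int"

fun z2_adj :: "vertex \<Rightarrow> vertex \<Rightarrow> bool" where
  "z2_adj (x, y) (x', y') \<longleftrightarrow>
     (\<bar>x - x'\<bar> = 1 \<and> y = y') \<or> (x = x' \<and> \<bar>y - y'\<bar> = 1)"

fun manhattan_edge :: "vertex \<Rightarrow> vertex \<Rightarrow> bool" where
  "manhattan_edge (x, y) (x', y') \<longleftrightarrow>
     (y' = y \<and> x' = (if even y then x + 1 else x - 1)) \<or>
     (x' = x \<and> y' = (if even x then y + 1 else y - 1))"

fun perpendicular :: "vertex \<Rightarrow> vertex \<Rightarrow> bool" where
  "perpendicular (a, b) (c, d) \<longleftrightarrow> a * c + b * d = 0"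

text \<open>A walk of length \<open>n\<close> is the list of its \<open>n + 1\<close> vertices.\<close>

definition manhattan_saws :: "nat \<Rightarrow> vertex \<Rightarrow> vertex list set" where
  "manhattan_saws n v\<^sub>0 =
     {w. length w = n + 1 \<and> w ! 0 = v\<^sub>0 \<and> distinct w \<and>
         (\<forall>i\<in>{1..n}. manhattan_edge (w ! (i - 1)) (w ! i))}"

definition turns_at :: "vertex list \<Rightarrow> nat \<Rightarrow> bool" where
  "turns_at w i \<longleftrightarrow> 1 \<le> i \<and> i + 1 < length w \<and>
     perpendicular (w ! i - w ! (i - 1)) (w ! (i + 1) - w ! i)"

definition taxi_walks :: "nat \<Rightarrow> vertex \<Rightarrow> vertex list set" where
  "taxi_walks n v\<^sub>0 =
     {w \<in> manhattan_saws n v\<^sub>0. \<forall>i. \<not> (turns_at w i \<and> turns_at w (i + 1))}"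

definition taxi_count :: "nat \<Rightarrow> nat" where
  "taxi_count n = card (taxi_walks n (0, 0))"

definition mu_taxi :: real where
  "mu_taxi = lim (\<lambda>n. root n (real (taxi_count n)))"

end

theory Submission
  imports Defs
begin

text \<open>Call a vertex of the square lattice even or odd according to the parity of the sum of its
  coordinates. The two Gibbs measures are limits of finite-volume measures whose boundary condition
  occupies all even, respectively all odd, vertices, and a Peierls argument tells them apart.

  Let \<open>S\<close> be a long horizontal row of \<open>M\<close> odd vertices with spacing two, and let \<open>S'\<close> be \<open>S\<close> moved one step to the
  right, a row of even vertices. If a configuration with even boundary condition occupies all of \<open>S\<close>,
  then \<open>S\<close> lies in a finite region \<open>W\<close> such that every edge leaving \<open>W\<close> goes from an even
  vertex of \<open>W\<close> to an odd vertex outside and has both ends unoccupied. Moving the part of the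
  configuration inside \<open>W\<close> one step to the right keeps it independent, turns \<open>S\<close> into
  \<open>S'\<close>, and frees every vertex on the left boundary of \<open>W\<close>; these vertices may be filled in at
  will. If \<open>W\<close> has \<open>4u\<close> boundary edges, then exactly \<open>u\<close> vertices are freed, so the
  configurations with region \<open>W\<close> have total weight at most \<open>1 / (1 + \<lambda>)\<^sup>u\<close> times the
  weight of those that occupy \<open>S'\<close> (\<open>shift_gain\<close>).

  The number of possible \<open>W\<close> is controlled by taxi walks. The midpoints of the edges of the
  square lattice, in suitably rotated coordinates, are the vertices of the Manhattan lattice, and
  following the boundary of \<open>W\<close> with its even side on the left means walking along the
  orientation of that lattice. Two consecutive turns would mean that \<open>W\<close> contains an even
  vertex none of whose neighbours is in \<open>W\<close>, or misses an odd vertex all of whose neighbours are in \<open>W\<close>;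
  removing the one or adding the other shortens the boundary. So a region with shortest boundary
  gives a taxi walk of length \<open>4u - 1\<close>, and there are at most \<open>4u c\<^bsub>4u-1\<^esub>\<close>
  regions (\<open>card_minimal_regions\<close>). Each has at least \<open>M\<close> columns, hence \<open>u \<ge> M\<close>, and
  \<open>\<Sum>u\<ge>M. 4u c\<^bsub>4u-1\<^esub> / (1 + \<lambda>)\<^sup>u\<close> tends to zero with growing \<open>M\<close> because
  \<open>\<mu>\<^sub>t\<^sub>a\<^sub>x\<^sub>i\<^sup>4 < 1 + \<lambda>\<close> (\<open>peierls_sum_small\<close>).

  A shortest boundary is a single cycle for the following reason. The boundary edges are permuted by
  the map that follows the boundary. A subset invariant under this map defines a height function, its
  winding number. If the subset is proper and nonempty, then the winding numbers of the subset and of its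
  complement add up to the indicator function of \<open>W\<close>. One of them is positive at a prescribed vertex, and the region
  where it is positive has a strictly smaller boundary (\<open>contour_split\<close>). Hence a region with
  minimal boundary has a boundary consisting of one orbit.

  With \<open>M\<close> so large that the sum is at most \<open>1/2\<close>, occupying \<open>S\<close> has at most half the probability of
  occupying \<open>S'\<close> under the even boundary condition. The reflection that exchanges \<open>S\<close> and \<open>S'\<close>
  exchanges the parities, so the opposite inequality holds for the odd boundary condition. Both
  inequalities survive in the limits (\<open>gibbs_limit_exists\<close>), where occupying \<open>S\<close> has positive
  probability. Hence the limits differ.\<close>

section \<open>Counting taxi walks\<close>

text \<open>The symmetry of the Manhattan lattice that takes \<open>(a, b)\<close> to the origin: translating by an odd
  amount reverses the streets of the other direction, and a reflection in that direction repairs this.\<close>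

fun to_origin :: "vertex \<Rightarrow> vertex \<Rightarrow> vertex" where
  "to_origin (a, b) (x, y) =
     ((if even b then x - a else a - x), (if even a then y - b else b - y))"

lemma to_origin_self: "to_origin v v = (0, 0)"
  by (cases v) simp

lemma inj_to_origin: "inj (to_origin v)"
  by (cases v) (auto intro!: injI split: if_splits)

lemma manhattan_edge_to_origin:
  "manhattan_edge u u' \<Longrightarrow> manhattan_edge (to_origin v u) (to_origin v u')"
  by (cases v; cases u; cases u') (auto split: if_splits)

lemma perpendicular_to_origin:
  "perpendicular (to_origin v u - to_origin v u') (to_origin v w - to_origin v w') =
   perpendicular (u - u') (w - w')"
  by (cases v; cases u; cases u'; cases w; cases w') (auto simp: algebra_simps)

text \<open>Indices are shifted to start at \<open>0\<close>, which makes taking and dropping initial parts of a walk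
  easy.\<close>

lemma taxi_walks_iff:
  "w \<in> taxi_walks n v \<longleftrightarrow> length w = n + 1 \<and> w ! 0 = v \<and> distinct w \<and>
     (\<forall>i<n. manhattan_edge (w ! i) (w ! Suc i)) \<and>
     (\<forall>i. i + 3 < n + 1 \<longrightarrow>
        \<not> (perpendicular (w ! (i+1) - w ! i) (w ! (i+2) - w ! (i+1)) \<and>
           perpendicular (w ! (i+2) - w ! (i+1)) (w ! (i+3) - w ! (i+2))))"
    (is "?L \<longleftrightarrow> ?R")
proof -
  have 1: "(\<forall>i\<in>{1..n}. manhattan_edge (w ! (i - 1)) (w ! i)) \<longleftrightarrow>
        (\<forall>i<n. manhattan_edge (w ! i) (w ! Suc i))"
  proof (intro iffI allI ballI impI)
    fix i assume *: "\<forall>i\<in>{1..n}. manhattan_edge (w ! (i - 1)) (w ! i)" "i < n"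
    show "manhattan_edge (w ! i) (w ! Suc i)" using *(1)[rule_format, of "Suc i"] *(2) by simp
  next
    fix i assume *: "\<forall>i<n. manhattan_edge (w ! i) (w ! Suc i)" "i \<in> {1..n}"
    show "manhattan_edge (w ! (i - 1)) (w ! i)" using *(1)[rule_format, of "i - 1"] *(2) by (cases i) auto
  qed
  have 2: "(\<forall>i. \<not> (turns_at w i \<and> turns_at w (i + 1))) \<longleftrightarrow>
     (\<forall>i. i + 3 < n + 1 \<longrightarrow>
        \<not> (perpendicular (w ! (i+1) - w ! i) (w ! (i+2) - w ! (i+1)) \<and>
           perpendicular (w ! (i+2) - w ! (i+1)) (w ! (i+3) - w ! (i+2))))" (is "?A \<longleftrightarrow> ?B")
    if "length w = n + 1"
  proof (intro iffI allI impI)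
    fix i assume ?A "i + 3 < n + 1"
    then show "\<not> (perpendicular (w ! (i+1) - w ! i) (w ! (i+2) - w ! (i+1)) \<and>
           perpendicular (w ! (i+2) - w ! (i+1)) (w ! (i+3) - w ! (i+2)))"
      using that by (auto simp: turns_at_def numeral_eq_Suc dest!: spec[of _ "i+1"])
  next
    fix i assume ?B
    then show "\<not> (turns_at w i \<and> turns_at w (i + 1))"
      using that
      by (cases i) (auto simp: turns_at_def numeral_eq_Suc)
  qed
  show ?thesis
    unfolding taxi_walks_def manhattan_saws_def using 1 2 by auto
qed

lemma finite_taxi_walks: "finite (taxi_walks n v)"
proof -
  obtain a b where v: "v = (a, b)" by (cases v)
  let ?B = "{a - int n..a + int n} \<times> {b - int n..b + int n}"
  have "taxi_walks n v \<subseteq> {w. set w \<subseteq> ?B \<and> length w = n + 1}"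
  proof (clarify, intro conjI)
    fix w assume w: "w \<in> taxi_walks n v"
    have *: "i \<le> n \<Longrightarrow> w ! i \<in> {a - int i..a + int i} \<times> {b - int i..b + int i}" for i
    proof (induction i)
      case 0 then show ?case using w v by (simp add: taxi_walks_iff)
    next
      case (Suc i)
      then have "manhattan_edge (w ! i) (w ! Suc i)" using w by (simp add: taxi_walks_iff)
      then show ?case using Suc
        by (cases "w ! i"; cases "w ! Suc i") (auto split: if_splits)
    qed
    show "length w = n + 1" using w by (simp add: taxi_walks_iff)
    show "set w \<subseteq> ?B"
    proof
      fix z assume "z \<in> set w"
      then obtain i where i: "i \<le> n" "z = w ! i"
        using \<open>length w = n + 1\<close> by (auto simp: in_set_conv_nth less_Suc_eq_le)
      then show "z \<in> ?B" using *[OF i(1)] by (auto simp: mem_Times_iff)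
    qed
  qed
  then show ?thesis
    by (rule finite_subset) (intro finite_lists_length_eq finite_cartesian_product finite_atLeastAtMost_int)
qed

lemma card_taxi_walks_le: "card (taxi_walks n v) \<le> taxi_count n"
  unfolding taxi_count_def
proof (rule card_inj_on_le[of "map (to_origin v)"])
  show "inj_on (map (to_origin v)) (taxi_walks n v)"
    using inj_mapI[OF inj_to_origin] by (rule inj_on_subset) simp
  show "map (to_origin v) ` taxi_walks n v \<subseteq> taxi_walks n (0, 0)"
  proof (clarify)
    fix w assume w: "w \<in> taxi_walks n v"
    then have l: "length w = n + 1" by (simp add: taxi_walks_iff)
    have nth: "i \<le> n \<Longrightarrow> map (to_origin v) w ! i = to_origin v (w ! i)" for i
      using l by simp
    have "inj_on (to_origin v) (set w)"
      by (rule inj_on_subset[OF inj_to_origin]) simp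
    then show "map (to_origin v) w \<in> taxi_walks n (0, 0)"
      using w unfolding taxi_walks_iff
      by (auto simp: nth perpendicular_to_origin distinct_map to_origin_self
           simp del: perpendicular.simps manhattan_edge.simps intro!: manhattan_edge_to_origin)
  qed
qed (rule finite_taxi_walks)

text \<open>A walk is determined by its first \<open>m\<close> steps and the remaining \<open>n\<close> steps, and both parts are
  taxi walks; the second part starts anywhere, which does not increase the count.\<close>

lemma taxi_count_submult: "taxi_count (m + n) \<le> taxi_count m * taxi_count n"
proof -
  let ?S = "SIGMA w:taxi_walks m (0, 0). taxi_walks n (w ! m)"
  let ?f = "\<lambda>w :: vertex list. (take (m + 1) w, drop m w)"
  have "taxi_count (m + n) \<le> card ?S"
    unfolding taxi_count_def
  proof (rule card_inj_on_le)
    show "inj_on ?f (taxi_walks (m + n) (0, 0))"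
    proof (rule inj_onI)
      fix w w' :: "vertex list" assume "?f w = ?f w'"
      then have *: "take (m + 1) w = take (m + 1) w'" "drop m w = drop m w'" by auto
      from *(1) have "take m (take (m + 1) w) = take m (take (m + 1) w')" by (rule arg_cong)
      then have "take m w = take m w'" by simp
      with *(2) show "w = w'" by (metis append_take_drop_id)
    qed
    show "?f ` taxi_walks (m + n) (0, 0) \<subseteq> ?S"
    proof clarify
      fix w assume w: "w \<in> taxi_walks (m + n) (0, 0)"
      have t: "take (m + 1) w \<in> taxi_walks m (0, 0)"
        using w unfolding taxi_walks_iff by auto
      have d: "drop m w \<in> taxi_walks n (take (m + 1) w ! m)"
        unfolding taxi_walks_iff
      proof (intro conjI allI impI)
        fix i assume "i + 3 < n + 1"
        then have "(m + i) + 3 < (m + n) + 1" by simp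
        moreover have "\<forall>j. j + 3 < (m + n) + 1 \<longrightarrow>
            \<not> (perpendicular (w ! (j+1) - w ! j) (w ! (j+2) - w ! (j+1)) \<and>
               perpendicular (w ! (j+2) - w ! (j+1)) (w ! (j+3) - w ! (j+2)))"
          using w unfolding taxi_walks_iff by blast
        ultimately have "\<not> (perpendicular (w ! (m + i + 1) - w ! (m + i)) (w ! (m + i + 2) - w ! (m + i + 1)) \<and>
               perpendicular (w ! (m + i + 2) - w ! (m + i + 1)) (w ! (m + i + 3) - w ! (m + i + 2)))"
          by blast
        moreover have "drop m w ! k = w ! (m + k)" for k
          using w by (intro nth_drop) (simp add: taxi_walks_iff)
        ultimately show "\<not> (perpendicular (drop m w ! (i+1) - drop m w ! i)
             (drop m w ! (i+2) - drop m w ! (i+1)) \<and>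
           perpendicular (drop m w ! (i+2) - drop m w ! (i+1))
             (drop m w ! (i+3) - drop m w ! (i+2)))"
          by (simp only: add.assoc) blast
      qed (use w in \<open>auto simp: taxi_walks_iff\<close>)
      show "take (m + 1) w \<in> taxi_walks m (0, 0) \<and> drop m w \<in> taxi_walks n (take (m + 1) w ! m)"
        using t d by simp
    qed
    show "finite ?S" by (auto intro: finite_taxi_walks)
  qed
  also have "card ?S = (\<Sum>w\<in>taxi_walks m (0, 0). card (taxi_walks n (w ! m)))"
    by (simp add: finite_taxi_walks)
  also have "\<dots> \<le> (\<Sum>w\<in>taxi_walks m (0, 0). taxi_count n)"
    by (intro sum_mono card_taxi_walks_le)
  finally show ?thesis by (simp add: taxi_count_def)
qed

lemma taxi_count_pos: "1 \<le> taxi_count n"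
proof -
  let ?w = "map (\<lambda>i. (int i, 0)) [0..<n + 1]"
  have "?w \<in> taxi_walks n (0, 0)"
    unfolding taxi_walks_iff by (auto simp: distinct_map inj_on_def simp del: upt_Suc)
  then show ?thesis
    unfolding taxi_count_def
    by (metis One_nat_def Suc_leI card_gt_0_iff empty_iff finite_taxi_walks)
qed

text \<open>Fekete's lemma. The limit is the infimum \<open>L\<close> of the roots: if \<open>root k (c k) < r\<close>, then writing
  \<open>n = q k + s\<close> with \<open>s < k\<close> gives \<open>c n \<le> r ^ (q k) * c s\<close>.\<close>

lemma submultiplicative_root_limit:
  fixes c :: "nat \<Rightarrow> real"
  assumes ge1: "\<And>n. 1 \<le> c n" and sub: "\<And>m n. c (m + n) \<le> c m * c n"
  obtains L where "1 \<le> L" "(\<lambda>n. root n (c n)) \<longlonglongrightarrow> L"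
    and "\<And>r. L < r \<Longrightarrow> \<exists>C>0. \<forall>n. c n \<le> C * r ^ n"
proof -
  define L where "L = Inf ((\<lambda>n. root n (c n)) ` {1..})"
  have root1: "1 \<le> root n (c n)" if "n \<ge> 1" for n using that ge1[of n] by simp
  have L1: "1 \<le> L" unfolding L_def using root1 by (intro cINF_greatest) auto
  have bb: "bdd_below ((\<lambda>n. root n (c n)) ` {1..})" using root1 by (intro bdd_belowI2[of _ 1]) auto
  have Lle: "L \<le> root n (c n)" if "n \<ge> 1" for n
    unfolding L_def using that bb by (intro cINF_lower) auto
  have bound: "\<exists>C>0. \<forall>n. c n \<le> C * r ^ n" if r: "L < r" for r
  proof -
    have "\<exists>k\<in>{1..}. root k (c k) < r"
      using r bb unfolding L_def by (subst (asm) cINF_less_iff) auto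
    then obtain k where k: "k \<ge> 1" "root k (c k) < r" by auto
    have r1: "1 \<le> r" using r L1 by simp
    have "c k = root k (c k) ^ k" using k(1) ge1[of k] by simp
    also have "\<dots> \<le> r ^ k" using k ge1[of k] by (intro power_mono) auto
    finally have ck: "c k \<le> r ^ k" .
    \<comment> \<open>The length is split into blocks of length \<open>k\<close>.\<close>
    have pow: "c (q * k + s) \<le> (r ^ k) ^ q * c s" for q s
    proof (induction q)
      case (Suc q)
      have "c (Suc q * k + s) \<le> c k * c (q * k + s)"
        using sub[of k "q * k + s"] by (simp add: algebra_simps)
      also have "\<dots> \<le> r ^ k * ((r ^ k) ^ q * c s)"
        using Suc ck ge1[of k] ge1[of "q*k+s"] by (intro mult_mono) auto
      finally show ?case by (simp add: mult.assoc)
    qed simp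
    define C where "C = (\<Sum>s<k. c s)"
    have "c n \<le> C * r ^ n" for n
    proof -
      have "c n = c ((n div k) * k + n mod k)" by simp
      also have "\<dots> \<le> (r ^ k) ^ (n div k) * c (n mod k)" by (rule pow)
      also have "\<dots> \<le> r ^ n * C"
      proof (rule mult_mono)
        show "(r ^ k) ^ (n div k) \<le> r ^ n"
          unfolding power_mult[symmetric] using r1 by (intro power_increasing) auto
        show "c (n mod k) \<le> C"
          unfolding C_def using k(1) ge1 by (intro member_le_sum) (auto intro: order_trans[OF zero_le_one])
      qed (use r1 order_trans[OF zero_le_one ge1] in auto)
      finally show ?thesis by (simp add: mult.commute)
    qed
    moreover have "C > 0"
      unfolding C_def using k(1) ge1 by (intro sum_pos) (auto intro: less_le_trans[OF zero_less_one] simp: lessThan_empty_iff)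
    ultimately show ?thesis by blast
  qed
  have lim: "(\<lambda>n. root n (c n)) \<longlonglongrightarrow> L"
  proof (rule order_tendstoI)
    fix a assume "a < L"
    then show "eventually (\<lambda>n. a < root n (c n)) sequentially"
      using Lle by (intro eventually_sequentiallyI[of 1]) (auto intro: less_le_trans)
  next
    fix a assume a: "L < a"
    define r where "r = (L + a) / 2"
    have r: "L < r" "r < a" "0 < r" using a L1 by (auto simp: r_def)
    obtain C where C: "C > 0" "\<And>n. c n \<le> C * r ^ n" using bound[OF r(1)] by blast
    have "(\<lambda>n. root n C) \<longlonglongrightarrow> 1" by (rule LIMSEQ_root_const) fact
    then have "eventually (\<lambda>n. root n C < a / r) sequentially"
      by (rule order_tendstoD) (use r in simp)
    then show "eventually (\<lambda>n. root n (c n) < a) sequentially"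
      using eventually_ge_at_top[of 1]
    proof eventually_elim
      case (elim n)
      have "root n (c n) \<le> root n (C * r ^ n)" using C elim by simp
      also have "\<dots> = root n C * r"
        using elim r by (simp add: real_root_mult real_root_power_cancel)
      also have "\<dots> < a" using elim(1) r by (simp add: field_simps)
      finally show ?case .
    qed
  qed
  show thesis using that[OF L1 lim bound] .
qed

lemma mu_taxi_ge_1: "1 \<le> mu_taxi"
  and taxi_count_le_power: "mu_taxi < r \<Longrightarrow> \<exists>C>0. \<forall>n. real (taxi_count n) \<le> C * r ^ n"
proof -
  have s: "real (taxi_count (m + n)) \<le> real (taxi_count m) * real (taxi_count n)" for m n
    using taxi_count_submult[of m n] by (metis of_nat_le_iff of_nat_mult)
  obtain L where L: "1 \<le> L" "(\<lambda>n. root n (real (taxi_count n))) \<longlonglongrightarrow> L"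
    "\<And>r. L < r \<Longrightarrow> \<exists>C>0. \<forall>n. real (taxi_count n) \<le> C * r ^ n"
    by (rule submultiplicative_root_limit[of "\<lambda>n. real (taxi_count n)"])
      (use taxi_count_pos s in \<open>auto simp: Suc_le_eq\<close>)
  have "mu_taxi = L" unfolding mu_taxi_def using L(2) by (rule limI)
  then show "1 \<le> mu_taxi" "mu_taxi < r \<Longrightarrow> \<exists>C>0. \<forall>n. real (taxi_count n) \<le> C * r ^ n"
    using L by auto
qed

section \<open>Limits of measures on configurations\<close>

text \<open>Tychonoff's theorem. The index set may be uncountable, so that the limit is taken along a filter
  finer than \<open>sequentially\<close> instead of a subsequence.\<close>

lemma cluster_point_of_bounded_functions:
  fixes f :: "nat \<Rightarrow> 'e \<Rightarrow> real"
  assumes "\<And>n e. f n e \<in> {0..1}"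
  obtains G g where "G \<noteq> bot" "G \<le> sequentially" "\<And>e. ((\<lambda>n. f n e) \<longlongrightarrow> g e) G"
proof -
  let ?K = "PiE UNIV (\<lambda>_ :: 'e. {0..1 :: real})"
  have "compactin (product_topology (\<lambda>_. euclidean) UNIV) ?K"
    by (subst compactin_PiE) (simp add: compactin_euclidean_iff)
  then have "compact ?K"
    by (simp add: euclidean_product_topology compactin_euclidean_iff)
  moreover have "eventually (\<lambda>x. x \<in> ?K) (filtermap f sequentially)"
    using assms by (simp add: eventually_filtermap PiE_UNIV_domain)
  ultimately obtain g where g: "inf (nhds g) (filtermap f sequentially) \<noteq> bot"
    unfolding compact_filter by (metis filtermap_bot_iff sequentially_bot)
  define G where "G = inf (filtercomap f (nhds g)) sequentially"
  have "G \<noteq> bot"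
  proof
    assume "G = bot"
    then have "eventually (\<lambda>_. False) G" by simp
    then obtain Q R where QR: "eventually Q (filtercomap f (nhds g))" "eventually R sequentially"
      "\<And>n. Q n \<Longrightarrow> R n \<Longrightarrow> False" unfolding G_def eventually_inf by auto
    then obtain P where P: "eventually P (nhds g)" "\<And>n. P (f n) \<Longrightarrow> Q n"
      unfolding eventually_filtercomap by auto
    have "eventually (\<lambda>x. \<not> P x) (filtermap f sequentially)"
      unfolding eventually_filtermap using QR(2) by eventually_elim (use QR(3) P(2) in blast)
    with P(1) have "eventually (\<lambda>_. False) (inf (nhds g) (filtermap f sequentially))"
      unfolding eventually_inf by auto
    with g show False by (simp add: trivial_limit_def)
  qed
  moreover have "G \<le> sequentially" by (simp add: G_def)
  moreover have "((\<lambda>n. f n e) \<longlongrightarrow> g e) G" for e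
  proof -
    have f: "filterlim f (nhds g) G"
      unfolding G_def by (rule filterlim_mono[OF filterlim_filtercomap order_refl inf_le1])
    show ?thesis
      by (rule continuous_on_tendsto_compose[OF continuous_on_product_coordinates f]) simp_all
  qed
  ultimately show thesis using that by blast
qed

lemma space_cylinder_algebra [simp]: "space (cylinder_algebra adj) = independent_sets adj"
  by (simp add: cylinder_algebra_def)

lemma in_sets_cylinder_algebra [measurable]:
  "{I \<in> independent_sets adj. v \<in> I} \<in> sets (cylinder_algebra adj)"
proof -
  have "(\<lambda>I v. v \<in> I) \<in> cylinder_algebra adj \<rightarrow>\<^sub>M (\<Pi>\<^sub>M v\<in>UNIV. count_space (UNIV :: bool set))"
    unfolding cylinder_algebra_def by (rule measurable_vimage_algebra1) (auto simp: space_PiM)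
  from measurable_compose[OF this measurable_component_singleton[of v]]
  have "(\<lambda>I. v \<in> I) \<in> cylinder_algebra adj \<rightarrow>\<^sub>M count_space UNIV" by simp
  from measurable_sets[OF this, of "{True}"] show ?thesis
    by (simp add: vimage_def Int_def conj_commute)
qed

lemma measurable_cylinder_algebraI:
  assumes "\<And>x. x \<in> space M \<Longrightarrow> f x \<in> independent_sets adj"
    and "\<And>v. {x \<in> space M. v \<in> f x} \<in> sets M"
  shows "f \<in> M \<rightarrow>\<^sub>M cylinder_algebra adj"
  unfolding cylinder_algebra_def
proof (rule measurable_vimage_algebra2)
  show "(\<lambda>x v. v \<in> f x) \<in> M \<rightarrow>\<^sub>M (\<Pi>\<^sub>M v\<in>UNIV. count_space UNIV)"
    using assms(2) by (intro measurable_PiM_single') (auto simp: pred_def)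
qed (use assms in auto)

lemma sets_independent:
  fixes f :: "'a \<Rightarrow> 'v :: countable set"
  assumes "\<And>v. {x \<in> space M. v \<in> f x} \<in> sets M"
  shows "{x \<in> space M. f x \<in> independent_sets adj} \<in> sets M"
proof -
  have [measurable]: "Measurable.pred M (\<lambda>x. v \<in> f x)" for v using assms by (simp add: pred_def)
  have "Measurable.pred M (\<lambda>x. \<forall>u v. u \<in> f x \<longrightarrow> v \<in> f x \<longrightarrow> \<not> adj u v)" by measurable
  then show ?thesis by (simp add: pred_def independent_sets_def Ball_def imp_conjL)
qed

lemma empty_independent [simp]: "{} \<in> independent_sets adj"
  by (simp add: independent_sets_def)

text \<open>The empty set serves as default value on the event that \<open>f x\<close> is not independent.\<close>

lemma measurable_cylinder_algebra_if:
  fixes f :: "'a \<Rightarrow> 'v :: countable set"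
  assumes m: "\<And>v. {x \<in> space M. v \<in> f x} \<in> sets M"
  shows "(\<lambda>x. if f x \<in> independent_sets adj then f x else {}) \<in> M \<rightarrow>\<^sub>M cylinder_algebra adj"
proof (rule measurable_cylinder_algebraI)
  fix v
  have "{x \<in> space M. v \<in> (if f x \<in> independent_sets adj then f x else {})} =
      {x \<in> space M. v \<in> f x} \<inter> {x \<in> space M. f x \<in> independent_sets adj}" by auto
  also have "\<dots> \<in> sets M" using m sets_independent[OF m] by (intro sets.Int)
  finally show "{x \<in> space M. v \<in> (if f x \<in> independent_sets adj then f x else {})} \<in> sets M" .
qed simp

lemma trace_event_sets:
  assumes m: "\<And>v. {x \<in> space M. v \<in> f x} \<in> sets M" and J: "finite J"
  shows "{x \<in> space M. f x \<inter> J = a} \<in> sets M"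
proof -
  have [measurable]: "Measurable.pred M (\<lambda>x. v \<in> f x)" for v using m by (simp add: pred_def)
  have "Measurable.pred M (\<lambda>x. (\<forall>v\<in>J. (v \<in> f x) = (v \<in> a)) \<and> a \<subseteq> J)"
    using J by measurable
  moreover have "f x \<inter> J = a \<longleftrightarrow> (\<forall>v\<in>J. (v \<in> f x) = (v \<in> a)) \<and> a \<subseteq> J" for x by blast
  ultimately show ?thesis by (simp add: pred_def)
qed

lemma local_event_sets:
  assumes "finite J"
  shows "{I \<in> independent_sets adj. I \<inter> J = a} \<in> sets (cylinder_algebra adj)"
  using trace_event_sets[of "cylinder_algebra adj" "\<lambda>I. I" J a] assms in_sets_cylinder_algebra by simp

lemma finite_trace_sum:
  assumes "finite J"
  shows "(\<Sum>a\<in>{a \<in> Pow J. Q a}. measure_pmf.prob p {I. I \<inter> J = a}) = measure_pmf.prob p {I. Q (I \<inter> J)}"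
proof -
  have "measure_pmf.prob p (\<Union>a\<in>{a \<in> Pow J. Q a}. {I. I \<inter> J = a}) =
      (\<Sum>a\<in>{a \<in> Pow J. Q a}. measure_pmf.prob p {I. I \<inter> J = a})"
    using assms by (intro measure_pmf.finite_measure_finite_Union) (auto simp: disjoint_family_on_def)
  moreover have "(\<Union>a\<in>{a \<in> Pow J. Q a}. {I. I \<inter> J = a}) = {I. Q (I \<inter> J)}" by auto
  ultimately show ?thesis by simp
qed

text \<open>A cluster point of the functions \<open>E \<mapsto> prob (p n) E\<close> on all sets of configurations is finitely
  additive. Its values on events that depend on finitely many vertices form a projective family,
  and the Daniell-Kolmogorov theorem extends them to a measure. The coordinates are
  represented by the reals \<open>0\<close> and \<open>1\<close> because that theorem is about Polish spaces.\<close>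

lemma limit_measure_exists:
  fixes p :: "nat \<Rightarrow> 'v :: countable set pmf" and adj :: "'v \<Rightarrow> 'v \<Rightarrow> bool"
  assumes supp: "\<And>n. set_pmf (p n) \<subseteq> independent_sets adj"
  obtains G \<mu> where "G \<noteq> bot" "G \<le> sequentially" "prob_space \<mu>" "sets \<mu> = sets (cylinder_algebra adj)"
    and "\<And>J a. finite J \<Longrightarrow>
      ((\<lambda>n. measure_pmf.prob (p n) {I. I \<inter> J = a}) \<longlongrightarrow> measure \<mu> {I \<in> independent_sets adj. I \<inter> J = a}) G"
proof -
  obtain G \<rho> where G: "G \<noteq> bot" "G \<le> sequentially"
    and lim: "\<And>E. ((\<lambda>n. measure_pmf.prob (p n) E) \<longlongrightarrow> \<rho> E) G"
    by (rule cluster_point_of_bounded_functions[of "\<lambda>n E. measure_pmf.prob (p n) E"]) auto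
  have \<rho>0: "0 \<le> \<rho> E" for E
    by (rule tendsto_lowerbound[OF lim _ G(1)]) simp
  have uniq: "x = y" if "(f \<longlongrightarrow> x) G" "(f \<longlongrightarrow> y) G" for f :: "nat \<Rightarrow> real" and x y
    using tendsto_unique[OF G(1) that] .
  have \<rho>_local: "(\<Sum>a\<in>{a \<in> Pow J. Q a}. \<rho> {I. I \<inter> J = a}) = \<rho> {I. Q (I \<inter> J)}" if "finite J" for J Q
  proof (rule uniq)
    show "((\<lambda>n. measure_pmf.prob (p n) {I. Q (I \<inter> J)}) \<longlongrightarrow> \<rho> {I. Q (I \<inter> J)}) G" by (rule lim)
    show "((\<lambda>n. measure_pmf.prob (p n) {I. Q (I \<inter> J)}) \<longlongrightarrow> (\<Sum>a\<in>{a \<in> Pow J. Q a}. \<rho> {I. I \<inter> J = a})) G"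
      unfolding finite_trace_sum[OF that, symmetric] by (intro tendsto_sum lim)
  qed
  have \<rho>_UNIV: "\<rho> UNIV = 1"
    by (rule uniq[OF lim]) simp
  define q where "q J = embed_pmf (\<lambda>a. if a \<subseteq> J then \<rho> {I. I \<inter> J = a} else 0)" for J :: "'v set"
  have pmf_q: "pmf (q J) a = (if a \<subseteq> J then \<rho> {I. I \<inter> J = a} else 0)" if "finite J" for J a
    unfolding q_def
  proof (rule pmf_embed_pmf)
    have "(\<integral>\<^sup>+a. ennreal (if a \<subseteq> J then \<rho> {I. I \<inter> J = a} else 0) \<partial>count_space UNIV) =
        (\<Sum>a\<in>Pow J. ennreal (\<rho> {I. I \<inter> J = a}))"
      using that by (subst nn_integral_count_space'[of "Pow J"]) (auto intro!: sum.cong)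
    also have "\<dots> = ennreal (\<Sum>a\<in>Pow J. \<rho> {I. I \<inter> J = a})" using \<rho>0 by (simp add: sum_ennreal)
    also have "(\<Sum>a\<in>Pow J. \<rho> {I. I \<inter> J = a}) = 1" using \<rho>_local[OF that, of "\<lambda>_. True"] \<rho>_UNIV by (simp add: Pow_def)
    finally show "(\<integral>\<^sup>+a. ennreal (if a \<subseteq> J then \<rho> {I. I \<inter> J = a} else 0) \<partial>count_space UNIV) = 1" by simp
  qed (simp add: \<rho>0)
  have q_sub: "set_pmf (q J) \<subseteq> Pow J" if "finite J" for J
    using pmf_q[OF that] by (auto simp: set_pmf_iff split: if_splits)
  have prob_q: "measure_pmf.prob (q J) {a. Q a} = \<rho> {I. Q (I \<inter> J)}" if "finite J" for J Q
  proof -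
    have "measure_pmf.prob (q J) {a. Q a} = measure_pmf.prob (q J) ({a. Q a} \<inter> Pow J)"
      using q_sub[OF that] by (intro measure_pmf.finite_measure_eq_AE) (auto simp: AE_measure_pmf_iff)
    also have "\<dots> = (\<Sum>a\<in>{a \<in> Pow J. Q a}. pmf (q J) a)"
      using that by (subst measure_measure_pmf_finite) (auto intro!: sum.cong)
    also have "\<dots> = \<rho> {I. Q (I \<inter> J)}"
      using \<rho>_local[OF that, of Q] by (simp add: pmf_q[OF that])
    finally show ?thesis .
  qed
  have q_proj: "q J = map_pmf (\<lambda>a. a \<inter> J) (q H)" if "J \<subseteq> H" "finite H" for J H
  proof (rule pmf_eqI)
    fix a
    have fJ: "finite J" using that finite_subset by blast
    have "pmf (map_pmf (\<lambda>a. a \<inter> J) (q H)) a = measure_pmf.prob (q H) {b. b \<inter> J = a}"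
      by (simp add: pmf_map vimage_def)
    also have "\<dots> = \<rho> {I. I \<inter> H \<inter> J = a}" by (rule prob_q[OF that(2)])
    also have "{I. I \<inter> H \<inter> J = a} = {I. I \<inter> J = a}" using that(1) by (simp add: Int_assoc Int_absorb1)
    also have "\<rho> {I. I \<inter> J = a} = measure_pmf.prob (q J) {b. b = a}" using prob_q[OF fJ, of "\<lambda>b. b = a"] by simp
    finally show "pmf (q J) a = pmf (map_pmf (\<lambda>a. a \<inter> J) (q H)) a" by (simp add: measure_pmf_single)
  qed
  define P where "P J = distr (measure_pmf (q J)) (\<Pi>\<^sub>M v\<in>J. (borel :: real measure)) (\<lambda>a. \<lambda>v\<in>J. indicator a v)" for J :: "'v set"
  have meas_ind: "(\<lambda>a. \<lambda>v\<in>J. indicator a v) \<in> measure_pmf (q H) \<rightarrow>\<^sub>M (\<Pi>\<^sub>M v\<in>J. (borel :: real measure))" for J H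
    by (auto simp: space_PiM)
  have P_proj: "P J = distr (P H) (\<Pi>\<^sub>M v\<in>J. borel) (\<lambda>f. restrict f J)"
    if JH: "J \<subseteq> H" "finite H" for J H
  proof -
    have "P J = distr (measure_pmf (q H)) (\<Pi>\<^sub>M v\<in>J. borel) (\<lambda>a. \<lambda>v\<in>J. indicator a v)"
      unfolding P_def q_proj[OF JH] map_pmf_rep_eq
      by (subst distr_distr) (auto simp: space_PiM comp_def indicator_def intro!: distr_cong)
    also have "\<dots> = distr (P H) (\<Pi>\<^sub>M v\<in>J. borel) (\<lambda>f. restrict f J)"
      unfolding P_def distr_distr[OF measurable_restrict_subset[OF JH(1)] meas_ind]
      using JH(1) by (simp add: comp_def Int_absorb1)
    finally show ?thesis .
  qed
  have P_prob: "prob_space (P J)" for J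
    unfolding P_def by (rule measure_pmf.prob_space_distr[OF meas_ind])
  interpret polish_projective UNIV P
    unfolding polish_projective_def projective_family_def using P_proj P_prob by blast
  define dec where "dec \<omega> = {v. \<omega> v = (1 :: real)}" for \<omega> :: "'v \<Rightarrow> real"
  have dec_meas: "{\<omega> \<in> space lim. v \<in> dec \<omega>} \<in> sets lim" for v
  proof -
    have "(\<lambda>\<omega>. \<omega> v) \<in> lim \<rightarrow>\<^sub>M borel"
      unfolding measurable_cong_sets[OF sets_lim refl] by (rule measurable_component_singleton) simp
    from measurable_sets[OF this, of "{1}"] show ?thesis
      by (simp add: dec_def vimage_def Int_def conj_commute)
  qed
  have lim_local: "measure lim {\<omega> \<in> space lim. dec \<omega> \<inter> J = a} = \<rho> {I. I \<inter> J = a}" if J: "finite J" for J a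
  proof -
    let ?X = "{f \<in> space (\<Pi>\<^sub>M v\<in>J. (borel :: real measure)). {v \<in> J. f v = 1} = a}"
    have X: "?X \<in> sets (\<Pi>\<^sub>M v\<in>J. borel)"
    proof -
      have "Measurable.pred (\<Pi>\<^sub>M v\<in>J. (borel :: real measure)) (\<lambda>f. \<forall>v\<in>J. (f v = 1) = (v \<in> a))"
        using J by measurable
      moreover have "?X = (if a \<subseteq> J then {f \<in> space (\<Pi>\<^sub>M v\<in>J. (borel :: real measure)). \<forall>v\<in>J. (f v = 1) = (v \<in> a)} else {})"
        by auto
      ultimately show ?thesis by (simp add: pred_def)
    qed
    have "{\<omega> \<in> space lim. dec \<omega> \<inter> J = a} = prod_emb UNIV (\<lambda>_. borel) J ?X"
      by (auto simp: prod_emb_def dec_def space_PiM)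
    then have "measure lim {\<omega> \<in> space lim. dec \<omega> \<inter> J = a} = measure (P J) ?X"
      using measure_lim_emb[of J ?X] J X by simp
    also have "\<dots> = measure_pmf.prob (q J) {b. b \<inter> J = a}"
      unfolding P_def using X meas_ind
      by (subst measure_distr) (auto simp: space_PiM indicator_def intro!: arg_cong[where f = "measure_pmf.prob (q J)"])
    also have "\<dots> = \<rho> {I. I \<inter> J = a}" using prob_q[OF J, of "\<lambda>b. b \<inter> J = a"] by (simp add: Int_assoc)
    finally show ?thesis .
  qed
  have indep: "AE \<omega> in lim. dec \<omega> \<in> independent_sets adj"
  proof -
    have "AE \<omega> in lim. \<not> (u \<in> dec \<omega> \<and> v \<in> dec \<omega>)" if "adj u v" for u v
    proof (rule AE_I[where N = "{\<omega> \<in> space lim. dec \<omega> \<inter> {u, v} = {u, v}}"])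
      have "measure_pmf.prob (p n) {I. I \<inter> {u, v} = {u, v}} = 0" for n
        using supp[of n] that by (auto simp: measure_pmf_zero_iff independent_sets_def)
      then have "((\<lambda>n. measure_pmf.prob (p n) {I. I \<inter> {u, v} = {u, v}}) \<longlongrightarrow> 0) G" by simp
      then have "\<rho> {I. I \<inter> {u, v} = {u, v}} = 0" using uniq lim by blast
      then show "emeasure lim {\<omega> \<in> space lim. dec \<omega> \<inter> {u, v} = {u, v}} = 0"
        using lim_local[of "{u, v}" "{u, v}"] by (simp add: P.emeasure_eq_measure)
      have "{\<omega> \<in> space lim. dec \<omega> \<inter> {u, v} = {u, v}} =
          {\<omega> \<in> space lim. u \<in> dec \<omega>} \<inter> {\<omega> \<in> space lim. v \<in> dec \<omega>}" by auto
      then show "{\<omega> \<in> space lim. dec \<omega> \<inter> {u, v} = {u, v}} \<in> sets lim"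
        by (simp only: sets.Int[OF dec_meas dec_meas])
      show "{\<omega> \<in> space lim. \<not> \<not> (u \<in> dec \<omega> \<and> v \<in> dec \<omega>)} \<subseteq> {\<omega> \<in> space lim. dec \<omega> \<inter> {u, v} = {u, v}}"
        by blast
    qed
    then have "AE \<omega> in lim. \<forall>u v. adj u v \<longrightarrow> \<not> (u \<in> dec \<omega> \<and> v \<in> dec \<omega>)"
      by (simp add: AE_all_countable)
    then show ?thesis by eventually_elim (auto simp: independent_sets_def)
  qed
  let ?f = "\<lambda>\<omega>. if dec \<omega> \<in> independent_sets adj then dec \<omega> else {}"
  have f: "?f \<in> lim \<rightarrow>\<^sub>M cylinder_algebra adj" by (rule measurable_cylinder_algebra_if[OF dec_meas])
  define \<mu> where "\<mu> = distr lim (cylinder_algebra adj) ?f"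
  have "measure \<mu> {I \<in> independent_sets adj. I \<inter> J = a} = \<rho> {I. I \<inter> J = a}" if J: "finite J" for J a
  proof -
    have "measure \<mu> {I \<in> independent_sets adj. I \<inter> J = a} =
        measure lim (?f -` {I \<in> independent_sets adj. I \<inter> J = a} \<inter> space lim)"
      unfolding \<mu>_def by (rule measure_distr[OF f local_event_sets[OF J]])
    also have "\<dots> = measure lim {\<omega> \<in> space lim. dec \<omega> \<inter> J = a}"
    proof (rule P.finite_measure_eq_AE)
      show "AE \<omega> in lim. (\<omega> \<in> ?f -` {I \<in> independent_sets adj. I \<inter> J = a} \<inter> space lim) =
          (\<omega> \<in> {\<omega> \<in> space lim. dec \<omega> \<inter> J = a})"
        using indep by eventually_elim auto
      show "?f -` {I \<in> independent_sets adj. I \<inter> J = a} \<inter> space lim \<in> sets lim"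
        by (rule measurable_sets[OF f local_event_sets[OF J]])
      show "{\<omega> \<in> space lim. dec \<omega> \<inter> J = a} \<in> sets lim"
        by (rule trace_event_sets[OF dec_meas J])
    qed
    also have "\<dots> = \<rho> {I. I \<inter> J = a}" by (rule lim_local[OF J])
    finally show ?thesis .
  qed
  then show thesis
    using that[of G \<mu>] G lim P.prob_space_distr[OF f] by (simp add: \<mu>_def)
qed

section \<open>Finite-volume hard-core measures\<close>

definition hc_configs :: "('v \<Rightarrow> 'v \<Rightarrow> bool) \<Rightarrow> 'v set \<Rightarrow> 'v set \<Rightarrow> 'v set set" where
  "hc_configs adj \<Lambda> B = {I \<in> independent_sets adj. I \<inter> - \<Lambda> = B \<inter> - \<Lambda>}"

lemma finite_hc_configs: "finite \<Lambda> \<Longrightarrow> finite (hc_configs adj \<Lambda> B)"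
proof (rule finite_subset)
  show "hc_configs adj \<Lambda> B \<subseteq> (\<lambda>A. A \<union> B \<inter> - \<Lambda>) ` Pow \<Lambda>"
  proof
    fix I assume "I \<in> hc_configs adj \<Lambda> B"
    then have "I = I \<inter> \<Lambda> \<union> B \<inter> - \<Lambda>" by (auto simp: hc_configs_def)
    then show "I \<in> (\<lambda>A. A \<union> B \<inter> - \<Lambda>) ` Pow \<Lambda>" by blast
  qed
qed simp

lemma hc_partition_eq: "hc_partition adj l \<Lambda> B = (\<Sum>K\<in>hc_configs adj \<Lambda> B. l ^ card (K \<inter> \<Lambda>))"
  by (simp add: hc_partition_def hc_configs_def)

definition hc_pmf :: "('v \<Rightarrow> 'v \<Rightarrow> bool) \<Rightarrow> real \<Rightarrow> 'v set \<Rightarrow> 'v set \<Rightarrow> 'v set pmf" where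
  "hc_pmf adj l \<Lambda> B = embed_pmf (\<lambda>I. if I \<in> hc_configs adj \<Lambda> B
     then l ^ card (I \<inter> \<Lambda>) / hc_partition adj l \<Lambda> B else 0)"

lemma hc_configs_cong: "I \<inter> - \<Lambda> = B \<inter> - \<Lambda> \<Longrightarrow> hc_configs adj \<Lambda> I = hc_configs adj \<Lambda> B"
  by (simp add: hc_configs_def)

lemma hc_configs_self: "B \<in> independent_sets adj \<Longrightarrow> B \<in> hc_configs adj \<Lambda> B"
  by (simp add: hc_configs_def)

lemma hc_partition_cong: "I \<inter> - \<Lambda> = B \<inter> - \<Lambda> \<Longrightarrow> hc_partition adj l \<Lambda> I = hc_partition adj l \<Lambda> B"
  by (simp add: hc_partition_def)

text \<open>Both directions of \<open>adj\<close> occur because adjacency is not assumed to be symmetric.\<close>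

locale hard_core =
  fixes adj :: "'v :: countable \<Rightarrow> 'v \<Rightarrow> bool" and l :: real
  assumes l_pos: "0 < l" and locally_finite: "\<And>v. finite {u. adj u v \<or> adj v u}"
begin

lemma hc_partition_pos:
  assumes "finite \<Lambda>" "B \<in> independent_sets adj"
  shows "0 < hc_partition adj l \<Lambda> B"
  unfolding hc_partition_eq
  using finite_hc_configs[OF assms(1)] hc_configs_self[OF assms(2)] l_pos by (intro sum_pos) auto

lemma pmf_hc_pmf:
  assumes "finite \<Lambda>" "B \<in> independent_sets adj"
  shows "pmf (hc_pmf adj l \<Lambda> B) I = (if I \<in> hc_configs adj \<Lambda> B
     then l ^ card (I \<inter> \<Lambda>) / hc_partition adj l \<Lambda> B else 0)"
  unfolding hc_pmf_def
proof (rule pmf_embed_pmf)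
  note Z = hc_partition_pos[OF assms]
  show "0 \<le> (if I \<in> hc_configs adj \<Lambda> B then l ^ card (I \<inter> \<Lambda>) / hc_partition adj l \<Lambda> B else 0)" for I
    using Z l_pos by simp
  have "(\<integral>\<^sup>+I. ennreal (if I \<in> hc_configs adj \<Lambda> B then l ^ card (I \<inter> \<Lambda>) / hc_partition adj l \<Lambda> B else 0)
      \<partial>count_space UNIV) = (\<Sum>I\<in>hc_configs adj \<Lambda> B. ennreal (l ^ card (I \<inter> \<Lambda>) / hc_partition adj l \<Lambda> B))"
    using finite_hc_configs[OF assms(1)]
    by (subst nn_integral_count_space'[of "hc_configs adj \<Lambda> B"]) (auto intro!: sum.cong)
  also have "\<dots> = ennreal (\<Sum>I\<in>hc_configs adj \<Lambda> B. l ^ card (I \<inter> \<Lambda>) / hc_partition adj l \<Lambda> B)"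
    using Z l_pos by (intro sum_ennreal) simp
  also have "(\<Sum>I\<in>hc_configs adj \<Lambda> B. l ^ card (I \<inter> \<Lambda>) / hc_partition adj l \<Lambda> B) = 1"
    using Z by (simp add: hc_partition_eq flip: sum_divide_distrib)
  finally show "(\<integral>\<^sup>+I. ennreal (if I \<in> hc_configs adj \<Lambda> B
      then l ^ card (I \<inter> \<Lambda>) / hc_partition adj l \<Lambda> B else 0) \<partial>count_space UNIV) = 1" by simp
qed

lemma set_hc_pmf:
  assumes "finite \<Lambda>" "B \<in> independent_sets adj"
  shows "set_pmf (hc_pmf adj l \<Lambda> B) = hc_configs adj \<Lambda> B"
  using hc_partition_pos[OF assms] l_pos by (auto simp: set_pmf_eq pmf_hc_pmf[OF assms])

lemma prob_hc_pmf:
  assumes "finite \<Lambda>" "B \<in> independent_sets adj"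
  shows "measure_pmf.prob (hc_pmf adj l \<Lambda> B) E =
    (\<Sum>I | I \<in> hc_configs adj \<Lambda> B \<and> I \<in> E. l ^ card (I \<inter> \<Lambda>)) / hc_partition adj l \<Lambda> B"
proof -
  have "measure_pmf.prob (hc_pmf adj l \<Lambda> B) E =
      measure_pmf.prob (hc_pmf adj l \<Lambda> B) {I. I \<in> hc_configs adj \<Lambda> B \<and> I \<in> E}"
    by (rule measure_pmf.finite_measure_eq_AE) (auto simp: AE_measure_pmf_iff set_hc_pmf[OF assms])
  also have "\<dots> = (\<Sum>I | I \<in> hc_configs adj \<Lambda> B \<and> I \<in> E. l ^ card (I \<inter> \<Lambda>) / hc_partition adj l \<Lambda> B)"
    using finite_hc_configs[OF assms(1)]
    by (subst measure_measure_pmf_finite) (auto simp: pmf_hc_pmf[OF assms])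
  finally show ?thesis by (simp add: sum_divide_distrib)
qed

text \<open>The finite-volume form of the Gibbs property: resampling the configuration inside \<open>\<Lambda>\<close> according to
  the hard-core measure preserves the hard-core measure of any larger volume. For a configuration \<open>J\<close>,
  the weights of the configurations that agree with \<open>J\<close> off \<open>\<Lambda>\<close> sum up to the partition function
  that normalizes the resampling.\<close>

lemma hc_pmf_consistent:
  assumes \<Lambda>: "\<Lambda> \<subseteq> \<Delta>" and \<Delta>: "finite \<Delta>" "B \<in> independent_sets adj"
  shows "bind_pmf (hc_pmf adj l \<Delta> B) (hc_pmf adj l \<Lambda>) = hc_pmf adj l \<Delta> B"
proof (rule pmf_eqI)
  fix J
  let ?\<Omega> = "hc_configs adj \<Delta> B" and ?Z = "hc_partition adj l \<Delta> B"
  have fin: "finite \<Lambda>" using \<Lambda> \<Delta>(1) finite_subset by blast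
  note fin\<Omega> = finite_hc_configs[OF \<Delta>(1), of adj B]
  have ind: "I \<in> independent_sets adj" if "I \<in> ?\<Omega>" for I using that by (simp add: hc_configs_def)
  have "pmf (bind_pmf (hc_pmf adj l \<Delta> B) (hc_pmf adj l \<Lambda>)) J =
      (\<Sum>I\<in>?\<Omega>. pmf (hc_pmf adj l \<Lambda> I) J * pmf (hc_pmf adj l \<Delta> B) I)"
    unfolding pmf_bind
    by (rule integral_measure_pmf_real) (simp_all add: fin\<Omega> set_hc_pmf[OF \<Delta>])
  also have "\<dots> = pmf (hc_pmf adj l \<Delta> B) J"
  proof (cases "J \<in> ?\<Omega>")
    case False
    have "pmf (hc_pmf adj l \<Lambda> I) J = 0" if I: "I \<in> ?\<Omega>" for I
    proof -
      have "J \<notin> hc_configs adj \<Lambda> I"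
      proof
        assume "J \<in> hc_configs adj \<Lambda> I"
        then have "J \<in> independent_sets adj" "J \<inter> - \<Delta> = I \<inter> - \<Delta>" using \<Lambda> by (auto simp: hc_configs_def)
        then show False using False I by (simp add: hc_configs_def)
      qed
      then show ?thesis by (simp add: pmf_hc_pmf[OF fin ind[OF I]])
    qed
    then show ?thesis using False by (simp add: pmf_hc_pmf[OF \<Delta>])
  next
    case True
    let ?C = "hc_configs adj \<Lambda> J" and ?z = "hc_partition adj l \<Lambda> J"
    note z = hc_partition_pos[OF fin ind[OF True]]
    have sub: "?C \<subseteq> ?\<Omega>" using True \<Lambda> by (auto simp: hc_configs_def)
    have card_split: "card (I \<inter> \<Delta>) = card (I \<inter> \<Lambda>) + card (J \<inter> (\<Delta> - \<Lambda>))" if "I \<inter> - \<Lambda> = J \<inter> - \<Lambda>" for I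
    proof -
      have "I \<inter> \<Delta> = (I \<inter> \<Lambda>) \<union> (J \<inter> (\<Delta> - \<Lambda>))" using that \<Lambda> by auto
      then show ?thesis using \<Delta>(1) fin by (simp add: card_Un_disjoint disjoint_iff)
    qed
    have "(\<Sum>I\<in>?\<Omega>. pmf (hc_pmf adj l \<Lambda> I) J * pmf (hc_pmf adj l \<Delta> B) I) =
        (\<Sum>I\<in>?C. pmf (hc_pmf adj l \<Lambda> I) J * pmf (hc_pmf adj l \<Delta> B) I)"
    proof (rule sum.mono_neutral_right[OF fin\<Omega> sub], rule ballI)
      fix I assume I: "I \<in> ?\<Omega> - ?C"
      then have "J \<notin> hc_configs adj \<Lambda> I" by (auto simp: hc_configs_def)
      then show "pmf (hc_pmf adj l \<Lambda> I) J * pmf (hc_pmf adj l \<Delta> B) I = 0"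
        using I by (simp add: pmf_hc_pmf[OF fin ind])
    qed
    also have "\<dots> = (\<Sum>I\<in>?C. l ^ card (J \<inter> \<Lambda>) / ?z * (l ^ card (I \<inter> \<Lambda>) * l ^ card (J \<inter> (\<Delta> - \<Lambda>)) / ?Z))"
    proof (rule sum.cong)
      fix I assume I: "I \<in> ?C"
      then have I': "I \<in> ?\<Omega>" "I \<inter> - \<Lambda> = J \<inter> - \<Lambda>" using sub by (auto simp: hc_configs_def)
      have "pmf (hc_pmf adj l \<Lambda> I) J = l ^ card (J \<inter> \<Lambda>) / ?z"
        using hc_configs_self[OF ind[OF True]] hc_configs_cong[OF I'(2)] hc_partition_cong[OF I'(2)]
        by (simp add: pmf_hc_pmf[OF fin ind[OF I'(1)]])
      moreover have "pmf (hc_pmf adj l \<Delta> B) I = l ^ card (I \<inter> \<Lambda>) * l ^ card (J \<inter> (\<Delta> - \<Lambda>)) / ?Z"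
        using I' card_split[OF I'(2)] by (simp add: pmf_hc_pmf[OF \<Delta>] power_add)
      ultimately show "pmf (hc_pmf adj l \<Lambda> I) J * pmf (hc_pmf adj l \<Delta> B) I =
          l ^ card (J \<inter> \<Lambda>) / ?z * (l ^ card (I \<inter> \<Lambda>) * l ^ card (J \<inter> (\<Delta> - \<Lambda>)) / ?Z)" by simp
    qed simp
    also have "\<dots> = l ^ card (J \<inter> \<Lambda>) / ?z * (l ^ card (J \<inter> (\<Delta> - \<Lambda>)) / ?Z) * ?z"
      unfolding hc_partition_eq[of adj l \<Lambda> J] sum_distrib_left
      by (intro sum.cong) (auto simp: mult_ac)
    also have "\<dots> = l ^ card (J \<inter> \<Delta>) / ?Z"
      using z card_split[of J] by (simp add: power_add)
    also have "\<dots> = pmf (hc_pmf adj l \<Delta> B) J" using True by (simp add: pmf_hc_pmf[OF \<Delta>])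
    finally show ?thesis .
  qed
  finally show "pmf (bind_pmf (hc_pmf adj l \<Delta> B) (hc_pmf adj l \<Lambda>)) J = pmf (hc_pmf adj l \<Delta> B) J" .
qed

definition nbhd :: "'v set \<Rightarrow> 'v set" where
  "nbhd \<Lambda> = (\<Union>v\<in>\<Lambda>. {u. adj u v \<or> adj v u})"

lemma finite_nbhd: "finite \<Lambda> \<Longrightarrow> finite (nbhd \<Lambda>)"
  using locally_finite by (simp add: nbhd_def)

text \<open>Only the boundary condition next to \<open>\<Lambda>\<close> restricts the configuration inside \<open>\<Lambda>\<close>. This makes
  the finite-volume measure of a local event a local function of the boundary condition.\<close>

lemma transplant:
  assumes I: "I' \<in> independent_sets adj" "I \<inter> (A \<union> nbhd \<Lambda>) = I' \<inter> (A \<union> nbhd \<Lambda>)"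
    and K: "K \<in> hc_configs adj \<Lambda> I" "A \<subseteq> K"
  shows "K \<inter> \<Lambda> \<union> (I' - \<Lambda>) \<in> hc_configs adj \<Lambda> I'" "A \<subseteq> K \<inter> \<Lambda> \<union> (I' - \<Lambda>)"
proof -
  have K': "K \<in> independent_sets adj" "K \<inter> - \<Lambda> = I \<inter> - \<Lambda>" using K by (auto simp: hc_configs_def)
  have cross: "\<not> adj u v \<and> \<not> adj v u" if "u \<in> K \<inter> \<Lambda>" "v \<in> I' - \<Lambda>" for u v
  proof (rule ccontr)
    assume "\<not> ?thesis"
    then have adj: "adj u v \<or> adj v u" by blast
    then have "v \<in> nbhd \<Lambda>" using that unfolding nbhd_def by blast
    then have "v \<in> K" using that I(2) K'(2) by blast
    then show False using adj that K'(1) unfolding independent_sets_def by blast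
  qed
  have "K \<inter> \<Lambda> \<union> (I' - \<Lambda>) \<in> independent_sets adj"
    unfolding independent_sets_def
  proof (intro CollectI ballI)
    fix u v assume "u \<in> K \<inter> \<Lambda> \<union> (I' - \<Lambda>)" "v \<in> K \<inter> \<Lambda> \<union> (I' - \<Lambda>)"
    then show "\<not> adj u v" using cross[of u v] cross[of v u] K'(1) I(1) unfolding independent_sets_def by blast
  qed
  then show "K \<inter> \<Lambda> \<union> (I' - \<Lambda>) \<in> hc_configs adj \<Lambda> I'" by (auto simp: hc_configs_def)
  show "A \<subseteq> K \<inter> \<Lambda> \<union> (I' - \<Lambda>)" using K(2) K'(2) I(2) by blast
qed

lemma sum_configs_local:
  assumes I: "I \<in> independent_sets adj" "I' \<in> independent_sets adj"
    "I \<inter> (A \<union> nbhd \<Lambda>) = I' \<inter> (A \<union> nbhd \<Lambda>)"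
  shows "(\<Sum>K | K \<in> hc_configs adj \<Lambda> I \<and> A \<subseteq> K. l ^ card (K \<inter> \<Lambda>)) =
    (\<Sum>K | K \<in> hc_configs adj \<Lambda> I' \<and> A \<subseteq> K. l ^ card (K \<inter> \<Lambda>))"
proof (rule sum.reindex_bij_witness[where i = "\<lambda>K. K \<inter> \<Lambda> \<union> (I - \<Lambda>)" and j = "\<lambda>K. K \<inter> \<Lambda> \<union> (I' - \<Lambda>)"])
  fix K assume "K \<in> {K. K \<in> hc_configs adj \<Lambda> I \<and> A \<subseteq> K}"
  then have K: "K \<in> hc_configs adj \<Lambda> I" "A \<subseteq> K" by auto
  show "K \<inter> \<Lambda> \<union> (I' - \<Lambda>) \<in> {K. K \<in> hc_configs adj \<Lambda> I' \<and> A \<subseteq> K}" using transplant[OF I(2,3) K] by blast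
  show "(K \<inter> \<Lambda> \<union> (I' - \<Lambda>)) \<inter> \<Lambda> \<union> (I - \<Lambda>) = K" using K(1) unfolding hc_configs_def by blast
  have "(K \<inter> \<Lambda> \<union> (I' - \<Lambda>)) \<inter> \<Lambda> = K \<inter> \<Lambda>" by blast
  then show "l ^ card ((K \<inter> \<Lambda> \<union> (I' - \<Lambda>)) \<inter> \<Lambda>) = l ^ card (K \<inter> \<Lambda>)" by simp
next
  fix K assume "K \<in> {K. K \<in> hc_configs adj \<Lambda> I' \<and> A \<subseteq> K}"
  then have K: "K \<in> hc_configs adj \<Lambda> I'" "A \<subseteq> K" by auto
  show "K \<inter> \<Lambda> \<union> (I - \<Lambda>) \<in> {K. K \<in> hc_configs adj \<Lambda> I \<and> A \<subseteq> K}"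
    using transplant[OF I(1) I(3)[symmetric] K] by blast
  show "(K \<inter> \<Lambda> \<union> (I - \<Lambda>)) \<inter> \<Lambda> \<union> (I' - \<Lambda>) = K" using K(1) unfolding hc_configs_def by blast
qed

lemma prob_hc_pmf_local:
  assumes "finite \<Lambda>" and I: "I \<in> independent_sets adj" "I' \<in> independent_sets adj"
    "I \<inter> (A \<union> nbhd \<Lambda>) = I' \<inter> (A \<union> nbhd \<Lambda>)"
  shows "measure_pmf.prob (hc_pmf adj l \<Lambda> I) {K. A \<subseteq> K} = measure_pmf.prob (hc_pmf adj l \<Lambda> I') {K. A \<subseteq> K}"
proof -
  have "I \<inter> ({} \<union> nbhd \<Lambda>) = I' \<inter> ({} \<union> nbhd \<Lambda>)" using I(3) by blast
  from sum_configs_local[OF I(1,2) this]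
  have "hc_partition adj l \<Lambda> I = hc_partition adj l \<Lambda> I'" by (simp add: hc_partition_eq)
  then show ?thesis
    using sum_configs_local[OF I] by (simp add: prob_hc_pmf[OF assms(1)] I(1,2))
qed

text \<open>A sum over the patterns \<open>b\<close> inside \<open>\<Lambda>\<close>, whose range does not depend on \<open>I\<close>: this
  shows measurability in \<open>I\<close>.\<close>

lemma prob_hc_pmf_by_pattern:
  assumes \<Lambda>: "finite \<Lambda>" and I: "I \<in> independent_sets adj" and E: "E \<subseteq> independent_sets adj"
  shows "measure_pmf.prob (hc_pmf adj l \<Lambda> I) E =
    (\<Sum>b\<in>Pow \<Lambda>. indicator {b. b \<union> (I - \<Lambda>) \<in> E} b * l ^ card b) /
    (\<Sum>b\<in>Pow \<Lambda>. indicator {b. b \<union> (I - \<Lambda>) \<in> independent_sets adj} b * l ^ card b)"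
proof -
  have *: "(\<Sum>K | K \<in> hc_configs adj \<Lambda> I \<and> K \<in> F. l ^ card (K \<inter> \<Lambda>)) =
      (\<Sum>b\<in>Pow \<Lambda>. indicator {b. b \<union> (I - \<Lambda>) \<in> F} b * l ^ card b)"
    if F: "F \<subseteq> independent_sets adj" for F
  proof -
    have "(\<Sum>K | K \<in> hc_configs adj \<Lambda> I \<and> K \<in> F. l ^ card (K \<inter> \<Lambda>)) =
        (\<Sum>b\<in>{b \<in> Pow \<Lambda>. b \<union> (I - \<Lambda>) \<in> F}. l ^ card b)"
    proof (rule sum.reindex_bij_witness[where i = "\<lambda>b. b \<union> (I - \<Lambda>)" and j = "\<lambda>K. K \<inter> \<Lambda>"])
      fix K assume K: "K \<in> {K. K \<in> hc_configs adj \<Lambda> I \<and> K \<in> F}"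
      then show eq: "K \<inter> \<Lambda> \<union> (I - \<Lambda>) = K" unfolding hc_configs_def by blast
      show "K \<inter> \<Lambda> \<in> {b \<in> Pow \<Lambda>. b \<union> (I - \<Lambda>) \<in> F}" using K eq by simp
    next
      fix b assume b: "b \<in> {b \<in> Pow \<Lambda>. b \<union> (I - \<Lambda>) \<in> F}"
      then show "(b \<union> (I - \<Lambda>)) \<inter> \<Lambda> = b" by blast
      have "(b \<union> (I - \<Lambda>)) \<inter> - \<Lambda> = I \<inter> - \<Lambda>" using b by blast
      then show "b \<union> (I - \<Lambda>) \<in> {K. K \<in> hc_configs adj \<Lambda> I \<and> K \<in> F}"
        using b F unfolding hc_configs_def by blast
    qed simp
    also have "\<dots> = (\<Sum>b\<in>Pow \<Lambda>. indicator {b. b \<union> (I - \<Lambda>) \<in> F} b * l ^ card b)"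
      using \<Lambda> by (intro sum.mono_neutral_cong_left) auto
    finally show ?thesis .
  qed
  have "{K. K \<in> hc_configs adj \<Lambda> I \<and> K \<in> independent_sets adj} = hc_configs adj \<Lambda> I"
    by (auto simp: hc_configs_def)
  then have "hc_partition adj l \<Lambda> I =
      (\<Sum>b\<in>Pow \<Lambda>. indicator {b. b \<union> (I - \<Lambda>) \<in> independent_sets adj} b * l ^ card b)"
    using *[OF order_refl] by (simp add: hc_partition_eq)
  then show ?thesis using *[OF E] by (simp add: prob_hc_pmf[OF \<Lambda> I])
qed

end

section \<open>Infinite-volume Gibbs measures\<close>

text \<open>A function of the trace on a finite set is a finite linear combination of indicator functions,
  so convergence on local events yields convergence of its expectation.\<close>

lemma local_function_expansion:
  fixes g :: "'v set \<Rightarrow> real"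
  assumes J: "finite J"
    and loc: "\<And>I I'. I \<in> X \<Longrightarrow> I' \<in> X \<Longrightarrow> I \<inter> J = I' \<inter> J \<Longrightarrow> g I = g I'"
  obtains h where "\<And>I. I \<in> X \<Longrightarrow> g I = (\<Sum>a\<in>Pow J. h a * indicator {I \<in> X. I \<inter> J = a} I)"
proof
  fix I assume I: "I \<in> X"
  define h where "h a = g (SOME I. I \<in> X \<and> I \<inter> J = a)" for a
  have "(SOME I'. I' \<in> X \<and> I' \<inter> J = I \<inter> J) \<in> X \<and> (SOME I'. I' \<in> X \<and> I' \<inter> J = I \<inter> J) \<inter> J = I \<inter> J"
    by (rule someI[of _ I]) (use I in simp)
  then have "g I = h (I \<inter> J)" unfolding h_def using loc I by metis
  also have "\<dots> = (\<Sum>a\<in>Pow J. if a = I \<inter> J then h a else 0)" using J by (simp add: sum.delta)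
  also have "\<dots> = (\<Sum>a\<in>Pow J. h a * indicator {I \<in> X. I \<inter> J = a} I)"
    by (intro sum.cong) (use I in auto)
  finally show "g I = (\<Sum>a\<in>Pow J. g (SOME I. I \<in> X \<and> I \<inter> J = a) * indicator {I \<in> X. I \<inter> J = a} I)"
    unfolding h_def .
qed

lemma expectation_local_function_limit:
  fixes adj :: "'v :: countable \<Rightarrow> 'v \<Rightarrow> bool" and g :: "'v set \<Rightarrow> real" and p :: "nat \<Rightarrow> 'v set pmf"
  defines "X \<equiv> independent_sets adj"
  assumes supp: "\<And>n. set_pmf (p n) \<subseteq> X"
    and \<mu>: "prob_space \<mu>" "sets \<mu> = sets (cylinder_algebra adj)"
    and conv: "\<And>J a. finite J \<Longrightarrow>
      ((\<lambda>n. measure_pmf.prob (p n) {I. I \<inter> J = a}) \<longlongrightarrow> measure \<mu> {I \<in> X. I \<inter> J = a}) G"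
    and J: "finite J"
    and loc: "\<And>I I'. I \<in> X \<Longrightarrow> I' \<in> X \<Longrightarrow> I \<inter> J = I' \<inter> J \<Longrightarrow> g I = g I'"
  shows "((\<lambda>n. measure_pmf.expectation (p n) g) \<longlongrightarrow> integral\<^sup>L \<mu> g) G"
proof -
  interpret prob_space \<mu> by fact
  have sp: "space \<mu> = X" using sets_eq_imp_space_eq[OF \<mu>(2)] by (simp add: X_def)
  have meas: "{I \<in> X. I \<inter> J = a} \<in> sets \<mu>" for a
    unfolding X_def \<mu>(2) by (rule local_event_sets[OF J])
  obtain h where h: "\<And>I. I \<in> X \<Longrightarrow> g I = (\<Sum>a\<in>Pow J. h a * indicator {I \<in> X. I \<inter> J = a} I)"
    using local_function_expansion[where X = X and g = g, OF J loc] by blast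
  have 1: "integral\<^sup>L \<mu> g = (\<Sum>a\<in>Pow J. h a * measure \<mu> {I \<in> X. I \<inter> J = a})"
  proof -
    have "integral\<^sup>L \<mu> g = (\<integral>I. (\<Sum>a\<in>Pow J. h a * indicator {I \<in> X. I \<inter> J = a} I) \<partial>\<mu>)"
      by (rule Bochner_Integration.integral_cong) (simp_all add: sp h)
    also have "\<dots> = (\<Sum>a\<in>Pow J. \<integral>I. h a * indicator {I \<in> X. I \<inter> J = a} I \<partial>\<mu>)"
      using meas by (intro Bochner_Integration.integral_sum integrable_mult_right)
        (auto simp: emeasure_eq_measure intro!: integrable_real_indicator)
    also have "\<dots> = (\<Sum>a\<in>Pow J. h a * measure \<mu> {I \<in> X. I \<inter> J = a})"
      using meas by (simp add: Int_absorb2 sets.sets_into_space)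
    finally show ?thesis .
  qed
  have 2: "measure_pmf.expectation (p n) g = (\<Sum>a\<in>Pow J. h a * measure_pmf.prob (p n) {I. I \<inter> J = a})" for n
  proof -
    have "measure_pmf.expectation (p n) g =
        measure_pmf.expectation (p n) (\<lambda>I. \<Sum>a\<in>Pow J. h a * indicator {I. I \<inter> J = a} I)"
    proof (rule integral_cong_AE)
      show "AE I in p n. g I = (\<Sum>a\<in>Pow J. h a * indicator {I. I \<inter> J = a} I)"
        unfolding AE_measure_pmf_iff
      proof
        fix I assume "I \<in> set_pmf (p n)"
        then have "I \<in> X" using supp by blast
        then show "g I = (\<Sum>a\<in>Pow J. h a * indicator {I. I \<inter> J = a} I)"
          unfolding h[OF \<open>I \<in> X\<close>] by (intro sum.cong) (auto simp: indicator_def)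
      qed
    qed simp_all
    also have "\<dots> = (\<Sum>a\<in>Pow J. measure_pmf.expectation (p n) (\<lambda>I. h a * indicator {I. I \<inter> J = a} I))"
      by (intro Bochner_Integration.integral_sum integrable_mult_right)
        (auto simp: measure_pmf.emeasure_eq_measure intro!: integrable_real_indicator)
    also have "\<dots> = (\<Sum>a\<in>Pow J. h a * measure_pmf.prob (p n) {I. I \<inter> J = a})"
      by simp
    finally show ?thesis .
  qed
  show ?thesis unfolding 1 2 by (intro tendsto_sum tendsto_mult tendsto_const conv[OF J])
qed

lemma Int_stable_inclusion_events:
  "Int_stable {{I \<in> X. A \<subseteq> I} | A. finite A}"
proof (rule Int_stableI)
  fix E F assume "E \<in> {{I \<in> X. A \<subseteq> I} | A. finite A}" "F \<in> {{I \<in> X. A \<subseteq> I} | A. finite A}"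
  then obtain A B where "finite A" "finite B" "E = {I \<in> X. A \<subseteq> I}" "F = {I \<in> X. B \<subseteq> I}" by blast
  then have "E \<inter> F = {I \<in> X. A \<union> B \<subseteq> I}" "finite (A \<union> B)" by auto
  then show "E \<inter> F \<in> {{I \<in> X. A \<subseteq> I} | A. finite A}" by blast
qed

lemma inclusion_event_sets:
  assumes "finite A"
  shows "{I \<in> independent_sets adj. A \<subseteq> I} \<in> sets (cylinder_algebra adj)"
  using local_event_sets[OF assms, of adj A] by (simp add: Int_absorb1 inf.absorb_iff2 Int_commute)

text \<open>The events \<open>A \<subseteq> I\<close> with finite \<open>A\<close> are closed under intersection, so that they determine a
  probability measure.\<close>

lemma sets_cylinder_algebra_inclusion:
  "sets (cylinder_algebra adj) = sigma_sets (independent_sets adj) {{I \<in> independent_sets adj. A \<subseteq> I} | A. finite A}"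
    (is "_ = sigma_sets ?X ?E")
proof
  show "sigma_sets ?X ?E \<subseteq> sets (cylinder_algebra adj)"
    using sets.sigma_sets_subset[of ?E "cylinder_algebra adj"] inclusion_event_sets[of _ adj] by auto
  have E: "?E \<subseteq> Pow ?X" by blast
  have "(\<lambda>I. I) \<in> sigma ?X ?E \<rightarrow>\<^sub>M cylinder_algebra adj"
  proof (rule measurable_cylinder_algebraI)
    fix v
    have "{I \<in> ?X. {v} \<subseteq> I} \<in> ?E" by blast
    then show "{I \<in> space (sigma ?X ?E). v \<in> I} \<in> sets (sigma ?X ?E)"
      using E by (auto simp: sets_measure_of space_measure_of_conv intro!: sigma_sets.Basic)
  qed (simp add: space_measure_of_conv)
  then show "sets (cylinder_algebra adj) \<subseteq> sigma_sets ?X ?E"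
  proof (intro subsetI)
    fix A assume m: "(\<lambda>I. I) \<in> sigma ?X ?E \<rightarrow>\<^sub>M cylinder_algebra adj" and A: "A \<in> sets (cylinder_algebra adj)"
    have "A \<subseteq> ?X" using sets.sets_into_space[OF A] by simp
    then show "A \<in> sigma_sets ?X ?E"
      using measurable_sets[OF m A] E by (simp add: sets_measure_of space_measure_of_conv Int_absorb2)
  qed
qed

lemma off_algebra_measurable:
  "(\<lambda>I. I \<inter> - \<Lambda>) \<in> off_algebra adj \<Lambda> \<rightarrow>\<^sub>M cylinder_algebra adj"
  unfolding off_algebra_def
  by (rule measurable_vimage_algebra1) (auto simp: independent_sets_def)

lemma space_off_algebra [simp]: "space (off_algebra adj \<Lambda>) = independent_sets adj"
  by (simp add: off_algebra_def)

lemma off_algebra_invariant: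
  assumes "E \<in> sets (off_algebra adj \<Lambda>)" "I \<in> independent_sets adj" "K \<in> independent_sets adj"
    "I \<inter> - \<Lambda> = K \<inter> - \<Lambda>"
  shows "I \<in> E \<longleftrightarrow> K \<in> E"
proof -
  have "(\<lambda>I. I \<inter> - \<Lambda>) \<in> independent_sets adj \<rightarrow> space (cylinder_algebra adj)"
    by (auto simp: independent_sets_def)
  from assms(1)[unfolded off_algebra_def sets_vimage_algebra2[OF this]]
  obtain A where "E = (\<lambda>I. I \<inter> - \<Lambda>) -` A \<inter> independent_sets adj" by blast
  then show ?thesis using assms(2-4) by simp
qed

context hard_core
begin

text \<open>The map sends configurations that are not independent, which have probability zero, to the empty
  configuration, in order to land in the space of independent sets.\<close>

definition hc_kernel :: "'v set \<Rightarrow> 'v set \<Rightarrow> 'v set measure" where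
  "hc_kernel \<Lambda> I = distr (measure_pmf (hc_pmf adj l \<Lambda> I)) (cylinder_algebra adj)
     (\<lambda>J. if J \<in> independent_sets adj then J else {})"

lemma kernel_map_measurable:
  "(\<lambda>J. if J \<in> independent_sets adj then J else {}) \<in> measure_pmf p \<rightarrow>\<^sub>M cylinder_algebra adj"
  by (auto simp: measurable_def)

lemma prob_space_hc_kernel: "prob_space (hc_kernel \<Lambda> I)"
  unfolding hc_kernel_def by (rule measure_pmf.prob_space_distr[OF kernel_map_measurable])

lemma sets_hc_kernel [simp]: "sets (hc_kernel \<Lambda> I) = sets (cylinder_algebra adj)"
  by (simp add: hc_kernel_def)

lemma measure_hc_kernel:
  assumes \<Lambda>: "finite \<Lambda>" and I: "I \<in> independent_sets adj" and A: "A \<in> sets (cylinder_algebra adj)"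
  shows "measure (hc_kernel \<Lambda> I) A = measure_pmf.prob (hc_pmf adj l \<Lambda> I) A"
proof -
  have "measure (hc_kernel \<Lambda> I) A =
      measure_pmf.prob (hc_pmf adj l \<Lambda> I) ((\<lambda>J. if J \<in> independent_sets adj then J else {}) -` A)"
    unfolding hc_kernel_def using measure_distr[OF kernel_map_measurable A] by simp
  also have "\<dots> = measure_pmf.prob (hc_pmf adj l \<Lambda> I) A"
    by (rule measure_pmf.finite_measure_eq_AE)
      (auto simp: AE_measure_pmf_iff set_hc_pmf[OF \<Lambda> I] hc_configs_def)
  finally show ?thesis .
qed

lemma measurable_pattern_indicator:
  assumes A: "A \<in> sets (cylinder_algebra adj)"
  shows "{I \<in> independent_sets adj. b \<union> (I - \<Lambda>) \<in> A} \<in> sets (off_algebra adj \<Lambda>)"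
proof -
  let ?F = "off_algebra adj \<Lambda>" and ?T = "\<lambda>I. b \<union> (I - \<Lambda>)"
  have m: "{I \<in> space ?F. v \<in> ?T I} \<in> sets ?F" for v
  proof (cases "v \<in> b")
    case True
    then show ?thesis using sets.top[of ?F] by simp
  next
    case False
    have "{I \<in> independent_sets adj. v \<in> I} \<in> sets (cylinder_algebra adj)" by (rule in_sets_cylinder_algebra)
    from measurable_sets[OF off_algebra_measurable this, of \<Lambda>]
    have "(\<lambda>I. I \<inter> - \<Lambda>) -` {I \<in> independent_sets adj. v \<in> I} \<inter> independent_sets adj \<in> sets ?F" by simp
    also have "(\<lambda>I. I \<inter> - \<Lambda>) -` {I \<in> independent_sets adj. v \<in> I} \<inter> independent_sets adj = {I \<in> space ?F. v \<in> ?T I}"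
      using False by (auto simp: independent_sets_def)
    finally show ?thesis .
  qed
  let ?f = "\<lambda>I. if ?T I \<in> independent_sets adj then ?T I else {}"
  have "?f -` A \<inter> space ?F \<in> sets ?F"
    by (rule measurable_sets[OF measurable_cylinder_algebra_if[OF m] A])
  moreover have "{I \<in> space ?F. ?T I \<in> independent_sets adj} \<in> sets ?F" by (rule sets_independent[OF m])
  ultimately have "(?f -` A \<inter> space ?F) \<inter> {I \<in> space ?F. ?T I \<in> independent_sets adj} \<in> sets ?F" by (rule sets.Int)
  also have "(?f -` A \<inter> space ?F) \<inter> {I \<in> space ?F. ?T I \<in> independent_sets adj} = {I \<in> independent_sets adj. ?T I \<in> A}"
    using sets.sets_into_space[OF A] by auto
  finally show ?thesis .
qed

lemma measurable_hc_kernel_event: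
  assumes \<Lambda>: "finite \<Lambda>" and A: "A \<in> sets (cylinder_algebra adj)"
  shows "(\<lambda>I. measure (hc_kernel \<Lambda> I) A) \<in> borel_measurable (off_algebra adj \<Lambda>)"
proof -
  have ind: "(\<lambda>I. indicator {b. b \<union> (I - \<Lambda>) \<in> B} b :: real) \<in> borel_measurable (off_algebra adj \<Lambda>)"
    if B: "B \<in> sets (cylinder_algebra adj)" for B b
  proof -
    have "(\<lambda>I. indicator {I \<in> independent_sets adj. b \<union> (I - \<Lambda>) \<in> B} I :: real) \<in> borel_measurable (off_algebra adj \<Lambda>)"
      using measurable_pattern_indicator[OF B] by simp
    moreover have "(\<lambda>I. indicator {b. b \<union> (I - \<Lambda>) \<in> B} b :: real) \<in> borel_measurable (off_algebra adj \<Lambda>) \<longleftrightarrow>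
        (\<lambda>I. indicator {I \<in> independent_sets adj. b \<union> (I - \<Lambda>) \<in> B} I :: real) \<in> borel_measurable (off_algebra adj \<Lambda>)"
      by (rule measurable_cong) (simp add: indicator_def)
    ultimately show ?thesis by simp
  qed
  have X: "independent_sets adj \<in> sets (cylinder_algebra adj)" using sets.top[of "cylinder_algebra adj"] by simp
  have "(\<lambda>I. (\<Sum>b\<in>Pow \<Lambda>. indicator {b. b \<union> (I - \<Lambda>) \<in> A} b * l ^ card b) /
      (\<Sum>b\<in>Pow \<Lambda>. indicator {b. b \<union> (I - \<Lambda>) \<in> independent_sets adj} b * l ^ card b))
      \<in> borel_measurable (off_algebra adj \<Lambda>)"
    using ind[OF A] ind[OF X]
    by (intro borel_measurable_divide borel_measurable_sum borel_measurable_times) auto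
  moreover have "A \<subseteq> independent_sets adj" using sets.sets_into_space[OF A] by simp
  ultimately show ?thesis
    by (subst measurable_cong[where g = "\<lambda>I. (\<Sum>b\<in>Pow \<Lambda>. indicator {b. b \<union> (I - \<Lambda>) \<in> A} b * l ^ card b) /
      (\<Sum>b\<in>Pow \<Lambda>. indicator {b. b \<union> (I - \<Lambda>) \<in> independent_sets adj} b * l ^ card b)"])
      (simp_all add: measure_hc_kernel[OF \<Lambda> _ A] prob_hc_pmf_by_pattern[OF \<Lambda>])
qed

lemma hc_kernel_measurable:
  assumes \<Lambda>: "finite \<Lambda>" and \<mu>: "sets \<mu> = sets (cylinder_algebra adj)"
  shows "hc_kernel \<Lambda> \<in> off_algebra adj \<Lambda> \<rightarrow>\<^sub>M prob_algebra \<mu>"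
proof (rule measurable_prob_algebraI)
  show "prob_space (hc_kernel \<Lambda> I)" for I by (rule prob_space_hc_kernel)
  show "hc_kernel \<Lambda> \<in> off_algebra adj \<Lambda> \<rightarrow>\<^sub>M subprob_algebra \<mu>"
  proof (rule measurable_subprob_algebra)
    show "subprob_space (hc_kernel \<Lambda> I)" for I
      by (rule prob_space_imp_subprob_space[OF prob_space_hc_kernel])
    show "sets (hc_kernel \<Lambda> I) = sets \<mu>" for I by (simp add: \<mu>)
    fix A assume A: "A \<in> sets \<mu>"
    have "emeasure (hc_kernel \<Lambda> I) A = ennreal (measure (hc_kernel \<Lambda> I) A)" for I
    proof -
      interpret prob_space "hc_kernel \<Lambda> I" by (rule prob_space_hc_kernel)
      show ?thesis by (rule emeasure_eq_measure)
    qed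
    then show "(\<lambda>I. emeasure (hc_kernel \<Lambda> I) A) \<in> borel_measurable (off_algebra adj \<Lambda>)"
      using measurable_hc_kernel_event[OF \<Lambda>] A by (simp add: \<mu>)
  qed
qed

end

context hard_core
begin

text \<open>The measure is preserved by resampling in every finite volume. This is the form of the Gibbs property that
  passes to limits.\<close>

definition dlr_invariant :: "'v set measure \<Rightarrow> bool" where
  "dlr_invariant \<mu> \<longleftrightarrow> prob_space \<mu> \<and> sets \<mu> = sets (cylinder_algebra adj) \<and>
     (\<forall>\<Lambda> A. finite \<Lambda> \<longrightarrow> A \<in> sets (cylinder_algebra adj) \<longrightarrow>
        (\<integral>I. measure (hc_kernel \<Lambda> I) A \<partial>\<mu>) = measure \<mu> A)"

lemma prob_bind_pmf:
  "measure_pmf.prob (bind_pmf p f) E = measure_pmf.expectation p (\<lambda>x. measure_pmf.prob (f x) E)"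
proof -
  have "ennreal (measure_pmf.prob (bind_pmf p f) E) = emeasure (bind_pmf p f) E"
    by (simp only: measure_pmf.emeasure_eq_measure)
  also have "\<dots> = (\<integral>\<^sup>+x. emeasure (f x) E \<partial>p)" by (rule emeasure_bind_pmf)
  also have "\<dots> = (\<integral>\<^sup>+x. ennreal (measure_pmf.prob (f x) E) \<partial>p)"
    by (simp only: measure_pmf.emeasure_eq_measure)
  also have "\<dots> = ennreal (measure_pmf.expectation p (\<lambda>x. measure_pmf.prob (f x) E))"
    by (rule nn_integral_eq_integral) (auto intro!: measure_pmf.integrable_const_bound[where B = 1])
  finally show ?thesis by (simp add: integral_nonneg)
qed

lemma kernel_borel:
  assumes "sets \<mu> = sets (cylinder_algebra adj)" "finite \<Lambda>" "A \<in> sets (cylinder_algebra adj)"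
  shows "(\<lambda>I. measure (hc_kernel \<Lambda> I) A) \<in> borel_measurable \<mu>"
  using measurable_from_subalg[OF subalgebra_off_algebra[OF assms(1)] measurable_hc_kernel_event[OF assms(2,3)]] .

text \<open>Resampling gives a probability measure again, and two probability measures that agree on the events
  \<open>A \<subseteq> I\<close> are equal.\<close>

lemma dlr_invariantI:
  assumes \<mu>: "prob_space \<mu>" "sets \<mu> = sets (cylinder_algebra adj)"
    and inv: "\<And>\<Lambda> A. finite \<Lambda> \<Longrightarrow> finite A \<Longrightarrow>
      (\<integral>I. measure_pmf.prob (hc_pmf adj l \<Lambda> I) {K. A \<subseteq> K} \<partial>\<mu>) = measure \<mu> {I \<in> independent_sets adj. A \<subseteq> I}"
  shows "dlr_invariant \<mu>"
  unfolding dlr_invariant_def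
proof (intro conjI allI impI)
  interpret prob_space \<mu> by fact
  let ?X = "independent_sets adj" and ?C = "cylinder_algebra adj"
  let ?E = "{{I \<in> ?X. A \<subseteq> I} | A. finite A}"
  have sp: "space \<mu> = ?X" using sets_eq_imp_space_eq[OF \<mu>(2)] by simp
  fix \<Lambda> A assume \<Lambda>: "finite (\<Lambda> :: 'v set)" and A: "A \<in> sets ?C"
  have ker: "hc_kernel \<Lambda> \<in> \<mu> \<rightarrow>\<^sub>M subprob_algebra \<mu>"
    using measurable_from_subalg[OF subalgebra_off_algebra[OF \<mu>(2)] hc_kernel_measurable[OF \<Lambda> \<mu>(2)]]
    by (rule measurable_prob_algebraD)
  have emeas: "emeasure (hc_kernel \<Lambda> I) B = ennreal (measure (hc_kernel \<Lambda> I) B)" for I B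
  proof -
    interpret K: prob_space "hc_kernel \<Lambda> I" by (rule prob_space_hc_kernel)
    show ?thesis by (rule K.emeasure_eq_measure)
  qed
  have le1: "measure (hc_kernel \<Lambda> I) B \<le> 1" for I B
  proof -
    interpret K: prob_space "hc_kernel \<Lambda> I" by (rule prob_space_hc_kernel)
    show ?thesis by (rule K.prob_le_1)
  qed
  have bind: "emeasure (\<mu> \<bind> hc_kernel \<Lambda>) B = ennreal (\<integral>I. measure (hc_kernel \<Lambda> I) B \<partial>\<mu>)"
    if B: "B \<in> sets ?C" for B
  proof -
    have "emeasure (\<mu> \<bind> hc_kernel \<Lambda>) B = (\<integral>\<^sup>+I. ennreal (measure (hc_kernel \<Lambda> I) B) \<partial>\<mu>)"
      using emeasure_bind[OF not_empty ker, of B] B by (simp add: \<mu>(2) emeas)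
    also have "\<dots> = ennreal (\<integral>I. measure (hc_kernel \<Lambda> I) B \<partial>\<mu>)"
      using kernel_borel[OF \<mu>(2) \<Lambda> B] le1
      by (intro nn_integral_eq_integral integrable_const_bound[where B = 1]) auto
    finally show ?thesis .
  qed
  have sets_bind': "sets (\<mu> \<bind> hc_kernel \<Lambda>) = sets ?C"
    by (rule sets_bind[OF sets_hc_kernel not_empty])
  have "\<mu> \<bind> hc_kernel \<Lambda> = \<mu>"
  proof (rule measure_eqI_generator_eq[where E = ?E and \<Omega> = ?X and A = "\<lambda>_. ?X"])
    show "Int_stable ?E" by (rule Int_stable_inclusion_events)
    show "?E \<subseteq> Pow ?X" by blast
    show "sets (\<mu> \<bind> hc_kernel \<Lambda>) = sigma_sets ?X ?E" "sets \<mu> = sigma_sets ?X ?E"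
      using sets_bind' \<mu>(2) sets_cylinder_algebra_inclusion by metis+
    have "?X = {I \<in> ?X. {} \<subseteq> I}" by simp
    then have "?X \<in> ?E" by blast
    then show "range (\<lambda>_ :: nat. ?X) \<subseteq> ?E" by blast
    show "emeasure (\<mu> \<bind> hc_kernel \<Lambda>) ?X \<noteq> \<infinity>" for i :: nat
      using bind[OF sets.top[of ?C]] by simp
    fix F assume "F \<in> ?E"
    then obtain B where B: "finite B" "F = {I \<in> ?X. B \<subseteq> I}" by blast
    have F: "F \<in> sets ?C" unfolding B(2) by (rule inclusion_event_sets[OF B(1)])
    have "(\<integral>I. measure (hc_kernel \<Lambda> I) F \<partial>\<mu>) = (\<integral>I. measure_pmf.prob (hc_pmf adj l \<Lambda> I) {K. B \<subseteq> K} \<partial>\<mu>)"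
    proof (rule Bochner_Integration.integral_cong[OF refl])
      fix I assume "I \<in> space \<mu>"
      then have I: "I \<in> ?X" by (simp add: sp)
      have "measure (hc_kernel \<Lambda> I) F = measure_pmf.prob (hc_pmf adj l \<Lambda> I) F"
        by (rule measure_hc_kernel[OF \<Lambda> I F])
      also have "\<dots> = measure_pmf.prob (hc_pmf adj l \<Lambda> I) {K. B \<subseteq> K}"
        unfolding B(2) by (rule measure_pmf.finite_measure_eq_AE)
          (auto simp: AE_measure_pmf_iff set_hc_pmf[OF \<Lambda> I] hc_configs_def)
      finally show "measure (hc_kernel \<Lambda> I) F = measure_pmf.prob (hc_pmf adj l \<Lambda> I) {K. B \<subseteq> K}" .
    qed
    then show "emeasure (\<mu> \<bind> hc_kernel \<Lambda>) F = emeasure \<mu> F"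
      using bind[OF F] inv[OF \<Lambda> B(1)] by (simp add: B(2) emeasure_eq_measure)
  qed simp
  then show "(\<integral>I. measure (hc_kernel \<Lambda> I) A \<partial>\<mu>) = measure \<mu> A"
    using bind[OF A] by (simp add: emeasure_eq_measure integral_nonneg)
qed (use \<mu> in auto)

text \<open>Resampling in the volume consisting of \<open>A\<close> and its neighbours produces \<open>A\<close> with positive
  probability, whatever the configuration outside.\<close>

lemma dlr_invariant_positive:
  assumes \<mu>: "dlr_invariant \<mu>" and A: "finite A" "A \<in> independent_sets adj"
  shows "0 < measure \<mu> {I \<in> independent_sets adj. A \<subseteq> I}"
proof -
  let ?X = "independent_sets adj" and ?C = "cylinder_algebra adj"
  let ?E = "{I \<in> ?X. A \<subseteq> I}"
  \<comment> \<open>Clearing this volume and putting \<open>A\<close> into it gives an independent set.\<close>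
  define \<Lambda> where "\<Lambda> = A \<union> nbhd A"
  have \<Lambda>: "finite \<Lambda>" using A(1) finite_nbhd by (simp add: \<Lambda>_def)
  interpret prob_space \<mu> using \<mu> by (simp add: dlr_invariant_def)
  have sets: "sets \<mu> = sets ?C" using \<mu> by (simp add: dlr_invariant_def)
  have sp: "space \<mu> = ?X" using sets_eq_imp_space_eq[OF sets] by simp
  have E: "?E \<in> sets ?C" by (rule inclusion_event_sets[OF A(1)])
  let ?g = "\<lambda>I. measure (hc_kernel \<Lambda> I) ?E"
  have pos: "0 < ?g I" if I: "I \<in> ?X" for I
  proof -
    let ?J = "A \<union> (I - \<Lambda>)"
    have J: "?J \<in> ?X"
      unfolding independent_sets_def
    proof (intro CollectI ballI)
      fix u v assume "u \<in> ?J" "v \<in> ?J"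
      then consider "u \<in> A" "v \<in> A" | "u \<in> I" "v \<in> I" | "u \<in> A" "v \<notin> nbhd A" | "v \<in> A" "u \<notin> nbhd A"
        unfolding \<Lambda>_def by blast
      then show "\<not> adj u v"
        by cases (use A(2) I in \<open>auto simp: independent_sets_def nbhd_def\<close>)
    qed
    moreover have "?J \<inter> - \<Lambda> = I \<inter> - \<Lambda>" unfolding \<Lambda>_def by blast
    ultimately have "?J \<in> hc_configs adj \<Lambda> I" by (simp add: hc_configs_def)
    then have "0 < pmf (hc_pmf adj l \<Lambda> I) ?J"
      using hc_partition_pos[OF \<Lambda> I] l_pos by (simp add: pmf_hc_pmf[OF \<Lambda> I])
    also have "\<dots> \<le> measure_pmf.prob (hc_pmf adj l \<Lambda> I) ?E"
      unfolding measure_pmf_single[symmetric]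
      by (rule measure_pmf.finite_measure_mono) (use J in auto)
    finally show ?thesis by (simp add: measure_hc_kernel[OF \<Lambda> I E])
  qed
  have int: "integrable \<mu> ?g"
  proof (rule integrable_const_bound[where B = 1])
    show "AE I in \<mu>. norm (?g I) \<le> 1"
      using prob_space.prob_le_1[OF prob_space_hc_kernel] by (intro AE_I2) simp
  qed (rule kernel_borel[OF sets \<Lambda> E])
  have "(\<integral>I. ?g I \<partial>\<mu>) \<noteq> 0"
  proof
    assume "(\<integral>I. ?g I \<partial>\<mu>) = 0"
    then have "AE I in \<mu>. ?g I = 0"
      using integral_nonneg_eq_0_iff_AE[OF int] by simp
    then have "AE I in \<mu>. False"
      using AE_space by eventually_elim (use pos sp in fastforce)
    then show False by simp
  qed
  moreover have "(\<integral>I. ?g I \<partial>\<mu>) = measure \<mu> ?E"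
    using \<mu> \<Lambda> E by (simp add: dlr_invariant_def)
  ultimately show ?thesis by (simp add: zero_less_measure_iff)
qed

lemma singleton_sets:
  assumes "J \<in> independent_sets adj"
  shows "{J} \<in> sets (cylinder_algebra adj)"
proof -
  let ?C = "cylinder_algebra adj"
  have "{I \<in> independent_sets adj. I \<inter> {v} = J \<inter> {v}} \<in> sets ?C" for v
    by (rule local_event_sets) simp
  then have "(\<Inter>v. {I \<in> independent_sets adj. I \<inter> {v} = J \<inter> {v}}) \<in> sets ?C"
    by (intro sets.countable_INT') auto
  also have "(\<Inter>v. {I \<in> independent_sets adj. I \<inter> {v} = J \<inter> {v}}) = {J}"
    using assms by blast
  finally show ?thesis .
qed

text \<open>The resampling kernel is the conditional distribution. An event \<open>B\<close> of the algebra off \<open>\<Lambda>\<close> is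
  not changed by resampling, so integrating the kernel's probability of \<open>A\<close> over \<open>B\<close> gives the
  integral of its probability of \<open>A \<inter> B\<close>, which invariance evaluates.\<close>

lemma dlr_invariant_gibbs:
  assumes \<mu>: "dlr_invariant \<mu>"
  shows "hc_gibbs adj l \<mu>"
  unfolding hc_gibbs_def
proof (intro conjI allI impI)
  let ?X = "independent_sets adj" and ?C = "cylinder_algebra adj"
  show ps: "prob_space \<mu>" and sets: "sets \<mu> = sets ?C" using \<mu> by (auto simp: dlr_invariant_def)
  interpret prob_space \<mu> by fact
  have sp: "space \<mu> = ?X" using sets_eq_imp_space_eq[OF sets] by simp
  fix \<Lambda> :: "'v set" assume \<Lambda>: "finite \<Lambda>"
  let ?F = "off_algebra adj \<Lambda>"
  have sub: "subalgebra \<mu> ?F" by (rule subalgebra_off_algebra[OF sets])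
  interpret finite_measure_subalgebra \<mu> ?F by unfold_locales (rule sub)
  have "AE x in \<mu>. real_cond_exp \<mu> ?F (indicat_real A) x = measure (hc_kernel \<Lambda> x) A"
    if A': "A \<in> sets \<mu>" for A
  proof (rule real_cond_exp_charact)
    have A: "A \<in> sets ?C" using A' sets by simp
    show "integrable \<mu> (indicat_real A)" using A' by (simp add: emeasure_eq_measure)
    show "(\<lambda>x. measure (hc_kernel \<Lambda> x) A) \<in> borel_measurable ?F"
      by (rule measurable_hc_kernel_event[OF \<Lambda> A])
    show "integrable \<mu> (\<lambda>x. measure (hc_kernel \<Lambda> x) A)"
    proof (rule integrable_const_bound[where B = 1])
      show "AE I in \<mu>. norm (measure (hc_kernel \<Lambda> I) A) \<le> 1"
        using prob_space.prob_le_1[OF prob_space_hc_kernel] by (intro AE_I2) simp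
    qed (rule kernel_borel[OF sets \<Lambda> A])
    fix B assume B: "B \<in> sets ?F"
    then have B': "B \<in> sets ?C" using sub sets by (auto simp: subalgebra_def)
    have AB: "A \<inter> B \<in> sets ?C" using A B' by (rule sets.Int)
    have "(\<integral>x\<in>B. measure (hc_kernel \<Lambda> x) A \<partial>\<mu>) = (\<integral>x. measure (hc_kernel \<Lambda> x) (A \<inter> B) \<partial>\<mu>)"
      unfolding set_lebesgue_integral_def
    proof (rule Bochner_Integration.integral_cong[OF refl])
      fix I assume "I \<in> space \<mu>"
      then have I: "I \<in> ?X" by (simp add: sp)
      have same: "K \<in> B \<longleftrightarrow> I \<in> B" if "K \<in> hc_configs adj \<Lambda> I" for K
        using off_algebra_invariant[OF B, of K I] that I by (simp add: hc_configs_def)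
      have "measure_pmf.prob (hc_pmf adj l \<Lambda> I) (A \<inter> B) =
          indicator B I * measure_pmf.prob (hc_pmf adj l \<Lambda> I) A"
      proof (cases "I \<in> B")
        case True
        have "measure_pmf.prob (hc_pmf adj l \<Lambda> I) (A \<inter> B) = measure_pmf.prob (hc_pmf adj l \<Lambda> I) A"
          by (rule measure_pmf.finite_measure_eq_AE)
            (use same True in \<open>auto simp: AE_measure_pmf_iff set_hc_pmf[OF \<Lambda> I]\<close>)
        then show ?thesis using True by simp
      next
        case False
        have "measure_pmf.prob (hc_pmf adj l \<Lambda> I) (A \<inter> B) = measure_pmf.prob (hc_pmf adj l \<Lambda> I) {}"
          by (rule measure_pmf.finite_measure_eq_AE)
            (use same False in \<open>auto simp: AE_measure_pmf_iff set_hc_pmf[OF \<Lambda> I]\<close>)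
        then show ?thesis using False by simp
      qed
      then show "indicat_real B I *\<^sub>R measure (hc_kernel \<Lambda> I) A = measure (hc_kernel \<Lambda> I) (A \<inter> B)"
        by (simp add: measure_hc_kernel[OF \<Lambda> I A] measure_hc_kernel[OF \<Lambda> I AB])
    qed
    also have "\<dots> = measure \<mu> (A \<inter> B)"
      using \<mu> \<Lambda> AB by (simp add: dlr_invariant_def)
    also have "\<dots> = (\<integral>x\<in>B. indicat_real A x \<partial>\<mu>)"
    proof -
      have "(\<integral>x\<in>B. indicat_real A x \<partial>\<mu>) = (\<integral>x. indicat_real (A \<inter> B) x \<partial>\<mu>)"
        unfolding set_lebesgue_integral_def
        by (rule Bochner_Integration.integral_cong) (auto simp: indicator_def)
      then show ?thesis using AB sets sets.sets_into_space[of "A \<inter> B" \<mu>] by (simp add: Int_absorb2)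
    qed
    finally show "(\<integral>x\<in>B. indicat_real A x \<partial>\<mu>) = (\<integral>x\<in>B. measure (hc_kernel \<Lambda> x) A \<partial>\<mu>)" by simp
  qed
  then have "regular_cond_prob \<mu> ?F (hc_kernel \<Lambda>)"
    using hc_kernel_measurable[OF \<Lambda> sets] by (simp add: regular_cond_prob_def)
  moreover have "AE I in \<mu>. \<forall>J\<in>?X. measure (hc_kernel \<Lambda> I) {J} =
      (if I \<inter> - \<Lambda> = J \<inter> - \<Lambda> then l ^ card (J \<inter> \<Lambda>) / hc_partition adj l \<Lambda> I else 0)"
  proof (rule AE_I2, rule ballI)
    fix I J assume "I \<in> space \<mu>" and J: "J \<in> ?X"
    then have I: "I \<in> ?X" by (simp add: sp)
    have "measure (hc_kernel \<Lambda> I) {J} = pmf (hc_pmf adj l \<Lambda> I) J"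
      by (simp add: measure_hc_kernel[OF \<Lambda> I singleton_sets[OF J]] measure_pmf_single)
    then show "measure (hc_kernel \<Lambda> I) {J} =
      (if I \<inter> - \<Lambda> = J \<inter> - \<Lambda> then l ^ card (J \<inter> \<Lambda>) / hc_partition adj l \<Lambda> I else 0)"
      using J by (auto simp: pmf_hc_pmf[OF \<Lambda> I] hc_configs_def)
  qed
  ultimately show "\<exists>\<kappa>. regular_cond_prob \<mu> ?F \<kappa> \<and> (AE I in \<mu>. \<forall>J\<in>?X. measure (\<kappa> I) {J} =
      (if I \<inter> - \<Lambda> = J \<inter> - \<Lambda> then l ^ card (J \<inter> \<Lambda>) / hc_partition adj l \<Lambda> I else 0))" by blast
qed

text \<open>For a finite set \<open>\<Lambda>\<close> and all large \<open>n\<close>, the finite-volume measure on \<open>\<Delta> n\<close> is invariant under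
  resampling in \<open>\<Lambda>\<close>; since the kernel is local, the invariance passes to the limit.\<close>

theorem gibbs_limit_exists:
  assumes \<Delta>: "\<And>n. finite (\<Delta> n)" "\<And>\<Lambda>. finite \<Lambda> \<Longrightarrow> eventually (\<lambda>n. \<Lambda> \<subseteq> \<Delta> n) sequentially"
    and B: "\<And>n. B n \<in> independent_sets adj"
  obtains G \<mu> where "G \<noteq> bot" "G \<le> sequentially" "hc_gibbs adj l \<mu>"
    and "\<And>A. finite A \<Longrightarrow> A \<in> independent_sets adj \<Longrightarrow> 0 < measure \<mu> {I \<in> independent_sets adj. A \<subseteq> I}"
    and "\<And>A. finite A \<Longrightarrow> ((\<lambda>n. measure_pmf.prob (hc_pmf adj l (\<Delta> n) (B n)) {I. A \<subseteq> I})
        \<longlongrightarrow> measure \<mu> {I \<in> independent_sets adj. A \<subseteq> I}) G"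
proof -
  let ?X = "independent_sets adj"
  let ?p = "\<lambda>n. hc_pmf adj l (\<Delta> n) (B n)"
  have supp: "set_pmf (?p n) \<subseteq> ?X" for n
    by (auto simp: set_hc_pmf[OF \<Delta>(1) B] hc_configs_def)
  obtain G \<mu> where G: "G \<noteq> bot" "G \<le> sequentially" and \<mu>: "prob_space \<mu>" "sets \<mu> = sets (cylinder_algebra adj)"
    and conv: "\<And>J a. finite J \<Longrightarrow>
      ((\<lambda>n. measure_pmf.prob (?p n) {I. I \<inter> J = a}) \<longlongrightarrow> measure \<mu> {I \<in> ?X. I \<inter> J = a}) G"
    using limit_measure_exists[of ?p adj, OF supp] by blast
  have conv': "((\<lambda>n. measure_pmf.prob (?p n) {I. A \<subseteq> I}) \<longlongrightarrow> measure \<mu> {I \<in> ?X. A \<subseteq> I}) G" if "finite A" for A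
  proof -
    have "I \<inter> A = A \<longleftrightarrow> A \<subseteq> I" for I by blast
    then show ?thesis using conv[OF that, of A] by simp
  qed
  have "dlr_invariant \<mu>"
  proof (rule dlr_invariantI[OF \<mu>])
    fix \<Lambda> A :: "'v set" assume \<Lambda>: "finite \<Lambda>" and A: "finite A"
    let ?g = "\<lambda>I. measure_pmf.prob (hc_pmf adj l \<Lambda> I) {K. A \<subseteq> K}"
    have "((\<lambda>n. measure_pmf.expectation (?p n) ?g) \<longlongrightarrow> integral\<^sup>L \<mu> ?g) G"
      using A \<Lambda> finite_nbhd
      by (intro expectation_local_function_limit[where J = "A \<union> nbhd \<Lambda>", OF supp \<mu>]
          conv prob_hc_pmf_local[OF \<Lambda>]) simp_all
    moreover have "((\<lambda>n. measure_pmf.expectation (?p n) ?g) \<longlongrightarrow> measure \<mu> {I \<in> ?X. A \<subseteq> I}) G"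
    proof (rule Lim_transform_eventually[OF conv'[OF A]])
      have "eventually (\<lambda>n. measure_pmf.prob (?p n) {I. A \<subseteq> I} = measure_pmf.expectation (?p n) ?g) sequentially"
        using \<Delta>(2)[OF \<Lambda>]
      proof eventually_elim
        case (elim n)
        show ?case
          using prob_bind_pmf[of "?p n" "hc_pmf adj l \<Lambda>" "{I. A \<subseteq> I}"]
          unfolding hc_pmf_consistent[OF elim \<Delta>(1) B] .
      qed
      then show "eventually (\<lambda>n. measure_pmf.prob (?p n) {I. A \<subseteq> I} = measure_pmf.expectation (?p n) ?g) G"
        using G(2) by (rule filter_leD[rotated])
    qed
    ultimately show "integral\<^sup>L \<mu> ?g = measure \<mu> {I \<in> ?X. A \<subseteq> I}"
      by (rule tendsto_unique[OF G(1)])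
  qed
  then show thesis
    using that[OF G] conv' dlr_invariant_gibbs dlr_invariant_positive by blast
qed

end

section \<open>Contours and height functions\<close>

definition units :: "vertex set" where
  "units = {(1, 0), (0, 1), (-1, 0), (0, -1)}"

fun rot :: "vertex \<Rightarrow> vertex" where
  "rot (a, b) = (- b, a)"

fun even_vertex :: "vertex \<Rightarrow> bool" where
  "even_vertex (x, y) \<longleftrightarrow> even (x + y)"

text \<open>Equivalently, every edge that leaves \<open>W\<close> goes from an even vertex in \<open>W\<close> to an odd vertex outside.\<close>

definition odd_closed :: "vertex set \<Rightarrow> bool" where
  "odd_closed W \<longleftrightarrow> (\<forall>z\<in>W. \<not> even_vertex z \<longrightarrow> (\<forall>d\<in>units. z + d \<in> W))"

text \<open>The pair \<open>(e, d)\<close> stands for the boundary edge from the even vertex \<open>e\<close> to the odd vertex \<open>e + d\<close>.\<close>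

definition contour :: "vertex set \<Rightarrow> (vertex \<times> vertex) set" where
  "contour W = {(e, d). d \<in> units \<and> even_vertex e \<and> e \<in> W \<and> e + d \<notin> W}"

text \<open>The contour is followed with its even ends on the left. Crossing the edge \<open>(e, d)\<close> leads into the
  face with corners \<open>e\<close>, \<open>e + d\<close>, \<open>e + d + rot d\<close>, \<open>e + rot d\<close>. There the contour turns
  left around \<open>e\<close> if the other odd corner is outside \<open>W\<close>, and right around \<open>e + d\<close> otherwise.
  If the even corners are in \<open>W\<close> and the odd corners are not, then the contour passes through the
  face twice; both passages turn left.\<close>

fun next_edge :: "vertex set \<Rightarrow> vertex \<times> vertex \<Rightarrow> vertex \<times> vertex" where
  "next_edge W (e, d) = (if e + rot d \<in> W then (e + d + rot d, - rot d) else (e, rot d))"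

lemma z2_adj_iff: "z2_adj u v \<longleftrightarrow> v - u \<in> units"
  by (cases u; cases v) (auto simp: units_def)

lemma rot_units: "d \<in> units \<Longrightarrow> rot d \<in> units"
  by (auto simp: units_def)

lemma minus_units: "d \<in> units \<Longrightarrow> - d \<in> units"
  by (auto simp: units_def)

lemma rot_rot [simp]: "rot (rot d) = - d"
  by (cases d) simp

lemma rot_minus [simp]: "rot (- d) = - rot d"
  by (cases d) simp

lemma rot_eq_iff [simp]: "rot d = rot d' \<longleftrightarrow> d = d'"
  by (cases d; cases d') auto

lemma rot_neq_minus_rot: "d \<in> units \<Longrightarrow> rot d \<noteq> - rot d" "d \<in> units \<Longrightarrow> d \<noteq> - d"
  by (auto simp: units_def)

lemma even_vertex_add_unit: "d \<in> units \<Longrightarrow> even_vertex (z + d) \<longleftrightarrow> \<not> even_vertex z"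
  by (cases z) (auto simp: units_def)

lemma finite_units: "finite units" by (simp add: units_def)

lemma finite_contour: "finite W \<Longrightarrow> finite (contour W)"
  by (rule finite_subset[of _ "W \<times> units"]) (auto simp: contour_def finite_units)

lemma next_edge_in_contour:
  assumes "odd_closed W" "b \<in> contour W"
  shows "next_edge W b \<in> contour W"
proof -
  obtain e d where b: "b = (e, d)" by (cases b)
  have d: "d \<in> units" "even_vertex e" "e \<in> W" "e + d \<notin> W"
    using assms(2) by (auto simp: b contour_def)
  show ?thesis
  proof (cases "e + rot d \<in> W")
    case True
    have "\<not> even_vertex (e + rot d)" using d by (simp add: even_vertex_add_unit rot_units)
    then have "e + rot d + d \<in> W" using assms(1) True d by (auto simp: odd_closed_def)
    moreover have "even_vertex (e + d + rot d)" using d by (simp add: even_vertex_add_unit rot_units)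
    ultimately show ?thesis using True d
      by (simp add: b contour_def rot_units minus_units add_ac)
  qed (use d in \<open>auto simp: b contour_def rot_units\<close>)
qed

text \<open>A left turn and a right turn cannot end in the same edge: the same odd corner of the face
  would have to be outside \<open>W\<close> for the one and inside \<open>W\<close> for the other.\<close>

lemma inj_on_next_edge: "inj_on (next_edge W) (contour W)"
proof -
  have *: False if "(e, d) \<in> contour W" "(e', d') \<in> contour W"
      "e + rot d \<in> W" "e' + rot d' \<notin> W" "(e + d + rot d, - rot d) = (e', rot d')" for e d e' d'
  proof -
    have "rot (- d) = rot d'" using that(5) by simp
    then have "d' = - d" by (simp only: rot_eq_iff)
    then have "e' + d' = e + rot d" using that(5) by auto
    then show False using that(2,3) by (auto simp: contour_def)
  qed
  show ?thesis
  proof (rule inj_onI)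
    fix b b' assume b: "b \<in> contour W" "b' \<in> contour W" "next_edge W b = next_edge W b'"
    obtain e d where b1: "b = (e, d)" by (cases b)
    obtain e' d' where b2: "b' = (e', d')" by (cases b')
    show "b = b'"
      using b *[of e d e' d'] *[of e' d' e d] unfolding b1 b2
      by (auto split: if_splits)
  qed
qed

lemma finite_support_bound:
  assumes "finite {z :: vertex. f z \<noteq> (0 :: int)}"
  obtains N where "\<And>x y. f (x, y) \<noteq> 0 \<Longrightarrow> \<bar>x\<bar> < N \<and> \<bar>y\<bar> < N"
proof -
  let ?A = "(\<lambda>z. \<bar>fst z\<bar>) ` {z. f z \<noteq> 0} \<union> (\<lambda>z. \<bar>snd z\<bar>) ` {z. f z \<noteq> 0}"
  have "finite ?A" using assms by blast
  then have "\<forall>k\<in>?A. k < Max ?A + 1" by (auto simp: zless_add1_eq intro: Max_ge)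
  then show thesis using that[of "Max ?A + 1"] by force
qed

text \<open>Summing the horizontal increments along the ray to the right gives the potential; as the curl
  vanishes, its vertical increments telescope to \<open>b\<close>.\<close>

lemma discrete_potential:
  fixes a b :: "vertex \<Rightarrow> int"
  assumes curl: "\<And>x y. a (x, y) + b (x + 1, y) = b (x, y) + a (x, y + 1)"
    and fa: "finite {z. a z \<noteq> 0}" and fb: "finite {z. b z \<noteq> 0}"
  obtains h where "finite {z. h z \<noteq> 0}"
    and "\<And>x y. h (x, y) - h (x + 1, y) = a (x, y)"
    and "\<And>x y. h (x, y) - h (x, y + 1) = b (x, y)"
proof -
  obtain N1 where N1: "\<And>x y. a (x, y) \<noteq> 0 \<Longrightarrow> \<bar>x\<bar> < N1 \<and> \<bar>y\<bar> < N1"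
    using finite_support_bound[OF fa] by blast
  obtain N2 where N2: "\<And>x y. b (x, y) \<noteq> 0 \<Longrightarrow> \<bar>x\<bar> < N2 \<and> \<bar>y\<bar> < N2"
    using finite_support_bound[OF fb] by blast
  define N where "N = max N1 N2"
  have az: "a (x, y) = 0" if "\<bar>x\<bar> \<ge> N \<or> \<bar>y\<bar> \<ge> N" for x y
    using N1[of x y] that by (force simp: N_def)
  have bz: "b (x, y) = 0" if "\<bar>x\<bar> \<ge> N \<or> \<bar>y\<bar> \<ge> N" for x y
    using N2[of x y] that by (force simp: N_def)
  define h where "h = (\<lambda>(x, y). \<Sum>i\<in>{x..<N}. a (i, y))"
  have h1: "h (x, y) - h (x + 1, y) = a (x, y)" for x y
  proof (cases "x < N")
    case True
    then have "{x..<N} = insert x {x + 1..<N}" by auto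
    then show ?thesis by (simp add: h_def)
  qed (use az[of x y] in \<open>simp add: h_def; linarith\<close>)
  have h2: "h (x, y) - h (x, y + 1) = b (x, y)" for x y
  proof (cases "x \<le> N")
    case True
    then show ?thesis
    proof (induction x rule: int_le_induct)
      case base then show ?case using bz[of N y] abs_ge_self[of N] by (simp add: h_def)
    next
      case (step x)
      then show ?case using h1[of "x - 1" y] h1[of "x - 1" "y + 1"] curl[of "x - 1" y] by simp
    qed
  qed (use bz[of x y] in \<open>simp add: h_def; linarith\<close>)
  have hz: "h (x, y) = 0" if "x \<ge> N \<or> \<bar>y\<bar> \<ge> N" for x y
    using that by (auto simp: h_def az)
  have hy: "h (x, y) = 0" if "x \<le> - N" for x y
  proof (cases "y \<le> \<bar>N\<bar>")
    case True
    then show ?thesis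
    proof (induction y rule: int_le_induct)
      case base then show ?case using hz[of x "\<bar>N\<bar>"] abs_ge_self[of N] by simp
    next
      case (step y)
      have "b (x, y - 1) = 0" using that by (intro bz) auto
      then show ?case using step h2[of x "y - 1"] by simp
    qed
  qed (intro hz, linarith)
  have "{z. h z \<noteq> 0} \<subseteq> {-N..N} \<times> {-N..N}"
  proof clarify
    fix x y assume "h (x, y) \<noteq> 0"
    then show "x \<in> {-N..N} \<and> y \<in> {-N..N}" using hz[of x y] hy[of x y] by force
  qed
  then have "finite {z. h z \<noteq> 0}" by (rule finite_subset) simp
  then show thesis using that[of h] h1 h2 by blast
qed

lemma finite_support_const_zero:
  fixes h :: "vertex \<Rightarrow> int"
  assumes fin: "finite {z. h z \<noteq> 0}" and c: "\<And>x y. h (x, y) = h (x + 1, y)"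
  shows "h z = 0"
proof -
  obtain x y where z: "z = (x, y)" by (cases z)
  obtain N where N: "\<And>x y. h (x, y) \<noteq> 0 \<Longrightarrow> \<bar>x\<bar> < N \<and> \<bar>y\<bar> < N"
    using finite_support_bound[OF fin] by blast
  have *: "h (x + int k, y) = h (x, y)" for k
  proof (induction k)
    case (Suc k)
    then show ?case using c[of "x + int k" y] by (simp add: algebra_simps)
  qed simp
  have "h (x + int (nat (\<bar>N\<bar> + \<bar>x\<bar>)), y) = 0"
    using N[of "x + int (nat (\<bar>N\<bar> + \<bar>x\<bar>))" y] by linarith
  then show ?thesis using *[of "nat (\<bar>N\<bar> + \<bar>x\<bar>)"] z by simp
qed

text \<open>Two of the four edges around a face lead into it and two lead out of it. The map \<open>next_edge\<close> takes
  edges of the first kind to edges of the second kind of the same face, so that an invariant set contains equally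
  many of each. This says that the jumps prescribed by \<open>D\<close> have no curl.\<close>

lemma contour_flux:
  assumes D: "D \<subseteq> contour W" "next_edge W ` D = D" and d: "d \<in> units"
  shows "of_bool ((e, d) \<in> D) + of_bool ((e + d + rot d, - d) \<in> D) =
    (of_bool ((e, rot d) \<in> D) + of_bool ((e + d + rot d, - rot d) \<in> D) :: int)"
proof -
  let ?n = "next_edge W"
  let ?A = "(e, d)" and ?A' = "(e + d + rot d, - d)"
  let ?B = "(e, rot d)" and ?B' = "(e + d + rot d, - rot d)"
  have ne: "?A \<noteq> ?A'" "?B \<noteq> ?B'" using rot_neq_minus_rot[OF d] by auto
  have img: "?n ?A \<in> {?B, ?B'}" "?n ?A' \<in> {?B, ?B'}" by (auto simp: algebra_simps)
  have pre: "b \<in> {?A, ?A'}" if "?n b \<in> {?B, ?B'}" for b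
  proof -
    obtain f g where b: "b = (f, g)" by (cases b)
    have r: "- rot g = rot d \<longleftrightarrow> g = - d" "rot g = - rot d \<longleftrightarrow> g = - d"
      by (metis rot_eq_iff rot_minus minus_minus)+
    show ?thesis
    proof (cases "f + rot g \<in> W")
      case True
      then have "(f + g + rot g, - rot g) \<in> {?B, ?B'}" using that by (simp add: b)
      then show ?thesis unfolding b by (auto simp: r)
    next
      case False
      then have "(f, rot g) \<in> {?B, ?B'}" using that by (simp add: b)
      then show ?thesis unfolding b by (auto simp: r)
    qed
  qed
  have "?n ` (D \<inter> {?A, ?A'}) = D \<inter> {?B, ?B'}"
  proof (intro equalityI subsetI)
    fix c assume c: "c \<in> D \<inter> {?B, ?B'}"
    then have "c \<in> ?n ` D" using D(2) by (simp only: Int_iff)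
    then obtain b where "b \<in> D" "c = ?n b" by (rule imageE)
    then show "c \<in> ?n ` (D \<inter> {?A, ?A'})" using pre[of b] c by (intro image_eqI[of _ _ b]) simp_all
  next
    fix c assume "c \<in> ?n ` (D \<inter> {?A, ?A'})"
    then obtain b where b: "c = ?n b" "b \<in> D" "b = ?A \<or> b = ?A'" by (elim imageE) simp
    have "c \<in> D" unfolding b(1) using D(2) b(2) by (metis imageI)
    moreover have "c \<in> {?B, ?B'}" using b(1,3) img by (simp only:) (elim disjE, simp_all only:)
    ultimately show "c \<in> D \<inter> {?B, ?B'}" by (rule IntI)
  qed
  moreover have "inj_on ?n (D \<inter> {?A, ?A'})"
    using inj_on_next_edge by (rule inj_on_subset) (use D(1) in blast)
  ultimately have eq: "card (D \<inter> {?A, ?A'}) = card (D \<inter> {?B, ?B'})"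
    by (metis card_image)
  have card2: "of_bool (x \<in> D) + of_bool (y \<in> D) = int (card (D \<inter> {x, y}))"
    if "x \<noteq> y" for x y :: "vertex \<times> vertex"
    using that by (cases "x \<in> D"; cases "y \<in> D") auto
  show ?thesis unfolding card2[OF ne(1)] card2[OF ne(2)] eq ..
qed

text \<open>The winding number around each vertex of the closed curves formed by \<open>D\<close>.\<close>

lemma contour_height:
  assumes D: "D \<subseteq> contour W" "next_edge W ` D = D" and fin: "finite W"
  obtains h :: "vertex \<Rightarrow> int" where "finite {z. h z \<noteq> 0}"
    and "\<And>e d. even_vertex e \<Longrightarrow> d \<in> units \<Longrightarrow> h e - h (e + d) = of_bool ((e, d) \<in> D)"
proof -
  \<comment> \<open>The jump from \<open>z + d\<close> to \<open>z\<close>, also when \<open>z\<close> is the odd end.\<close>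
  define J :: "vertex \<Rightarrow> vertex \<Rightarrow> int" where
    "J z d = (if even_vertex z then of_bool ((z, d) \<in> D) else - of_bool ((z + d, - d) \<in> D))" for z d
  have finD: "finite D" using D(1) finite_contour[OF fin] finite_subset by blast
  have finJ: "finite {z. J z d \<noteq> 0}" for d
  proof (rule finite_subset)
    show "{z. J z d \<noteq> 0} \<subseteq> fst ` D \<union> (\<lambda>b. fst b + snd b) ` D"
      by (force simp: J_def split: if_splits)
  qed (use finD in simp)
  have curl: "J z d + J (z + d) (rot d) = J z (rot d) + J (z + rot d) d" if d: "d \<in> units" for z d
  proof -
    have ev: "even_vertex (z + d) \<longleftrightarrow> \<not> even_vertex z" "even_vertex (z + rot d) \<longleftrightarrow> \<not> even_vertex z"
      using d by (simp_all add: even_vertex_add_unit rot_units)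
    have ac: "z + rot d + d = z + d + rot d" by (simp add: add_ac)
    have "z + d + rot d + rot (rot d) = z + rot d" by simp
    note fl = contour_flux[OF D d, of z] contour_flux[OF D rot_units[OF d], of "z + d", unfolded this]
    show ?thesis
    proof (cases "even_vertex z")
      case True
      then show ?thesis using fl(1) unfolding J_def ev ac by simp
    next
      case False
      then show ?thesis using fl(2) unfolding J_def ev ac by simp
    qed
  qed
  have u: "(1, 0) \<in> units" "(0, 1) \<in> units" by (auto simp: units_def)
  obtain h where h: "finite {z. h z \<noteq> 0}"
      "\<And>x y. h (x, y) - h (x + 1, y) = J (x, y) (1, 0)"
      "\<And>x y. h (x, y) - h (x, y + 1) = J (x, y) (0, 1)"
  proof (rule discrete_potential[of "\<lambda>z. J z (1, 0)" "\<lambda>z. J z (0, 1)"])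
    show "J (x, y) (1, 0) + J (x + 1, y) (0, 1) = J (x, y) (0, 1) + J (x, y + 1) (1, 0)" for x y
      using curl[OF u(1), of "(x, y)"] by simp
  qed (use finJ that in auto)
  have "h e - h (e + d) = of_bool ((e, d) \<in> D)" if e: "even_vertex e" "d \<in> units" for e d
  proof -
    obtain x y where xy: "e = (x, y)" by (cases e)
    from e(2) consider "d = (1, 0)" | "d = (0, 1)" | "d = (-1, 0)" | "d = (0, -1)"
      by (auto simp: units_def)
    then show ?thesis
    proof cases
      case 1 then show ?thesis using h(2)[of x y] e by (simp add: J_def xy)
    next
      case 2 then show ?thesis using h(3)[of x y] e by (simp add: J_def xy)
    next
      case 3 then show ?thesis using h(2)[of "x - 1" y] e by (simp add: J_def xy)
    next
      case 4 then show ?thesis using h(3)[of x "y - 1"] e by (simp add: J_def xy)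
    qed
  qed
  with h(1) show thesis using that by blast
qed

section \<open>Minimal regions\<close>

lemma jump_odd_closed:
  assumes "odd_closed W" "even_vertex e" "d \<in> units"
  shows "of_bool (e \<in> W) - of_bool (e + d \<in> W) = (of_bool ((e, d) \<in> contour W) :: int)"
proof -
  have "e \<in> W" if "e + d \<in> W"
  proof -
    have "\<not> even_vertex (e + d)" using assms by (simp add: even_vertex_add_unit)
    then have "e + d + - d \<in> W"
      using that assms(1) minus_units[OF assms(3)] unfolding odd_closed_def by blast
    then show ?thesis by simp
  qed
  then show ?thesis using assms by (auto simp: contour_def)
qed

lemma finite_support_locally_constant:
  fixes h :: "vertex \<Rightarrow> int"
  assumes "finite {z. h z \<noteq> 0}"
    and c: "\<And>e d. even_vertex e \<Longrightarrow> d \<in> units \<Longrightarrow> h e = h (e + d)"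
  shows "h z = 0"
proof (rule finite_support_const_zero)
  fix x y
  show "h (x, y) = h (x + 1, y)"
    using c[of "(x, y)" "(1, 0)"] c[of "(x + 1, y)" "(-1, 0)"]
    by (cases "even_vertex (x, y)") (auto simp: units_def)
qed fact

lemma contour_determines_region:
  assumes "finite W" "odd_closed W" "finite W'" "odd_closed W'" "contour W = contour W'"
  shows "W = W'"
proof -
  define h :: "vertex \<Rightarrow> int" where "h z = of_bool (z \<in> W) - of_bool (z \<in> W')" for z
  have "h z = 0" for z
  proof (rule finite_support_locally_constant)
    show "finite {z. h z \<noteq> 0}"
      by (rule finite_subset[of _ "W \<union> W'"]) (use assms in \<open>auto simp: h_def\<close>)
    show "h e = h (e + d)" if "even_vertex e" "d \<in> units" for e d
      using jump_odd_closed[OF assms(2) that] jump_odd_closed[OF assms(4) that] assms(5)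
      by (simp add: h_def)
  qed
  then have "z \<in> W \<longleftrightarrow> z \<in> W'" for z
    unfolding h_def by (cases "z \<in> W"; cases "z \<in> W'") (metis diff_0 diff_0_right of_bool_eq zero_neq_one neg_equal_0_iff_equal)+
  then show ?thesis by blast
qed

text \<open>Along edges the height only jumps up from an odd to an even vertex, and only across \<open>D\<close>.\<close>

lemma superlevel_set:
  fixes h :: "vertex \<Rightarrow> int"
  assumes fin: "finite {z. h z \<noteq> 0}"
    and jump: "\<And>e d. even_vertex e \<Longrightarrow> d \<in> units \<Longrightarrow> h e - h (e + d) = of_bool ((e, d) \<in> D)"
  shows "finite {z. h z \<ge> 1}" "odd_closed {z. h z \<ge> 1}" "contour {z. h z \<ge> 1} \<subseteq> D"
proof -
  show "finite {z. h z \<ge> 1}" by (rule finite_subset[OF _ fin]) auto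
  show "odd_closed {z. h z \<ge> 1}"
    unfolding odd_closed_def
  proof (intro ballI impI)
    fix z d assume z: "z \<in> {z. h z \<ge> 1}" "\<not> even_vertex z" "d \<in> units"
    then show "z + d \<in> {z. h z \<ge> 1}"
      using jump[of "z + d" "- d"] by (auto simp: even_vertex_add_unit minus_units of_bool_def split: if_splits)
  qed
  show "contour {z. h z \<ge> 1} \<subseteq> D"
  proof
    fix b assume "b \<in> contour {z. h z \<ge> 1}"
    then obtain e d where b: "b = (e, d)" "d \<in> units" "even_vertex e" "h e \<ge> 1" "\<not> h (e + d) \<ge> 1"
      by (auto simp: contour_def)
    then show "b \<in> D" using jump[of e d] by (auto simp: of_bool_def split: if_splits)
  qed
qed

lemma image_next_edge_contour:
  assumes "finite W" "odd_closed W"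
  shows "next_edge W ` contour W = contour W"
  using assms by (intro endo_inj_surj inj_on_next_edge) (auto intro: finite_contour next_edge_in_contour simp del: next_edge.simps)

text \<open>The heights of \<open>D\<close> and of the remaining contour
  edges sum up to the indicator function of \<open>W\<close>, since the difference has no jumps and finite support.
  Hence one of the heights is positive at \<open>s\<close>, and its superlevel set is a region with smaller contour.\<close>

lemma contour_split:
  assumes W: "finite W" "odd_closed W" "s \<in> W"
    and D: "D \<subseteq> contour W" "next_edge W ` D = D" "D \<noteq> {}" "D \<noteq> contour W"
  obtains W' where "finite W'" "odd_closed W'" "s \<in> W'" "contour W' \<subset> contour W"
proof -
  let ?D = "contour W - D"
  have D': "?D \<subseteq> contour W" "next_edge W ` ?D = ?D"
    using inj_on_image_set_diff[OF inj_on_next_edge[of W], of "contour W" D]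
      image_next_edge_contour[OF W(1,2)] D by auto
  obtain h :: "vertex \<Rightarrow> int" where h: "finite {z. h z \<noteq> 0}"
    "\<And>e d. even_vertex e \<Longrightarrow> d \<in> units \<Longrightarrow> h e - h (e + d) = of_bool ((e, d) \<in> D)"
    using contour_height[OF D(1,2) W(1)] by blast
  obtain g :: "vertex \<Rightarrow> int" where g: "finite {z. g z \<noteq> 0}"
    "\<And>e d. even_vertex e \<Longrightarrow> d \<in> units \<Longrightarrow> g e - g (e + d) = of_bool ((e, d) \<in> ?D)"
    using contour_height[OF D' W(1)] by blast
  have "h z + g z - of_bool (z \<in> W) = 0" for z
  proof (rule finite_support_locally_constant[where h = "\<lambda>z. h z + g z - of_bool (z \<in> W)"])
    show "finite {z. h z + g z - of_bool (z \<in> W) \<noteq> 0}"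
      by (rule finite_subset[of _ "{z. h z \<noteq> 0} \<union> {z. g z \<noteq> 0} \<union> W"]) (use h g W in auto)
    fix e d assume e: "even_vertex e" "d \<in> units"
    show "h e + g e - of_bool (e \<in> W) = h (e + d) + g (e + d) - of_bool (e + d \<in> W)"
      using h(2)[OF e] g(2)[OF e] jump_odd_closed[OF W(2) e] D(1)
      by (cases "(e, d) \<in> D"; cases "(e, d) \<in> contour W") auto
  qed
  from this[of s] W(3) have "h s \<ge> 1 \<or> g s \<ge> 1" by simp linarith
  then show thesis
  proof
    assume "h s \<ge> 1"
    with superlevel_set[OF h] D show thesis by (intro that[of "{z. h z \<ge> 1}"]) auto
  next
    assume "g s \<ge> 1"
    with superlevel_set[OF g] D show thesis by (intro that[of "{z. g z \<ge> 1}"]) auto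
  qed
qed

text \<open>Minimality is with respect to inclusion of contours, so that whatever holds for all edges of the
  contour of a region still holds for some minimal region.\<close>

definition minimal_region :: "vertex \<Rightarrow> vertex set \<Rightarrow> bool" where
  "minimal_region s W \<longleftrightarrow> finite W \<and> odd_closed W \<and> s \<in> W \<and>
     (\<forall>W'. finite W' \<and> odd_closed W' \<and> s \<in> W' \<longrightarrow> \<not> contour W' \<subset> contour W)"

lemma minimal_region_exists:
  assumes "finite R" "odd_closed R" "s \<in> R"
  obtains W where "minimal_region s W" "contour W \<subseteq> contour R"
proof -
  let ?P = "\<lambda>W. finite W \<and> odd_closed W \<and> s \<in> W \<and> contour W \<subseteq> contour R"
  have "?P R" using assms by simp
  then obtain W where W: "?P W" "\<And>W'. ?P W' \<Longrightarrow> card (contour W) \<le> card (contour W')"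
    using ex_has_least_nat[of ?P R "\<lambda>W. card (contour W)"] by blast
  have "minimal_region s W"
    unfolding minimal_region_def
  proof (intro conjI allI impI notI)
    fix W' assume W': "finite W' \<and> odd_closed W' \<and> s \<in> W'" "contour W' \<subset> contour W"
    then have "card (contour W') < card (contour W)"
      using W(1) by (intro psubset_card_mono finite_contour) auto
    then show False using W(2)[of W'] W(1) W' by auto
  qed (use W in auto)
  then show thesis using that W(1) by blast
qed

lemma units_eq: "d \<in> units \<Longrightarrow> units = {d, rot d, - d, - rot d}"
  by (auto simp: units_def)

text \<open>Otherwise \<open>e\<close> could be removed from the region.\<close>

lemma minimal_region_no_even_spike:
  assumes W: "minimal_region s W" and s: "\<not> even_vertex s" and e: "even_vertex e"
  shows "\<exists>d\<in>units. (e, d) \<notin> contour W"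
proof (rule ccontr)
  assume "\<not> ?thesis"
  then have all: "\<And>d. d \<in> units \<Longrightarrow> (e, d) \<in> contour W" by blast
  then have eW: "e \<in> W" "\<And>d. d \<in> units \<Longrightarrow> e + d \<notin> W" by (auto simp: contour_def units_def)
  have "odd_closed (W - {e})"
    unfolding odd_closed_def
  proof (intro ballI impI)
    fix z d assume z: "z \<in> W - {e}" "\<not> even_vertex z" "d \<in> units"
    have "z + d \<noteq> e"
    proof
      assume "z + d = e"
      then have "z = e + - d" by auto
      with eW(2)[OF minus_units[OF z(3)]] z(1) show False by simp
    qed
    moreover have "z + d \<in> W" using W z unfolding minimal_region_def odd_closed_def by blast
    ultimately show "z + d \<in> W - {e}" by simp
  qed
  moreover have "contour (W - {e}) \<subset> contour W"
  proof
    show "contour (W - {e}) \<subseteq> contour W"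
    proof
      fix b assume "b \<in> contour (W - {e})"
      then obtain f d where b: "b = (f, d)" "d \<in> units" "even_vertex f" "f \<in> W" "f + d \<notin> W - {e}"
        unfolding contour_def by blast
      have "f + d \<noteq> e" using b e even_vertex_add_unit[of d f] by metis
      then show "b \<in> contour W" using b by (simp add: contour_def)
    qed
    show "contour (W - {e}) \<noteq> contour W"
      using all[of "(1, 0)"] by (auto simp: contour_def units_def)
  qed
  ultimately show False using W s e unfolding minimal_region_def by (metis Diff_iff finite_Diff singletonD)
qed

text \<open>Otherwise \<open>z\<close> could be added to the region.\<close>

lemma minimal_region_no_odd_hole:
  assumes W: "minimal_region s W" and z: "\<not> even_vertex z" "z \<notin> W"
  shows "\<exists>d\<in>units. z + d \<notin> W"
proof (rule ccontr)
  assume "\<not> ?thesis"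
  then have all: "\<And>d. d \<in> units \<Longrightarrow> z + d \<in> W" by blast
  have "odd_closed (insert z W)"
    using W all unfolding minimal_region_def odd_closed_def by auto
  moreover have "contour (insert z W) \<subset> contour W"
  proof
    show "contour (insert z W) \<subseteq> contour W"
      using z by (auto simp: contour_def)
    have "(z + (1, 0), (-1, 0)) \<in> contour W"
      using all[of "(1, 0)"] z by (auto simp: contour_def even_vertex_add_unit units_def add.assoc
        simp flip: zero_prod_def)
    moreover have "(z + (1, 0), (-1, 0)) \<notin> contour (insert z W)"
      by (auto simp: contour_def add.assoc simp flip: zero_prod_def)
    ultimately show "contour (insert z W) \<noteq> contour W" by blast
  qed
  ultimately show False using W unfolding minimal_region_def by (metis finite_insert insertI2)
qed

text \<open>If two of the first \<open>card X\<close> iterates coincided, the orbit would have fewer than \<open>card X\<close>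
  elements; but the orbit is invariant and therefore is all of \<open>X\<close>.\<close>

lemma orbit_enumerates:
  assumes X: "finite X" "inj_on f X" "f ` X \<subseteq> X" "b \<in> X"
    and irred: "\<And>D. D \<subseteq> X \<Longrightarrow> f ` D = D \<Longrightarrow> D \<noteq> {} \<Longrightarrow> D = X"
  shows "bij_betw (\<lambda>k. (f ^^ k) b) {..<card X} X"
proof -
  let ?p = "\<lambda>k. (f ^^ k) b"
  have sub: "range ?p \<subseteq> X"
  proof clarify
    fix k show "?p k \<in> X" by (induction k) (use X in auto)
  qed
  have img: "f ` range ?p \<subseteq> range ?p"
  proof clarify
    fix k show "f (?p k) \<in> range ?p" using rangeI[of ?p "Suc k"] by simp
  qed
  have "f ` range ?p = range ?p"
    by (rule endo_inj_surj) (use img sub X in \<open>auto intro: finite_subset inj_on_subset\<close>)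
  then have all: "range ?p = X" using irred sub by blast
  have "inj_on ?p {..<card X}"
  proof (rule linorder_inj_onI)
    fix i j assume ij: "i < j" "i \<in> {..<card X}" "j \<in> {..<card X}"
    show "?p i \<noteq> ?p j"
    proof
      assume eq: "?p i = ?p j"
      have "?p k \<in> ?p ` {..<j}" for k
      proof (induction k)
        case 0 then show ?case using ij(1) by (intro imageI) simp
      next
        case (Suc k)
        then obtain m where m: "m < j" "?p k = ?p m" by auto
        then have "?p (Suc k) = ?p (Suc m)" by simp
        moreover have "Suc m < j \<or> Suc m = j" using m by auto
        ultimately show ?case using eq ij by force
      qed
      then have "X \<subseteq> ?p ` {..<j}" using all by blast
      then have "card X \<le> j" by (metis card_image_le card_lessThan card_mono finite_imageI finite_lessThan le_trans)
      then show False using ij by simp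
    qed
  qed auto
  moreover from this have "?p ` {..<card X} = X"
    using sub X(1) by (intro card_subset_eq) (auto simp: card_image)
  ultimately show ?thesis by (simp add: bij_betw_def)
qed

section \<open>Minimal contours are taxi walks\<close>

text \<open>The midpoint of the edge \<open>(e, d)\<close>, in coordinates rotated by 45 degrees and rescaled. The edges at an
  even vertex become the corners of a face of the Manhattan lattice whose boundary is oriented counterclockwise,
  and those at an odd vertex the corners of a clockwise face.\<close>

fun manhattan_vertex :: "vertex \<times> vertex \<Rightarrow> vertex" where
  "manhattan_vertex ((x, y), (p, q)) = (x + y + (p + q - 1) div 2, y - x + (q - p + 1) div 2)"

lemma units_cases:
  assumes "d \<in> units"
  obtains "d = (1, 0)" | "d = (0, 1)" | "d = (-1, 0)" | "d = (0, -1)"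
  using assms by (auto simp: units_def)

lemma manhattan_vertex_simps:
  "manhattan_vertex ((x, y), (1, 0)) = (x + y, y - x)"
  "manhattan_vertex ((x, y), (0, 1)) = (x + y, y - x + 1)"
  "manhattan_vertex ((x, y), (-1, 0)) = (x + y - 1, y - x + 1)"
  "manhattan_vertex ((x, y), (0, -1)) = (x + y - 1, y - x)"
  by simp_all

declare manhattan_vertex.simps [simp del] manhattan_vertex_simps [simp]

lemma inj_on_manhattan_vertex: "inj_on manhattan_vertex {(e, d). even_vertex e \<and> d \<in> units}"
proof (rule inj_onI)
  fix b b' assume b: "b \<in> {(e, d). even_vertex e \<and> d \<in> units}"
      "b' \<in> {(e, d). even_vertex e \<and> d \<in> units}" and c: "manhattan_vertex b = manhattan_vertex b'"
  obtain x y d where 1: "b = ((x, y), d)" by (metis surj_pair)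
  obtain x' y' d' where 2: "b' = ((x', y'), d')" by (metis surj_pair)
  have e: "even (x + y)" "even (x' + y')" "d \<in> units" "d' \<in> units" using b by (auto simp: 1 2)
  show "b = b'"
    using e(3,4,1,2) c unfolding 1 2 by (elim units_cases; simp; presburger)
qed

lemma manhattan_edge_next_edge:
  assumes "(e, d) \<in> contour W"
  shows "manhattan_edge (manhattan_vertex (e, d)) (manhattan_vertex (next_edge W (e, d)))"
proof -
  obtain x y where e: "e = (x, y)" by (cases e)
  have "even (x + y)" "d \<in> units" using assms by (auto simp: contour_def e)
  from this(2) this(1) show ?thesis
    by (cases rule: units_cases) (simp_all add: e)
qed

text \<open>The walk turns when two consecutive steps go around the same vertex of the square lattice, and it goes straight
  when a left turn of the contour alternates with a right turn: consecutive diagonal steps are then parallel.\<close>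

lemma turn_around_same_vertex:
  assumes "d \<in> units" "next_edge W (e, d) = (e', d')"
    and "perpendicular (manhattan_vertex (e', d') - manhattan_vertex (e, d)) (manhattan_vertex (next_edge W (e', d')) - manhattan_vertex (e', d'))"
  shows "e + rot d \<in> W \<longleftrightarrow> e' + rot d' \<in> W"
proof (rule ccontr)
  assume neq: "\<not> ?thesis"
  obtain x y where e: "e = (x, y)" by (cases e)
  show False
  proof (cases "e + rot d \<in> W")
    case True
    then have "e' = e + d + rot d" "d' = - rot d" "e' + rot d' \<notin> W" using neq assms(2) by auto
    with assms(1,3) show False by (cases rule: units_cases) (simp_all add: e)
  next
    case False
    then have "e' = e" "d' = rot d" "e' + rot d' \<in> W" using neq assms(2) by auto
    with assms(1,3) show False by (cases rule: units_cases) (simp_all add: e)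
  qed
qed

declare even_vertex.simps [simp del]

lemma minimal_contour_enumeration:
  assumes W: "minimal_region s W" and b: "b \<in> contour W"
  shows "bij_betw (\<lambda>k. (next_edge W ^^ k) b) {..<card (contour W)} (contour W)"
proof (rule orbit_enumerates)
  have W': "finite W" "odd_closed W" "s \<in> W" using W by (auto simp: minimal_region_def)
  show "finite (contour W)" "inj_on (next_edge W) (contour W)" "next_edge W ` contour W \<subseteq> contour W"
    using W' finite_contour inj_on_next_edge next_edge_in_contour by blast+
  show "D = contour W" if "D \<subseteq> contour W" "next_edge W ` D = D" "D \<noteq> {}" for D
    using contour_split[OF W' that] W unfolding minimal_region_def by metis
qed fact

text \<open>Two consecutive turns need three consecutive steps around the same vertex, so that all four edges at this
  vertex belong to the contour.\<close>

lemma no_two_consecutive_turns: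
  assumes W: "minimal_region s W" and s: "\<not> even_vertex s"
    and b: "b \<in> contour W" and b': "b' = next_edge W b" and b'': "b'' = next_edge W b'"
    and t1: "perpendicular (manhattan_vertex b' - manhattan_vertex b) (manhattan_vertex b'' - manhattan_vertex b')"
    and t2: "perpendicular (manhattan_vertex b'' - manhattan_vertex b') (manhattan_vertex (next_edge W b'') - manhattan_vertex b'')"
  shows False
proof -
  have W': "finite W" "odd_closed W" "s \<in> W" using W by (auto simp: minimal_region_def)
  obtain e d where 0: "b = (e, d)" by (cases b)
  obtain e' d' where 1: "b' = (e', d')" by (cases b')
  obtain e'' d'' where 2: "b'' = (e'', d'')" by (cases b'')
  have c: "(e', d') \<in> contour W" "(e'', d'') \<in> contour W" "next_edge W b'' \<in> contour W"
    using next_edge_in_contour[OF W'(2)] b unfolding 1[symmetric] 2[symmetric] b'' b' by blast+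
  have d: "d \<in> units" "d' \<in> units" "d'' \<in> units" "even_vertex e" "e + d \<notin> W"
    using b c unfolding 0 by (auto simp: contour_def)
  have same: "e + rot d \<in> W \<longleftrightarrow> e' + rot d' \<in> W" "e' + rot d' \<in> W \<longleftrightarrow> e'' + rot d'' \<in> W"
    using turn_around_same_vertex[OF d(1), of W e e' d'] turn_around_same_vertex[OF d(2), of W e' e'' d'']
      t1 t2 unfolding 0 1 2 using b' b'' unfolding 0 1 2 by metis+
  show False
  proof (cases "e + rot d \<in> W")
    case False
    have "e' = e" "d' = rot d" using False b' unfolding 0 1 by simp_all
    moreover from this have "e'' = e" "d'' = - d" using False same b'' unfolding 1 2 by simp_all
    moreover from this have "next_edge W b'' = (e, - rot d)" using False same unfolding 2 by simp
    ultimately have "(e, d) \<in> contour W" "(e, rot d) \<in> contour W" "(e, - d) \<in> contour W"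
      "(e, - rot d) \<in> contour W"
      using b c unfolding 0 by simp_all
    then show False
      using minimal_region_no_even_spike[OF W s d(4)] units_eq[OF d(1)] by auto
  next
    case True
    have "e' = e + d + rot d" "d' = - rot d" using True b' unfolding 0 1 by simp_all
    moreover from this have "e'' = e + d + d" "d'' = - d"
      using True same b'' unfolding 1 2 by simp_all
    moreover from this have "fst (next_edge W b'') = e + d - rot d" using True same unfolding 2 by simp
    ultimately have "e \<in> W" "e + d + rot d \<in> W" "e + d + d \<in> W" "e + d + - rot d \<in> W"
      using b c unfolding 0 by (auto simp: contour_def)
    moreover have "e + d + - d = e" by simp
    moreover have "\<not> even_vertex (e + d)" using d by (simp add: even_vertex_add_unit)
    ultimately show False
      using minimal_region_no_odd_hole[OF W _ d(5)] unfolding units_eq[OF d(1)]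
      by (metis insert_iff empty_iff)
  qed
qed

lemma minimal_contour_taxi_walk:
  assumes W: "minimal_region s W" and s: "\<not> even_vertex s" and b: "b \<in> contour W"
  obtains w where "w \<in> taxi_walks (card (contour W) - 1) (manhattan_vertex b)" "set w = manhattan_vertex ` contour W"
proof -
  let ?N = "card (contour W)"
  let ?p = "\<lambda>k. (next_edge W ^^ k) b"
  let ?w = "map (\<lambda>k. manhattan_vertex (?p k)) [0..<?N]"
  have W': "finite W" "odd_closed W" using W by (auto simp: minimal_region_def)
  have N: "?N \<ge> 1" using b finite_contour[OF W'(1)] by (metis One_nat_def Suc_leI card_gt_0_iff empty_iff)
  have bij: "bij_betw ?p {..<?N} (contour W)" by (rule minimal_contour_enumeration[OF W b])
  have pc: "?p k \<in> contour W" for k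
    by (induction k) (use b next_edge_in_contour[OF W'(2)] in auto)
  have inj: "inj_on manhattan_vertex (contour W)"
    by (rule inj_on_subset[OF inj_on_manhattan_vertex]) (auto simp: contour_def)
  have "inj_on (\<lambda>k. manhattan_vertex (?p k)) {..<?N}"
    using comp_inj_on[of ?p "{..<?N}" manhattan_vertex] bij inj by (simp add: bij_betw_def comp_def)
  then have dist: "distinct ?w" by (simp add: distinct_map atLeast0LessThan)
  have edge: "manhattan_edge (manhattan_vertex (?p k)) (manhattan_vertex (?p (Suc k)))" for k
    using manhattan_edge_next_edge[of "fst (?p k)" "snd (?p k)" W] pc[of k] by simp
  have turns: "\<not> (perpendicular (manhattan_vertex (?p (k+1)) - manhattan_vertex (?p k)) (manhattan_vertex (?p (k+2)) - manhattan_vertex (?p (k+1))) \<and>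
      perpendicular (manhattan_vertex (?p (k+2)) - manhattan_vertex (?p (k+1))) (manhattan_vertex (?p (k+3)) - manhattan_vertex (?p (k+2))))" for k
    using no_two_consecutive_turns[OF W s pc[of k], of "?p (k+1)" "?p (k+2)"]
    by (auto simp: numeral_eq_Suc)
  have "?w \<in> taxi_walks (?N - 1) (manhattan_vertex b)"
    unfolding taxi_walks_iff using N dist edge turns
    by (auto simp del: perpendicular.simps manhattan_edge.simps funpow.simps next_edge.simps)
  moreover have "set ?w = manhattan_vertex ` contour W"
  proof -
    have "set ?w = manhattan_vertex ` (?p ` {..<?N})" by (simp only: set_map image_image set_upt atLeast0LessThan)
    then show ?thesis using bij by (simp only: bij_betw_def)
  qed
  ultimately show thesis using that by blast
qed

definition ray :: "vertex \<Rightarrow> vertex \<Rightarrow> nat \<Rightarrow> vertex" where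
  "ray z d k = (fst z + int k * fst d, snd z + int k * snd d)"

lemma ray_0 [simp]: "ray z d 0 = z" by (simp add: ray_def)

lemma ray_Suc: "ray z d (Suc k) = ray z d k + d"
  by (cases z; cases d) (simp add: ray_def algebra_simps)

lemma inj_ray: "d \<in> units \<Longrightarrow> inj (ray z d)"
  by (auto simp: ray_def units_def inj_def)

text \<open>A ray from a vertex of a finite region has to leave it, and it does so through an even vertex.\<close>

lemma contour_exit:
  assumes W: "finite W" "odd_closed W" and z: "z \<in> W" and d: "d \<in> units"
  obtains k where "(ray z d k, d) \<in> contour W" "\<And>i. i \<le> k \<Longrightarrow> ray z d i \<in> W"
proof -
  have "\<exists>k. ray z d k \<notin> W"
  proof (rule ccontr)
    assume "\<not> ?thesis"
    then have "range (ray z d) \<subseteq> W" by auto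
    then have "finite (range (ray z d))" using W(1) finite_subset by blast
    then show False using inj_ray[OF d] finite_imageD by blast
  qed
  then obtain m where m: "ray z d m \<notin> W" "\<And>i. i < m \<Longrightarrow> ray z d i \<in> W"
    using exists_least_iff[of "\<lambda>k. ray z d k \<notin> W"] by auto
  obtain k where k: "m = Suc k" using m(1) z by (cases m) auto
  have "ray z d k \<in> W" using m(2) k by simp
  moreover have "ray z d k + d \<notin> W" using m(1) by (simp add: k ray_Suc)
  moreover from calculation have "even_vertex (ray z d k)" using W(2) d by (auto simp: odd_closed_def)
  ultimately have "(ray z d k, d) \<in> contour W" using d by (simp add: contour_def)
  with m(2) k show thesis using that by auto
qed

text \<open>The even vertices of \<open>W\<close> that are not left in direction \<open>d\<close> correspond to the odd vertices of \<open>W\<close>.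
  Hence the number of edges leaving \<open>W\<close> in a given direction is the same for all four directions.\<close>

lemma card_contour_direction:
  assumes W: "finite W" "odd_closed W" and d: "d \<in> units"
  shows "card {e. (e, d) \<in> contour W} + card {z \<in> W. \<not> even_vertex z} = card {z \<in> W. even_vertex z}"
proof -
  have "bij_betw (\<lambda>e. e + d) {e \<in> W. even_vertex e \<and> e + d \<in> W} {z \<in> W. \<not> even_vertex z}"
  proof (rule bij_betw_byWitness[where f' = "\<lambda>z. z + - d"])
    show "(\<lambda>z. z + - d) ` {z \<in> W. \<not> even_vertex z} \<subseteq> {e \<in> W. even_vertex e \<and> e + d \<in> W}"
    proof (rule image_subsetI)
      fix z assume z: "z \<in> {z \<in> W. \<not> even_vertex z}"
      then have "z + - d \<in> W" using W(2) minus_units[OF d] unfolding odd_closed_def by blast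
      then show "z + - d \<in> {e \<in> W. even_vertex e \<and> e + d \<in> W}"
        using z even_vertex_add_unit[OF minus_units[OF d], of z] by simp
    qed
    show "(\<lambda>e. e + d) ` {e \<in> W. even_vertex e \<and> e + d \<in> W} \<subseteq> {z \<in> W. \<not> even_vertex z}"
      by (rule image_subsetI) (use d in \<open>simp add: even_vertex_add_unit\<close>)
  qed simp_all
  then have "card {z \<in> W. \<not> even_vertex z} = card {e \<in> W. even_vertex e \<and> e + d \<in> W}"
    by (rule bij_betw_same_card[symmetric])
  moreover have "card {z \<in> W. even_vertex z} =
      card {e. (e, d) \<in> contour W} + card {e \<in> W. even_vertex e \<and> e + d \<in> W}"
  proof -
    have "{z \<in> W. even_vertex z} = {e. (e, d) \<in> contour W} \<union> {e \<in> W. even_vertex e \<and> e + d \<in> W}"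
      using d by (auto simp: contour_def)
    moreover have "finite {e. (e, d) \<in> contour W}"
      by (rule finite_subset[OF _ W(1)]) (auto simp: contour_def)
    ultimately show ?thesis
      using W(1) by (simp add: card_Un_disjoint contour_def disjoint_iff)
  qed
  ultimately show ?thesis by simp
qed

definition left_boundary :: "vertex set \<Rightarrow> vertex set" where
  "left_boundary W = {e. (e, (-1, 0)) \<in> contour W}"

lemma finite_left_boundary: "finite W \<Longrightarrow> finite (left_boundary W)"
  by (rule finite_subset[of _ W]) (auto simp: left_boundary_def contour_def)

lemma card_contour:
  assumes W: "finite W" "odd_closed W"
  shows "card (contour W) = 4 * card (left_boundary W)"
proof -
  have eq: "card {e. (e, d) \<in> contour W} = card (left_boundary W)" if "d \<in> units" for d
    using card_contour_direction[OF W that] card_contour_direction[OF W, of "(-1, 0)"]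
    by (simp add: left_boundary_def units_def)
  have fin: "finite {e. (e, d) \<in> contour W}" for d
    by (rule finite_subset[OF _ W(1)]) (auto simp: contour_def)
  have swap: "prod.swap ` contour W = (SIGMA d:units. {e. (e, d) \<in> contour W})"
  proof (rule set_eqI)
    fix p :: "vertex \<times> vertex"
    obtain d e where p: "p = (d, e)" by (cases p)
    show "p \<in> prod.swap ` contour W \<longleftrightarrow> p \<in> (SIGMA d:units. {e. (e, d) \<in> contour W})"
      unfolding p pair_in_swap_image by (auto simp: contour_def)
  qed
  have "card (contour W) = card (prod.swap ` contour W)"
    by (rule card_image[symmetric]) simp
  also have "\<dots> = card (SIGMA d:units. {e. (e, d) \<in> contour W})" unfolding swap ..
  also have "\<dots> = (\<Sum>d\<in>units. card (left_boundary W))"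
    using fin finite_units eq by simp
  also have "\<dots> = 4 * card (left_boundary W)" by (simp add: units_def)
  finally show ?thesis .
qed

lemma card_columns_le:
  assumes W: "finite W" "odd_closed W"
  shows "card (fst ` W) \<le> card (left_boundary W)"
proof -
  have u: "(0, 1) \<in> units" "(-1, 0) \<in> units" by (auto simp: units_def)
  let ?U = "{e. (e, (0, 1)) \<in> contour W}"
  have fin: "finite ?U" by (rule finite_subset[OF _ W(1)]) (auto simp: contour_def)
  have "fst ` W \<subseteq> fst ` ?U"
  proof clarify
    fix x y assume "(x, y) \<in> W"
    then obtain k where "(ray (x, y) (0, 1) k, (0, 1)) \<in> contour W"
      using contour_exit[OF W _ u(1)] by blast
    then show "fst (x, y) \<in> fst ` ?U" 
      by (intro image_eqI[of _ _ "ray (x, y) (0, 1) k"]) (simp_all add: ray_def)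
  qed
  then have "card (fst ` W) \<le> card ?U"
    using fin by (meson card_image_le card_mono finite_imageI order_trans)
  also have "card ?U = card (left_boundary W)"
    using card_contour_direction[OF W u(1)] card_contour_direction[OF W u(2)]
    by (simp add: left_boundary_def)
  finally show ?thesis .
qed

text \<open>The ray from \<open>s\<close> to the right leaves the region after fewer than \<open>n\<close> steps, since the columns on its way
  each contain a boundary edge. This leaves at most \<open>n\<close> edges at which to start the taxi walk along the
  contour, and the walk determines the region.\<close>

lemma card_minimal_regions:
  assumes s: "\<not> even_vertex s" and n: "n \<ge> 1"
  defines "A \<equiv> {W. minimal_region s W \<and> card (contour W) = n}"
  shows "finite A" "card A \<le> n * taxi_count (n - 1)"
proof -
  let ?T = "\<Union>k<n. taxi_walks (n - 1) (manhattan_vertex (ray s (1, 0) k, (1, 0)))"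
  have u: "(1, 0) \<in> units" by (auto simp: units_def)
  have "\<forall>W\<in>A. \<exists>w. w \<in> ?T \<and> set w = manhattan_vertex ` contour W"
  proof
    fix W assume "W \<in> A"
    then have W: "minimal_region s W" "card (contour W) = n"
      and W': "finite W" "odd_closed W" "s \<in> W" by (auto simp: A_def minimal_region_def)
    obtain k where k: "(ray s (1, 0) k, (1, 0)) \<in> contour W" "\<And>i. i \<le> k \<Longrightarrow> ray s (1, 0) i \<in> W"
      using contour_exit[OF W' u] by blast
    have "inj_on (\<lambda>i. fst (ray s (1, 0) i)) {..k}" by (auto simp: ray_def inj_on_def)
    then have "Suc k = card ((\<lambda>i. fst (ray s (1, 0) i)) ` {..k})" by (simp add: card_image)
    also have "\<dots> \<le> card (fst ` W)" using k(2) W'(1) by (intro card_mono) auto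
    also have "\<dots> \<le> card (contour W)"
      using card_columns_le[OF W'(1,2)] card_contour[OF W'(1,2)] by simp
    finally have "k < n" using W by simp
    moreover obtain w where "w \<in> taxi_walks (n - 1) (manhattan_vertex (ray s (1, 0) k, (1, 0)))" "set w = manhattan_vertex ` contour W"
      using minimal_contour_taxi_walk[OF W(1) s k(1)] W(2) by blast
    ultimately show "\<exists>w. w \<in> ?T \<and> set w = manhattan_vertex ` contour W" by blast
  qed
  then obtain f where f: "\<And>W. W \<in> A \<Longrightarrow> f W \<in> ?T \<and> set (f W) = manhattan_vertex ` contour W" by metis
  have inj: "inj_on f A"
  proof (rule inj_onI)
    fix W W' assume *: "W \<in> A" "W' \<in> A" "f W = f W'"
    then have "manhattan_vertex ` contour W = manhattan_vertex ` contour W'" using f by metis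
    then have "contour W = contour W'"
      by (subst (asm) inj_on_image_eq_iff[OF inj_on_manhattan_vertex]) (auto simp: contour_def)
    then show "W = W'"
      using * contour_determines_region by (auto simp: A_def minimal_region_def)
  qed
  have fin: "finite ?T" by (auto intro: finite_taxi_walks)
  have sub: "f ` A \<subseteq> ?T" using f by blast
  show "finite A" using inj sub fin by (meson finite_imageD finite_subset)
  have "card A \<le> card ?T" using card_inj_on_le[OF inj sub fin] .
  also have "\<dots> \<le> (\<Sum>k<n. card (taxi_walks (n - 1) (manhattan_vertex (ray s (1, 0) k, (1, 0)))))"
    by (rule card_UN_le) simp
  also have "\<dots> \<le> (\<Sum>k<n. taxi_count (n - 1))" by (intro sum_mono card_taxi_walks_le)
  finally show "card A \<le> n * taxi_count (n - 1)" by simp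
qed

section \<open>The Peierls estimate\<close>

text \<open>No boundary edge of \<open>W\<close> has an occupied end.\<close>

definition insulated :: "vertex set \<Rightarrow> vertex set \<Rightarrow> bool" where
  "insulated I W \<longleftrightarrow> (\<forall>(e, d) \<in> contour W. e \<notin> I \<and> e + d \<notin> I)"

lemma independent_sets_z2_iff:
  "I \<in> independent_sets z2_adj \<longleftrightarrow> (\<forall>z\<in>I. \<forall>d\<in>units. z + d \<notin> I)"
proof -
  have "z2_adj u (u + d)" if "d \<in> units" for u d using that by (simp add: z2_adj_iff)
  moreover have "v = u + (v - u)" for u v :: vertex by simp
  ultimately show ?thesis unfolding independent_sets_def z2_adj_iff mem_Collect_eq by metis
qed

definition evens :: "vertex set" where "evens = {z. even_vertex z}"

lemma add_minus_unit [simp]: "(z :: vertex) + d + - d = z"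
  by simp

lemma insulated_crossing:
  assumes "odd_closed W" "insulated I W" "d \<in> units" "z \<in> W" "z + d \<notin> W"
  shows "z \<notin> I" "z + d \<notin> I"
proof -
  have "even_vertex z" using assms unfolding odd_closed_def by blast
  then have "(z, d) \<in> contour W" using assms by (simp add: contour_def)
  then show "z \<notin> I" "z + d \<notin> I" using assms(2) unfolding insulated_def by blast+
qed

text \<open>The occupied odd vertices together with their neighbours form a region whose boundary edges
  have unoccupied ends: the even end is next to an occupied vertex, and the odd end, if occupied, would belong to
  the region. Passing to a minimal region only removes boundary edges.\<close>

lemma insulated_region_exists:
  assumes I: "I \<in> independent_sets z2_adj" and \<Lambda>: "finite \<Lambda>" "I \<inter> - \<Lambda> = evens \<inter> - \<Lambda>"
    and s: "s \<in> I" "\<not> even_vertex s"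
  obtains W where "minimal_region s W" "insulated I W"
proof -
  \<comment> \<open>By the boundary condition only finitely many odd vertices are occupied.\<close>
  define Q where "Q = {z \<in> I. \<not> even_vertex z}"
  define R where "R = Q \<union> (\<Union>d\<in>units. (\<lambda>z. z + d) ` Q)"
  have "Q \<subseteq> \<Lambda>" using \<Lambda>(2) unfolding Q_def evens_def by blast
  then have "finite Q" using \<Lambda>(1) finite_subset by blast
  then have "finite R" by (simp add: R_def finite_units)
  have nbr: "even_vertex z \<and> z \<notin> I" if "z \<in> R" "z \<notin> Q" for z
  proof -
    from that obtain q d where q: "q \<in> Q" "d \<in> units" "z = q + d" unfolding R_def by blast
    then have "q \<in> I" "\<not> even_vertex q" by (auto simp: Q_def)
    then show ?thesis using I q by (simp add: independent_sets_z2_iff even_vertex_add_unit)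
  qed
  have "odd_closed R"
    unfolding odd_closed_def
  proof (intro ballI impI)
    fix z d assume z: "z \<in> R" "\<not> even_vertex z" "d \<in> units"
    then have "z \<in> Q" using nbr by blast
    then show "z + d \<in> R" using z(3) unfolding R_def by blast
  qed
  moreover have "s \<in> R" using s by (simp add: R_def Q_def)
  ultimately obtain W where W: "minimal_region s W" "contour W \<subseteq> contour R"
    using minimal_region_exists \<open>finite R\<close> by metis
  have "e \<notin> I \<and> e + d \<notin> I" if "(e, d) \<in> contour W" for e d
  proof -
    have c: "d \<in> units" "even_vertex e" "e \<in> R" "e + d \<notin> R"
      using that W(2) by (auto simp: contour_def)
    have "e \<notin> Q" using c(2) unfolding Q_def by blast
    then have "e \<notin> I" using nbr c(3) by blast
    moreover have "e + d \<notin> I"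
    proof
      assume "e + d \<in> I"
      moreover have "\<not> even_vertex (e + d)" using even_vertex_add_unit c(1,2) by blast
      ultimately have "e + d \<in> Q" unfolding Q_def by blast
      then show False using c(4) unfolding R_def by blast
    qed
    ultimately show ?thesis ..
  qed
  then have "insulated I W" unfolding insulated_def by blast
  then show thesis using that W(1) by blast
qed

definition odd_segment :: "nat \<Rightarrow> vertex set" where
  "odd_segment M = (\<lambda>i. (2 * int i + 1, 0)) ` {..<M}"

text \<open>Walking from \<open>s\<close> to the right along the row, each even vertex is in \<open>W\<close> because \<open>W\<close> is odd-closed,
  and each odd vertex is in \<open>W\<close> because it is occupied.\<close>

lemma odd_segment_in_region:
  assumes W: "odd_closed W" "insulated I W" and S: "odd_segment M \<subseteq> I" and s: "(1, 0) \<in> W"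
  shows "odd_segment M \<subseteq> W"
proof -
  have "i < M \<Longrightarrow> (2 * int i + 1, 0) \<in> W" for i
  proof (induction i)
    case 0 then show ?case using s by simp
  next
    case (Suc i)
    have u: "(1, 0) \<in> units" by (auto simp: units_def)
    have "\<not> even_vertex (2 * int i + 1, 0)" by (simp add: even_vertex.simps)
    moreover have "(2 * int i + 1, 0) \<in> W" using Suc by simp
    ultimately have "(2 * int i + 1, 0) + (1, 0) \<in> W" using u W(1) unfolding odd_closed_def by blast
    then have "(2 * int i + 2, 0) \<in> W" by (simp add: add.assoc)
    moreover have "((2 * int (Suc i) + 1, 0) :: vertex) = (2 * int i + 2, 0) + (1, 0)" by simp
    moreover have "(2 * int (Suc i) + 1, 0) \<in> I" using S Suc.prems unfolding odd_segment_def by blast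
    ultimately show ?case using insulated_crossing(2)[OF W u] by metis
  qed
  then show ?thesis by (auto simp: odd_segment_def)
qed

lemma card_odd_segment: "card (fst ` odd_segment M) = M"
  by (simp add: odd_segment_def image_image card_image inj_on_def)

text \<open>From every vertex outside \<open>\<Lambda>\<close> some ray avoids \<open>\<Lambda>\<close>; along it the boundary condition is in
  force, so that no insulated region can be left there.\<close>

definition escapable :: "vertex set \<Rightarrow> bool" where
  "escapable \<Lambda> \<longleftrightarrow> (\<forall>z. z \<notin> \<Lambda> \<longrightarrow> (\<exists>d\<in>units. \<forall>k. ray z d k \<notin> \<Lambda>))"

lemma region_within_box:
  assumes W: "finite W" "odd_closed W" "insulated I W"
    and \<Lambda>: "escapable \<Lambda>" "I \<inter> - \<Lambda> = evens \<inter> - \<Lambda>"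
  shows "W \<subseteq> \<Lambda>"
proof (rule ccontr)
  assume "\<not> ?thesis"
  then obtain z where z: "z \<in> W" "z \<notin> \<Lambda>" by blast
  then obtain d where d: "d \<in> units" "\<And>k. ray z d k \<notin> \<Lambda>" using \<Lambda>(1) unfolding escapable_def by blast
  obtain k where k: "(ray z d k, d) \<in> contour W" using contour_exit[OF W(1,2) z(1) d(1)] by blast
  then have "even_vertex (ray z d k)" by (simp add: contour_def)
  then have "ray z d k \<in> I" using d(2)[of k] \<Lambda>(2) unfolding evens_def by blast
  then show False using k W(3) unfolding insulated_def by blast
qed

definition shift_region :: "vertex set \<Rightarrow> vertex set \<Rightarrow> vertex set \<Rightarrow> vertex set" where
  "shift_region W I A = (I - W) \<union> (\<lambda>z. z + (1, 0)) ` (I \<inter> W) \<union> A"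

lemma in_shift_iff: "z \<in> (\<lambda>z. z + (1, 0)) ` X \<longleftrightarrow> z + (-1, 0) \<in> X" for z :: vertex
proof
  assume "z + (-1, 0) \<in> X"
  then show "z \<in> (\<lambda>z. z + (1, 0)) ` X" by (intro image_eqI[of _ _ "z + (-1, 0)"]) (cases z, auto)
qed (auto)

lemma unit_right: "(1, 0) \<in> units" "(-1, 0) \<in> units"
  by (auto simp: units_def)

locale insulated_region =
  fixes W I :: "vertex set"
  assumes finW: "finite W" and oc: "odd_closed W" and ins: "insulated I W"
    and ind: "I \<in> independent_sets z2_adj"
begin

lemma crossing: "d \<in> units \<Longrightarrow> z \<in> W \<Longrightarrow> z + d \<notin> W \<Longrightarrow> z \<notin> I \<and> z + d \<notin> I"
  using insulated_crossing[OF oc ins] by blast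

lemma shifted_in_W: "z + (-1, 0) \<in> I \<inter> W \<Longrightarrow> z \<in> W"
  using crossing[of "(1, 0)" "z + (-1, 0)"] unit_right by (cases z) auto

lemma left_boundary_iff: "z \<in> left_boundary W \<longleftrightarrow> even_vertex z \<and> z \<in> W \<and> z + (-1, 0) \<notin> W"
  by (auto simp: left_boundary_def contour_def unit_right)

text \<open>Shifted occupied vertices stay inside \<open>W\<close>, and no vertex of \<open>W\<close> is adjacent to an occupied vertex
  outside. A vertex of the left boundary that is adjacent to a shifted vertex would come, after shifting back, from a
  boundary edge with an occupied end.\<close>

lemma shift_region_independent:
  assumes A: "A \<subseteq> left_boundary W"
  shows "shift_region W I A \<in> independent_sets z2_adj"
proof -
  let ?In = "\<lambda>z. z + (-1, 0) \<in> I \<inter> W \<or> z \<in> A"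
  have mem: "z \<in> shift_region W I A \<longleftrightarrow> z \<in> I - W \<or> ?In z" for z
    by (simp add: shift_region_def in_shift_iff disj_assoc)
  have InW: "z \<in> W" if "?In z" for z using that shifted_in_W A left_boundary_iff by blast
  have swap: "z + d + (-1, 0) = z + (-1, 0) + d" for z d :: vertex by (simp add: add_ac)
  have AS: False if "d \<in> units" "z \<in> A" "z + d + (-1, 0) \<in> I \<inter> W" for z d
  proof -
    have "z + (-1, 0) \<notin> W" using that(2) A left_boundary_iff by blast
    then show False
      using crossing[OF minus_units[OF that(1)], of "z + d + (-1, 0)"] that(3)
      unfolding swap add_minus_unit by blast
  qed
  have AA: False if "d \<in> units" "z \<in> A" "z + d \<in> A" for z d
    using that A left_boundary_iff even_vertex_add_unit by blast
  have SS: False if "d \<in> units" "z + (-1, 0) \<in> I \<inter> W" "z + d + (-1, 0) \<in> I \<inter> W" for z d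
    using that ind unfolding independent_sets_z2_iff swap by blast
  have SA: False if "d \<in> units" "z + (-1, 0) \<in> I \<inter> W" "z + d \<in> A" for z d
    using AS[OF minus_units[OF that(1)], of "z + d"] that unfolding add_minus_unit by blast
  have OI: False if "d \<in> units" "z \<in> I - W" "?In (z + d)" for z d
    using crossing[OF minus_units[OF that(1)], of "z + d"] that(2) InW[OF that(3)]
    unfolding add_minus_unit by blast
  have IO: False if "d \<in> units" "?In z" "z + d \<in> I - W" for z d
    using crossing[OF that(1), of "z"] that(3) InW[OF that(2)] by blast
  have OO: False if "d \<in> units" "z \<in> I - W" "z + d \<in> I - W" for z d
    using that ind unfolding independent_sets_z2_iff by blast
  show ?thesis
    unfolding independent_sets_z2_iff
  proof (intro ballI notI)
    fix z d assume z: "z \<in> shift_region W I A" "d \<in> units" "z + d \<in> shift_region W I A"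
    then show False unfolding mem using OO OI IO SS SA AS AA by metis
  qed
qed

text \<open>No shifted vertex lies on the left boundary, so \<open>A\<close> and then \<open>I\<close> can be read off.\<close>

lemma shift_region_recovers:
  assumes A: "A \<subseteq> left_boundary W"
  shows "A = shift_region W I A \<inter> left_boundary W"
    and "I = (shift_region W I A - W) \<union> {z \<in> W. z + (1, 0) \<in> shift_region W I A}"
proof -
  have mem: "z \<in> shift_region W I A \<longleftrightarrow> z \<in> I - W \<or> z + (-1, 0) \<in> I \<inter> W \<or> z \<in> A" for z
    by (simp add: shift_region_def in_shift_iff disj_assoc)
  show "A = shift_region W I A \<inter> left_boundary W"
    using A left_boundary_iff by (auto simp: mem)
  have undo: "z + (1, 0) + (-1, 0) = z" for z :: vertex by (cases z) simp
  have "z \<in> I \<longleftrightarrow> z \<in> (shift_region W I A - W) \<union> {z \<in> W. z + (1, 0) \<in> shift_region W I A}" for z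
  proof (cases "z \<in> W")
    case True
    have "z + (1, 0) \<notin> I - W" using crossing[OF unit_right(1) True] by blast
    moreover have "z + (1, 0) \<notin> A" using A left_boundary_iff[of "z + (1, 0)"] True unfolding undo by blast
    ultimately show ?thesis using True unfolding Un_iff Diff_iff mem_Collect_eq mem undo by blast
  next
    case False
    then have "z + (-1, 0) \<notin> I \<inter> W" using shifted_in_W by blast
    moreover have "z \<notin> A" using False A left_boundary_iff by blast
    ultimately show ?thesis using False unfolding Un_iff Diff_iff mem_Collect_eq mem by blast
  qed
  then show "I = (shift_region W I A - W) \<union> {z \<in> W. z + (1, 0) \<in> shift_region W I A}"
    by (intro set_eqI)
qed

lemma card_shift_region:
  assumes A: "A \<subseteq> left_boundary W" and \<Lambda>: "finite \<Lambda>" "W \<subseteq> \<Lambda>"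
  shows "card (shift_region W I A \<inter> \<Lambda>) = card (I \<inter> \<Lambda>) + card A"
    and "shift_region W I A \<inter> - \<Lambda> = I \<inter> - \<Lambda>"
proof -
  let ?X = "(\<lambda>z. z + (1, 0)) ` (I \<inter> W)"
  have XW: "?X \<subseteq> W" using shifted_in_W unfolding in_shift_iff subset_iff by blast
  have AW: "A \<subseteq> W" using A left_boundary_iff by blast
  have XA: "?X \<inter> A = {}"
  proof -
    have "z \<notin> A" if "z \<in> ?X" for z
      using that[unfolded in_shift_iff] A left_boundary_iff[of z] by blast
    then show ?thesis by blast
  qed
  show "shift_region W I A \<inter> - \<Lambda> = I \<inter> - \<Lambda>"
    unfolding shift_region_def using XW AW \<Lambda>(2) by blast
  have "shift_region W I A \<inter> \<Lambda> = ((I \<inter> \<Lambda>) - W) \<union> (?X \<union> A)"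
    unfolding shift_region_def using XW AW \<Lambda>(2) by blast
  also have "card \<dots> = card ((I \<inter> \<Lambda>) - W) + card (?X \<union> A)"
    using \<Lambda>(1) XW AW finW by (intro card_Un_disjoint) (auto intro: finite_subset)
  also have "card (?X \<union> A) = card ?X + card A"
    using XA AW finW by (intro card_Un_disjoint) (auto intro: finite_subset)
  also have "card ?X = card (I \<inter> W)"
    by (rule card_image) (auto intro: inj_onI)
  also have "card ((I \<inter> \<Lambda>) - W) + (card (I \<inter> W) + card A) = card (I \<inter> \<Lambda>) + card A"
  proof -
    have "I \<inter> \<Lambda> = ((I \<inter> \<Lambda>) - W) \<union> (I \<inter> W)" using \<Lambda>(2) by blast
    then have "card (I \<inter> \<Lambda>) = card ((I \<inter> \<Lambda>) - W) + card (I \<inter> W)"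
      using \<Lambda>(1) finW by (subst card_Un_disjoint[symmetric]) auto
    then show ?thesis by simp
  qed
  finally show "card (shift_region W I A \<inter> \<Lambda>) = card (I \<inter> \<Lambda>) + card A" .
qed

end

lemma sum_power_card_Pow:
  fixes l :: "'a :: comm_semiring_1"
  assumes "finite U"
  shows "(\<Sum>A\<in>Pow U. l ^ card A) = (1 + l) ^ card U"
  using prod_add[OF assms, of "\<lambda>_. l" "\<lambda>_. 1"] by (simp add: add.commute)

lemma sum_le_sum_UN:
  fixes f :: "'b \<Rightarrow> real"
  assumes "finite A" "\<And>a. a \<in> A \<Longrightarrow> finite (B a)" "\<And>x. 0 \<le> f x"
  shows "sum f (\<Union>a\<in>A. B a) \<le> (\<Sum>a\<in>A. sum f (B a))"
  using assms
proof (induction A rule: finite_induct)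
  case (insert a A)
  let ?X = "\<Union>a\<in>A. B a"
  have "sum f (B a \<union> ?X) + sum f (B a \<inter> ?X) = sum f (B a) + sum f ?X"
    using insert by (intro sum.union_inter) auto
  moreover have "0 \<le> sum f (B a \<inter> ?X)" using insert by (intro sum_nonneg) auto
  moreover have "sum f ?X \<le> (\<Sum>a\<in>A. sum f (B a))" using insert by auto
  ultimately show ?case using insert by simp
qed simp

text \<open>Pairs of a configuration \<open>I\<close> and a set \<open>A\<close> of freed vertices are mapped injectively to
  configurations, and summing \<open>l ^ card A\<close> over all \<open>A\<close> gives a power of \<open>1 + l\<close>.\<close>

lemma shift_gain:
  fixes l :: real
  assumes l: "0 \<le> l" and \<Lambda>: "finite \<Lambda>" and W: "finite W" "odd_closed W" "W \<subseteq> \<Lambda>" "S \<subseteq> W"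
  shows "(\<Sum>I | I \<in> hc_configs z2_adj \<Lambda> evens \<and> S \<subseteq> I \<and> insulated I W. l ^ card (I \<inter> \<Lambda>))
       * (1 + l) ^ card (left_boundary W)
     \<le> (\<Sum>I | I \<in> hc_configs z2_adj \<Lambda> evens \<and> (\<lambda>z. z + (1, 0)) ` S \<subseteq> I. l ^ card (I \<inter> \<Lambda>))"
proof -
  let ?U = "left_boundary W"
  let ?T = "{I. I \<in> hc_configs z2_adj \<Lambda> evens \<and> S \<subseteq> I \<and> insulated I W}"
  let ?T' = "{I. I \<in> hc_configs z2_adj \<Lambda> evens \<and> (\<lambda>z. z + (1, 0)) ` S \<subseteq> I}"
  let ?f = "\<lambda>(I, A). shift_region W I A"
  have finT': "finite ?T'" using finite_hc_configs[OF \<Lambda>] by simp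
  have loc: "insulated_region W I" if "I \<in> ?T" for I
    using that W by (simp add: insulated_region_def hc_configs_def)
  have inj: "inj_on ?f (?T \<times> Pow ?U)"
  proof (rule inj_onI)
    fix p p' assume p: "p \<in> ?T \<times> Pow ?U" "p' \<in> ?T \<times> Pow ?U" "?f p = ?f p'"
    obtain I A where 1: "p = (I, A)" by (cases p)
    obtain I' A' where 2: "p' = (I', A')" by (cases p')
    have "I \<in> ?T" "I' \<in> ?T" "A \<subseteq> ?U" "A' \<subseteq> ?U" using p(1,2) unfolding 1 2 by auto
    note rec = insulated_region.shift_region_recovers[OF loc[OF \<open>I \<in> ?T\<close>] \<open>A \<subseteq> ?U\<close>]
      insulated_region.shift_region_recovers[OF loc[OF \<open>I' \<in> ?T\<close>] \<open>A' \<subseteq> ?U\<close>]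
    have eq: "shift_region W I A = shift_region W I' A'" using p(3) by (simp add: 1 2)
    have "A = A'" using rec(1,3) unfolding eq by simp
    moreover have "I = I'" using rec(2) unfolding eq rec(4)[symmetric] .
    ultimately show "p = p'" by (simp add: 1 2)
  qed
  have into: "?f ` (?T \<times> Pow ?U) \<subseteq> ?T'"
  proof (rule image_subsetI)
    fix p assume p: "p \<in> ?T \<times> Pow ?U"
    obtain I A where 1: "p = (I, A)" by (cases p)
    have I: "I \<in> ?T" and A: "A \<subseteq> ?U" using p unfolding 1 by auto
    have "(\<lambda>z. z + (1, 0)) ` S \<subseteq> shift_region W I A"
      using I W(4) unfolding shift_region_def by blast
    then show "?f p \<in> ?T'"
      using insulated_region.shift_region_independent[OF loc[OF I] A]
        insulated_region.card_shift_region(2)[OF loc[OF I] A \<Lambda> W(3)] I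
      by (simp add: 1 hc_configs_def)
  qed
  have "(\<Sum>I\<in>?T. l ^ card (I \<inter> \<Lambda>)) * (1 + l) ^ card ?U =
      (\<Sum>I\<in>?T. l ^ card (I \<inter> \<Lambda>)) * (\<Sum>A\<in>Pow ?U. l ^ card A)"
    using sum_power_card_Pow[OF finite_left_boundary[OF W(1)], of l] by simp
  also have "\<dots> = (\<Sum>p\<in>?T \<times> Pow ?U. l ^ card (fst p \<inter> \<Lambda>) * l ^ card (snd p))"
    by (simp add: sum_product sum.cartesian_product case_prod_beta)
  also have "\<dots> = (\<Sum>p\<in>?T \<times> Pow ?U. l ^ card (?f p \<inter> \<Lambda>))"
  proof (rule sum.cong)
    fix p assume p: "p \<in> ?T \<times> Pow ?U"
    obtain I A where 1: "p = (I, A)" by (cases p)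
    have I: "I \<in> ?T" and A: "A \<subseteq> ?U" using p unfolding 1 by auto
    show "l ^ card (fst p \<inter> \<Lambda>) * l ^ card (snd p) = l ^ card (?f p \<inter> \<Lambda>)"
      using insulated_region.card_shift_region(1)[OF loc[OF I] A \<Lambda> W(3)] by (simp add: 1 power_add)
  qed simp
  also have "\<dots> = (\<Sum>J\<in>?f ` (?T \<times> Pow ?U). l ^ card (J \<inter> \<Lambda>))"
    using sum.reindex[OF inj, of "\<lambda>J. l ^ card (J \<inter> \<Lambda>)"] by (simp add: comp_def)
  also have "\<dots> \<le> (\<Sum>J\<in>?T'. l ^ card (J \<inter> \<Lambda>))"
    using into finT' l by (intro sum_mono2) auto
  finally show ?thesis .
qed

text \<open>A bound for the number of minimal regions with \<open>u\<close> vertices on the left boundary, divided by the gain of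
  one such region.\<close>

definition peierls_term :: "real \<Rightarrow> nat \<Rightarrow> real" where
  "peierls_term l u = 4 * u * taxi_count (4 * u - 1) / (1 + l) ^ u"

text \<open>Each configuration that occupies the row has an insulated minimal region; this region contains the row,
  lies in \<open>\<Lambda>\<close>, and has at least \<open>M\<close> columns.\<close>

lemma peierls_finite_volume:
  assumes l: "0 < l" and \<Lambda>: "finite \<Lambda>" "escapable \<Lambda>" and M: "1 \<le> M"
    and \<epsilon>: "\<And>F. finite F \<Longrightarrow> F \<subseteq> {M..} \<Longrightarrow> sum (peierls_term l) F \<le> \<epsilon>"
  shows "(\<Sum>I | I \<in> hc_configs z2_adj \<Lambda> evens \<and> odd_segment M \<subseteq> I. l ^ card (I \<inter> \<Lambda>))
    \<le> \<epsilon> * (\<Sum>I | I \<in> hc_configs z2_adj \<Lambda> evens \<and> (\<lambda>z. z + (1, 0)) ` odd_segment M \<subseteq> I. l ^ card (I \<inter> \<Lambda>))"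
    (is "?P \<le> \<epsilon> * ?Q")
proof -
  let ?\<Omega> = "hc_configs z2_adj \<Lambda> evens" and ?S = "odd_segment M"
  define \<W> where "\<W> = {W. minimal_region (1, 0) W \<and> W \<subseteq> \<Lambda> \<and> ?S \<subseteq> W}"
  let ?T = "\<lambda>W. {I. I \<in> ?\<Omega> \<and> ?S \<subseteq> I \<and> insulated I W}"
  let ?u = "\<lambda>W. card (left_boundary W)"
  have fin\<W>: "finite \<W>" by (rule finite_subset[of _ "Pow \<Lambda>"]) (use \<Lambda> in \<open>auto simp: \<W>_def\<close>)
  have fin\<Omega>: "finite ?\<Omega>" by (rule finite_hc_configs) fact
  have s: "(1, 0) \<in> ?S" using M unfolding odd_segment_def by force
  have odd: "\<not> even_vertex (1, 0)" by (simp add: even_vertex.simps)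
  have W: "finite W" "odd_closed W" if "W \<in> \<W>" for W
    using that by (auto simp: \<W>_def minimal_region_def)
  have uM: "M \<le> ?u W" if "W \<in> \<W>" for W
  proof -
    have "M = card (fst ` ?S)" by (simp add: card_odd_segment)
    also have "\<dots> \<le> card (fst ` W)" using that W[OF that] by (intro card_mono) (auto simp: \<W>_def)
    also have "\<dots> \<le> ?u W" using W[OF that] by (rule card_columns_le)
    finally show ?thesis .
  qed
  have cover: "{I. I \<in> ?\<Omega> \<and> ?S \<subseteq> I} \<subseteq> (\<Union>W\<in>\<W>. ?T W)"
  proof clarify
    fix I assume I: "I \<in> ?\<Omega>" "?S \<subseteq> I"
    then have ind: "I \<in> independent_sets z2_adj" "I \<inter> - \<Lambda> = evens \<inter> - \<Lambda>" by (auto simp: hc_configs_def)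
    obtain W where W: "minimal_region (1, 0) W" "insulated I W"
      using insulated_region_exists[OF ind(1) \<Lambda>(1) ind(2) _ odd] I s by blast
    then have W': "finite W" "odd_closed W" "(1, 0) \<in> W" by (auto simp: minimal_region_def)
    have "W \<in> \<W>"
      using W region_within_box[OF W'(1,2) W(2) \<Lambda>(2) ind(2)] odd_segment_in_region[OF W'(2) W(2) I(2) W'(3)]
      by (simp add: \<W>_def)
    then show "I \<in> (\<Union>W\<in>\<W>. ?T W)" using I W by blast
  qed
  have Q0: "0 \<le> ?Q" using l by (intro sum_nonneg) simp
  have "?P \<le> (\<Sum>I\<in>(\<Union>W\<in>\<W>. ?T W). l ^ card (I \<inter> \<Lambda>))"
    using cover fin\<W> fin\<Omega> l by (intro sum_mono2) auto
  also have "\<dots> \<le> (\<Sum>W\<in>\<W>. \<Sum>I\<in>?T W. l ^ card (I \<inter> \<Lambda>))"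
    using fin\<W> fin\<Omega> l by (intro sum_le_sum_UN) auto
  also have "\<dots> \<le> (\<Sum>W\<in>\<W>. ?Q / (1 + l) ^ ?u W)"
  proof (rule sum_mono)
    fix W assume "W \<in> \<W>"
    then have "(\<Sum>I\<in>?T W. l ^ card (I \<inter> \<Lambda>)) * (1 + l) ^ ?u W \<le> ?Q"
      using shift_gain[OF _ \<Lambda>(1) W[OF \<open>W \<in> \<W>\<close>]] l by (simp add: \<W>_def)
    then show "(\<Sum>I\<in>?T W. l ^ card (I \<inter> \<Lambda>)) \<le> ?Q / (1 + l) ^ ?u W"
      using l by (simp add: pos_le_divide_eq)
  qed
  also have "\<dots> = (\<Sum>W\<in>\<W>. 1 / (1 + l) ^ ?u W) * ?Q"
    by (simp add: sum_distrib_right)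
  also have "(\<Sum>W\<in>\<W>. 1 / (1 + l) ^ ?u W) = (\<Sum>u\<in>?u ` \<W>. \<Sum>W | W \<in> \<W> \<and> ?u W = u. 1 / (1 + l) ^ ?u W)"
    by (rule sum.image_gen[OF fin\<W>])
  also have "\<dots> = (\<Sum>u\<in>?u ` \<W>. card {W. W \<in> \<W> \<and> ?u W = u} / (1 + l) ^ u)"
    by (intro sum.cong) auto
  also have "\<dots> \<le> (\<Sum>u\<in>?u ` \<W>. peierls_term l u)"
  proof (rule sum_mono)
    fix u assume "u \<in> ?u ` \<W>"
    then have u1: "1 \<le> 4 * u" using uM M by force
    have "{W. W \<in> \<W> \<and> ?u W = u} \<subseteq> {W. minimal_region (1, 0) W \<and> card (contour W) = 4 * u}"
      using card_contour W by (auto simp: \<W>_def)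
    then have "card {W. W \<in> \<W> \<and> ?u W = u} \<le> 4 * u * taxi_count (4 * u - 1)"
      using card_minimal_regions[OF odd u1] by (meson card_mono order_trans)
    then have "real (card {W. W \<in> \<W> \<and> ?u W = u}) \<le> real (4 * u * taxi_count (4 * u - 1))"
      by (simp only: of_nat_le_iff)
    then show "card {W. W \<in> \<W> \<and> ?u W = u} / (1 + l) ^ u \<le> peierls_term l u"
      unfolding peierls_term_def using l by (intro divide_right_mono) auto
  qed
  also have "\<dots> \<le> \<epsilon>" using uM fin\<W> by (intro \<epsilon>) auto
  finally show ?thesis using Q0 by (simp add: mult_right_mono)
qed

lemma peierls_sum_small:
  assumes l: "mu_taxi ^ 4 - 1 < l" and \<epsilon>: "0 < \<epsilon>"
  obtains M where "1 \<le> M" "\<And>F. finite F \<Longrightarrow> F \<subseteq> {M..} \<Longrightarrow> sum (peierls_term l) F \<le> \<epsilon>"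
proof -
  have mu1: "1 \<le> mu_taxi" by (rule mu_taxi_ge_1)
  have l1: "mu_taxi ^ 4 < 1 + l" using l by simp
  \<comment> \<open>Any growth rate strictly between \<open>mu_taxi\<close> and the fourth root of \<open>1 + l\<close> gives a geometric majorant.\<close>
  define r where "r = (mu_taxi + root 4 (1 + l)) / 2"
  have pos: "0 < 1 + l" using l1 mu1 by (smt (verit) zero_le_power)
  have "mu_taxi = root 4 (mu_taxi ^ 4)" using mu1 by (simp add: real_root_power_cancel)
  also have "\<dots> < root 4 (1 + l)" using l1 by simp
  finally have r: "mu_taxi < r" "r < root 4 (1 + l)" by (auto simp: r_def)
  have r1: "1 < r" using r mu1 by simp
  have "r ^ 4 < root 4 (1 + l) ^ 4" using r r1 by (intro power_strict_mono) auto
  then have r4: "r ^ 4 < 1 + l" using pos by simp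
  obtain C where C: "C > 0" "\<And>n. real (taxi_count n) \<le> C * r ^ n"
    using taxi_count_le_power[OF r(1)] by blast
  define x where "x = r ^ 4 / (1 + l)"
  have x: "0 < x" "x < 1" using r1 r4 pos by (auto simp: x_def)
  have term0: "0 \<le> peierls_term l u" for u
    unfolding peierls_term_def using pos by simp
  have bound: "peierls_term l u \<le> 4 * C * (of_nat u * x ^ u)" for u
  proof -
    have "real (taxi_count (4 * u - 1)) \<le> C * r ^ (4 * u - 1)" by (rule C)
    also have "\<dots> \<le> C * r ^ (4 * u)" using C(1) r1 by (intro mult_left_mono power_increasing) auto
    finally have "real (4 * u) * real (taxi_count (4 * u - 1)) \<le> real (4 * u) * (C * r ^ (4 * u))"
      by (rule mult_left_mono) simp
    then have "real (4 * u * taxi_count (4 * u - 1)) \<le> real (4 * u) * (C * r ^ (4 * u))" by simp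
    then have "peierls_term l u \<le> real (4 * u) * (C * r ^ (4 * u)) / (1 + l) ^ u"
      unfolding peierls_term_def using pos by (intro divide_right_mono) (auto simp: mult.assoc)
    also have "\<dots> = 4 * C * (of_nat u * x ^ u)"
      by (simp add: x_def power_divide power_mult)
    finally show ?thesis .
  qed
  have "summable (\<lambda>u. of_nat (Suc u) * x ^ u)"
    using geometric_deriv_sums[of x] x by (auto simp: sums_iff)
  then have "summable (\<lambda>u. of_nat u * x ^ u)"
    by (rule summable_comparison_test'[where N = 0]) (use x in \<open>auto intro!: mult_right_mono\<close>)
  then have "summable (\<lambda>u. 4 * C * (of_nat u * x ^ u))" by (rule summable_mult)
  then have sum: "summable (peierls_term l)"
    by (rule summable_comparison_test'[where N = 0]) (use bound term0 in simp)
  obtain N where N: "\<And>m n. N \<le> m \<Longrightarrow> norm (sum (peierls_term l) {m..<n}) < \<epsilon>"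
    using sum \<epsilon> unfolding summable_Cauchy by blast
  show thesis
  proof (rule that[of "Suc N"])
    fix F :: "nat set" assume F: "finite F" "F \<subseteq> {Suc N..}"
    have "F \<subseteq> {Suc N..<Suc (Max F)}" using F by (auto simp: less_Suc_eq_le)
    then have "sum (peierls_term l) F \<le> sum (peierls_term l) {Suc N..<Suc (Max F)}"
      using term0 by (intro sum_mono2) auto
    also have "\<dots> \<le> \<epsilon>" using N[of "Suc N" "Suc (Max F)"] by simp
    finally show "sum (peierls_term l) F \<le> \<epsilon>" .
  qed simp
qed

section \<open>Two Gibbs measures\<close>

lemma hard_core_z2: "0 < l \<Longrightarrow> hard_core z2_adj l"
proof
  fix v :: vertex
  have "{u. z2_adj u v \<or> z2_adj v u} \<subseteq> (\<lambda>d. v + d) ` units"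
  proof
    fix u assume "u \<in> {u. z2_adj u v \<or> z2_adj v u}"
    then have "u - v \<in> units" using minus_units[of "v - u"] by (auto simp: z2_adj_iff)
    then show "u \<in> (\<lambda>d. v + d) ` units" by (intro image_eqI[of _ _ "u - v"]) auto
  qed
  then show "finite {u. z2_adj u v \<or> z2_adj v u}" using finite_units finite_surj by blast
qed

definition square :: "nat \<Rightarrow> vertex set" where
  "square n = {- int n..int n} \<times> {- int n..int n}"

lemma square_exhausts:
  assumes "finite \<Lambda>"
  shows "eventually (\<lambda>n. \<Lambda> \<subseteq> square n) sequentially"
proof -
  have "eventually (\<lambda>n. z \<in> square n) sequentially" for z
  proof -
    obtain x y where z: "z = (x, y)" by (cases z)
    show ?thesis
      by (rule eventually_sequentiallyI[of "nat (\<bar>x\<bar> + \<bar>y\<bar>)"]) (auto simp: z square_def)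
  qed
  then have "eventually (\<lambda>n. \<forall>z\<in>\<Lambda>. z \<in> square n) sequentially"
    using assms by (intro eventually_ball_finite) auto
  then show ?thesis by (simp add: subset_eq)
qed

lemma escapable_square: "escapable (square n)"
  unfolding escapable_def
proof (intro allI impI)
  fix z assume z: "z \<notin> square n"
  obtain x y where xy: "z = (x, y)" by (cases z)
  from z consider "x > int n" | "x < - int n" | "y > int n" | "y < - int n"
    unfolding xy square_def by fastforce
  then show "\<exists>d\<in>units. \<forall>k. ray z d k \<notin> square n"
  proof cases
    case 1 then show ?thesis
      by (intro bexI[of _ "(1, 0)"]) (auto simp: xy ray_def square_def units_def)
  next
    case 2 then show ?thesis
      by (intro bexI[of _ "(-1, 0)"]) (auto simp: xy ray_def square_def units_def)
  next
    case 3 then show ?thesis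
      by (intro bexI[of _ "(0, 1)"]) (auto simp: xy ray_def square_def units_def)
  next
    case 4 then show ?thesis
      by (intro bexI[of _ "(0, -1)"]) (auto simp: xy ray_def square_def units_def)
  qed
qed

lemma evens_independent: "evens \<in> independent_sets z2_adj"
  by (auto simp: independent_sets_z2_iff evens_def even_vertex_add_unit simp del: split_paired_All)

lemma involution_configs:
  assumes inv: "\<And>v. \<phi> (\<phi> v) = v" and aut: "\<And>u v. adj (\<phi> u) (\<phi> v) = adj u v"
    and I: "I \<in> hc_configs adj \<Lambda> B"
  shows "\<phi> ` I \<in> hc_configs adj (\<phi> ` \<Lambda>) (\<phi> ` B)"
proof -
  have inj: "inj \<phi>" by (metis injI inv)
  have surj: "surj \<phi>" by (metis surjI inv)
  have "\<phi> ` (I \<inter> - \<Lambda>) = \<phi> ` (B \<inter> - \<Lambda>)" using I by (simp add: hc_configs_def)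
  then have "\<phi> ` I \<inter> - (\<phi> ` \<Lambda>) = \<phi> ` B \<inter> - (\<phi> ` \<Lambda>)"
    using inj surj by (simp add: image_Int bij_image_Compl_eq bij_def)
  moreover have "\<phi> ` I \<in> independent_sets adj"
    using I aut by (auto simp: hc_configs_def independent_sets_def)
  ultimately show ?thesis by (simp add: hc_configs_def)
qed

text \<open>The automorphism maps configurations to configurations in both directions and so reindexes the sums
  over configurations.\<close>

lemma (in hard_core) prob_hc_pmf_involution:
  assumes inv: "\<And>v. \<phi> (\<phi> v) = v" and aut: "\<And>u v. adj (\<phi> u) (\<phi> v) = adj u v"
    and \<Lambda>: "finite \<Lambda>" and B: "B \<in> independent_sets adj"
  shows "measure_pmf.prob (hc_pmf adj l (\<phi> ` \<Lambda>) (\<phi> ` B)) {I. \<phi> ` A \<subseteq> I} =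
    measure_pmf.prob (hc_pmf adj l \<Lambda> B) {I. A \<subseteq> I}"
proof -
  have inj: "inj \<phi>" by (metis injI inv)
  have ii: "\<phi> ` \<phi> ` X = X" for X by (simp add: image_image inv)
  have *: "(\<Sum>I | I \<in> hc_configs adj (\<phi> ` \<Lambda>) (\<phi> ` B) \<and> \<phi> ` A \<subseteq> I. l ^ card (I \<inter> \<phi> ` \<Lambda>)) =
      (\<Sum>I | I \<in> hc_configs adj \<Lambda> B \<and> A \<subseteq> I. l ^ card (I \<inter> \<Lambda>))" for A
  proof (rule sum.reindex_bij_witness[where i = "image \<phi>" and j = "image \<phi>"])
    fix I assume I: "I \<in> {I. I \<in> hc_configs adj (\<phi> ` \<Lambda>) (\<phi> ` B) \<and> \<phi> ` A \<subseteq> I}"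
    then have "\<phi> ` I \<in> hc_configs adj (\<phi> ` \<phi> ` \<Lambda>) (\<phi> ` \<phi> ` B)" by (intro involution_configs inv aut) simp
    moreover have "\<phi> ` \<phi> ` A \<subseteq> \<phi> ` I" using I by (intro image_mono) simp
    ultimately show "\<phi> ` I \<in> {I. I \<in> hc_configs adj \<Lambda> B \<and> A \<subseteq> I}" by (simp only: ii) simp
    have "\<phi> ` I \<inter> \<Lambda> = \<phi> ` (I \<inter> \<phi> ` \<Lambda>)" using inj by (simp only: image_Int ii)
    then show "l ^ card (\<phi> ` I \<inter> \<Lambda>) = l ^ card (I \<inter> \<phi> ` \<Lambda>)"
      using inj by (simp add: card_image inj_on_subset)
  next
    fix I assume I: "I \<in> {I. I \<in> hc_configs adj \<Lambda> B \<and> A \<subseteq> I}"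
    then have "\<phi> ` I \<in> hc_configs adj (\<phi> ` \<Lambda>) (\<phi> ` B)" by (intro involution_configs inv aut) simp
    moreover have "\<phi> ` A \<subseteq> \<phi> ` I" using I by (intro image_mono) simp
    ultimately show "\<phi> ` I \<in> {I. I \<in> hc_configs adj (\<phi> ` \<Lambda>) (\<phi> ` B) \<and> \<phi> ` A \<subseteq> I}" by simp
  qed (simp_all add: ii)
  have Z: "hc_partition adj l (\<phi> ` \<Lambda>) (\<phi> ` B) = hc_partition adj l \<Lambda> B"
    using *[of "{}"] by (simp add: hc_partition_eq)
  have "B \<in> hc_configs adj {} B" by (rule hc_configs_self[OF B])
  then have "\<phi> ` B \<in> independent_sets adj"
    using involution_configs[of \<phi> adj B "{}" B, OF inv aut] by (simp add: hc_configs_def)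
  then show ?thesis
    using *[of A] Z \<Lambda> B by (simp add: prob_hc_pmf)
qed

fun reflect :: "int \<Rightarrow> vertex \<Rightarrow> vertex" where
  "reflect c (x, y) = (c - x, y)"

lemma reflect_involution: "reflect c (reflect c v) = v"
  by (cases v) simp

lemma z2_adj_reflect: "z2_adj (reflect c u) (reflect c v) = z2_adj u v"
  by (cases u; cases v) (auto simp: abs_minus_commute)

text \<open>The reflection centre \<open>M + 1/2\<close> is halfway between the first odd vertex \<open>1\<close> and the last even
  vertex \<open>2 M\<close>.\<close>

lemma reflect_odd_segment:
  "reflect (2 * int M + 1) ` odd_segment M = (\<lambda>z. z + (1, 0)) ` odd_segment M"
proof -
  have 1: "reflect (2 * int M + 1) ` odd_segment M = (\<lambda>i. (2 * int (M - 1 - i) + 2, 0)) ` {..<M}"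
    unfolding odd_segment_def image_image by (intro image_cong) (auto simp: of_nat_diff)
  also have "\<dots> = (\<lambda>i. (2 * int i + 2, 0)) ` (\<lambda>i. M - 1 - i) ` {..<M}" by (simp add: image_image)
  also have "(\<lambda>i. M - 1 - i) ` {..<M} = {..<M}"
  proof (intro equalityI subsetI)
    fix i assume "i \<in> {..<M}"
    then show "i \<in> (\<lambda>i. M - 1 - i) ` {..<M}" by (intro image_eqI[of _ _ "M - 1 - i"]) auto
  qed auto
  also have "(\<lambda>i. (2 * int i + 2, 0)) ` {..<M} = (\<lambda>z. z + (1, 0)) ` odd_segment M"
    by (simp add: odd_segment_def image_image add.commute)
  finally show ?thesis .
qed

lemma odd_segment_independent: "odd_segment M \<in> independent_sets z2_adj"
proof -
  have "\<not> even_vertex z" if "z \<in> odd_segment M" for z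
    using that by (auto simp: odd_segment_def even_vertex.simps)
  then show ?thesis unfolding independent_sets_z2_iff using even_vertex_add_unit by blast
qed

theorem theorem2p3:
  fixes l :: real
  assumes "l > mu_taxi ^ 4 - 1"
  shows "\<exists>\<mu> \<nu>. hc_gibbs z2_adj l \<mu> \<and> hc_gibbs z2_adj l \<nu> \<and> \<mu> \<noteq> \<nu>"
proof -
  have "1 \<le> mu_taxi ^ 4" using mu_taxi_ge_1 by simp
  then have l: "0 < l" using assms by simp
  interpret hard_core z2_adj l by (rule hard_core_z2[OF l])
  obtain M where M: "1 \<le> M" "\<And>F. finite F \<Longrightarrow> F \<subseteq> {M..} \<Longrightarrow> sum (peierls_term l) F \<le> 1 / 2"
    using peierls_sum_small[OF assms, of "1 / 2"] by auto
  let ?S = "odd_segment M" and ?S' = "(\<lambda>z. z + (1, 0)) ` odd_segment M"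
  let ?\<phi> = "reflect (2 * int M + 1)"
  let ?p = "\<lambda>n. hc_pmf z2_adj l (square n) evens"
  \<comment> \<open>The reflected even sublattice is the odd sublattice.\<close>
  let ?q = "\<lambda>n. hc_pmf z2_adj l (?\<phi> ` square n) (?\<phi> ` evens)"
  let ?X = "independent_sets z2_adj"
  have fin: "finite (square n)" for n by (simp add: square_def)
  have finS: "finite ?S" "finite ?S'" by (auto simp: odd_segment_def)
  note refl = prob_hc_pmf_involution[of ?\<phi>, OF reflect_involution z2_adj_reflect fin evens_independent]
  have SS': "?\<phi> ` ?S = ?S'" by (rule reflect_odd_segment)
  have S'S: "?\<phi> ` ?S' = ?S"
    unfolding SS'[symmetric] by (simp only: image_image reflect_involution image_ident)
  have even: "measure_pmf.prob (?p n) {I. ?S \<subseteq> I} \<le> 1 / 2 * measure_pmf.prob (?p n) {I. ?S' \<subseteq> I}" for n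
    using peierls_finite_volume[OF l fin escapable_square M, of n] hc_partition_pos[OF fin evens_independent, of n]
    by (simp add: prob_hc_pmf[OF fin evens_independent] divide_right_mono field_simps)
  have odd: "measure_pmf.prob (?q n) {I. ?S' \<subseteq> I} \<le> 1 / 2 * measure_pmf.prob (?q n) {I. ?S \<subseteq> I}" for n
    using even[of n] refl[of n ?S] refl[of n ?S'] unfolding SS' S'S by simp
  obtain G \<mu> where G: "G \<noteq> bot" "G \<le> sequentially" and \<mu>: "hc_gibbs z2_adj l \<mu>"
    and pos: "\<And>A. finite A \<Longrightarrow> A \<in> ?X \<Longrightarrow> 0 < measure \<mu> {I \<in> ?X. A \<subseteq> I}"
    and lim: "\<And>A. finite A \<Longrightarrow> ((\<lambda>n. measure_pmf.prob (?p n) {I. A \<subseteq> I}) \<longlongrightarrow> measure \<mu> {I \<in> ?X. A \<subseteq> I}) G"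
    by (rule gibbs_limit_exists[of square "\<lambda>_. evens", OF fin square_exhausts evens_independent]) (assumption, rule that)
  have exh: "eventually (\<lambda>n. \<Lambda> \<subseteq> ?\<phi> ` square n) sequentially" if "finite \<Lambda>" for \<Lambda>
  proof -
    have "eventually (\<lambda>n. ?\<phi> ` \<Lambda> \<subseteq> square n) sequentially" using that by (intro square_exhausts) simp
    then show ?thesis
    proof eventually_elim
      case (elim n)
      then have "?\<phi> ` ?\<phi> ` \<Lambda> \<subseteq> ?\<phi> ` square n" by (rule image_mono)
      then show ?case by (simp add: image_image reflect_involution)
    qed
  qed
  have odds: "?\<phi> ` evens \<in> ?X"
    using involution_configs[of ?\<phi> z2_adj evens "{}" evens, OF reflect_involution z2_adj_reflect]
      hc_configs_self[OF evens_independent] by (simp add: hc_configs_def)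
  have fin': "finite (?\<phi> ` square n)" for n using fin by simp
  obtain H \<nu> where H: "H \<noteq> bot" "H \<le> sequentially" and \<nu>: "hc_gibbs z2_adj l \<nu>"
    and pos': "\<And>A. finite A \<Longrightarrow> A \<in> ?X \<Longrightarrow> 0 < measure \<nu> {I \<in> ?X. A \<subseteq> I}"
    and lim': "\<And>A. finite A \<Longrightarrow> ((\<lambda>n. measure_pmf.prob (?q n) {I. A \<subseteq> I}) \<longlongrightarrow> measure \<nu> {I \<in> ?X. A \<subseteq> I}) H"
    by (rule gibbs_limit_exists[of "\<lambda>n. ?\<phi> ` square n" "\<lambda>_. ?\<phi> ` evens", OF fin' exh odds]) (assumption, rule that)
  have 1: "measure \<mu> {I \<in> ?X. ?S \<subseteq> I} \<le> 1 / 2 * measure \<mu> {I \<in> ?X. ?S' \<subseteq> I}"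
    by (rule tendsto_le[OF G(1) tendsto_mult[OF tendsto_const lim[OF finS(2)]] lim[OF finS(1)]])
      (use even in simp)
  have 2: "measure \<nu> {I \<in> ?X. ?S' \<subseteq> I} \<le> 1 / 2 * measure \<nu> {I \<in> ?X. ?S \<subseteq> I}"
    by (rule tendsto_le[OF H(1) tendsto_mult[OF tendsto_const lim'[OF finS(1)]] lim'[OF finS(2)]])
      (use odd in simp)
  \<comment> \<open>If the measures were equal, the probability of \<open>S\<close> would be at most a quarter of itself.\<close>
  have "\<mu> \<noteq> \<nu>" using 1 2 pos[OF finS(1) odd_segment_independent] by auto
  then show ?thesis using \<mu> \<nu> by blast
qed

end
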